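(* Let $T$ be the Oseen solution operator and $T^S$ the Stokes solution operator (both defined in the context). There is a constant $C_\nu>0$, depending on $\nu$ (and on $\Omega$) but not on $\boldsymbol{f}$ or $\boldsymbol\beta$, such that for every $\boldsymbol{f}\in L^2(\Omega,\mathbb{C})^d$ $$\|(T-T^S)\boldsymbol{f}\|_{1,\Omega}\le C_\nu\,\|\boldsymbol\beta\|_{\infty,\Omega}\,\|\boldsymbol{f}\|_{0,\Omega}.$$
   Context: Let $d\in\{2,3\}$ and let $\Omega\subset\mathbb{R}^d$ be an open bounded polygonal/polyhedral domain with Lipschitz boundary. Let $\nu>0$ be a constant with $\nu^-<\nu<\nu^+$ for fixed positive numbers $\nu^-,\nu^+$, and let $\boldsymbol\beta\in W^{1,\infty}(\Omega)^d$ be a real, divergence-free vector field; $\|\cdot\|_{\infty,\Omega}$ denotes the $W^{1,\infty}(\Omega)$ norm, $\|\cdot\|_{r,\Omega}$ the $H^r(\Omega)$ norm (with $H^0=L^2$). $H_0^1(\Omega,\mathbb{C})$ is the space of $H^1$ functions with zero trace and $L_0^2(\Omega,\mathbb{C})$ the space of $L^2$ functions with zero mean. Write $(\boldsymbol u,\boldsymbol v)=\int_\Omega \boldsymbol u\cdot\overline{\boldsymbol v}$. The Oseen operator $T:L^2(\Omega,\mathbb{C})^d\to H_0^1(\Omega,\mathbb{C})^d$ is $T\boldsymbol f:=\widehat{\boldsymbol u}$, where $(\widehat{\boldsymbol u},\widehat p)\in H_0^1(\Omega,\mathbb{C})^d\times L_0^2(\Omega,\mathbb{C})$ is the unique solution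 of $$\int_\Omega\nu\nabla\widehat{\boldsymbol u}:\overline{\nabla\boldsymbol v}+\int_\Omega(\boldsymbol\beta\cdot\nabla)\widehat{\boldsymbol u}\cdot\overline{\boldsymbol v}-\int_\Omega\widehat p\,\overline{\operatorname{div}\boldsymbol v}=(\boldsymbol f,\boldsymbol v)\quad\forall\boldsymbol v\in H_0^1(\Omega,\mathbb{C})^d,\qquad \int_\Omega \overline{q}\,\operatorname{div}\widehat{\boldsymbol u}=0\quad\forall q\in L_0^2(\Omega,\mathbb{C}).$$ The Stokes operator $T^S:L^2(\Omega,\mathbb{C})^d\to H_0^1(\Omega,\mathbb{C})^d$ is $T^S\boldsymbol f:=\widehat{\boldsymbol u}^S$, where $(\widehat{\boldsymbol u}^S,\widehat p^S)\in H_0^1(\Omega,\mathbb{C})^d\times L_0^2(\Omega,\mathbb{C})$ is the unique solution of the same problem with the convective term $\int_\Omega(\boldsymbol\beta\cdot\nabla)\widehat{\boldsymbol u}\cdot\overline{\boldsymbol v}$ removed. *)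

theory Defs
  imports "HOL-Analysis.Analysis" "HOL-Probability.Essential_Supremum"
begin

text \<open>Elements of Lebesgue and Sobolev spaces are represented by functions, i.e. the spaces below
  are spaces of representatives; equality of classes is equality almost everywhere. Values of a
  function outside the domain \<open>\<Omega>\<close> are irrelevant.\<close>

section \<open>Smooth functions and test functions\<close>

primrec cont_diff :: "nat \<Rightarrow> ('a::euclidean_space \<Rightarrow> 'b::real_normed_vector) \<Rightarrow> bool" where
  "cont_diff 0 f \<longleftrightarrow> continuous_on UNIV f"
| "cont_diff (Suc k) f \<longleftrightarrow>
     (\<forall>x. f differentiable (at x)) \<and> (\<forall>v. cont_diff k (\<lambda>x. frechet_derivative f (at x) v))"

definition smooth :: "('a::euclidean_space \<Rightarrow> 'b::real_normed_vector) \<Rightarrow> bool" where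
  "smooth f \<longleftrightarrow> (\<forall>k. cont_diff k f)"

definition test_function :: "'a::euclidean_space set \<Rightarrow> ('a \<Rightarrow> real) \<Rightarrow> bool" where
  "test_function \<Omega> \<phi> \<longleftrightarrow>
     smooth \<phi> \<and> compact (closure {x. \<phi> x \<noteq> 0}) \<and> closure {x. \<phi> x \<noteq> 0} \<subseteq> \<Omega>"

section \<open>Lebesgue spaces\<close>

definition L2 :: "'a measure \<Rightarrow> ('a \<Rightarrow> 'b::euclidean_space) \<Rightarrow> bool" where
  "L2 M f \<longleftrightarrow> f \<in> borel_measurable M \<and> integrable M (\<lambda>x. (norm (f x))\<^sup>2)"

definition l2_norm :: "'a measure \<Rightarrow> ('a \<Rightarrow> 'b::euclidean_space) \<Rightarrow> real" where
  "l2_norm M f = sqrt (\<integral>x. (norm (f x))\<^sup>2 \<partial>M)"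

definition L2_zero_mean :: "'a::euclidean_space set \<Rightarrow> ('a \<Rightarrow> complex) \<Rightarrow> bool" where
  "L2_zero_mean \<Omega> q \<longleftrightarrow> L2 (lebesgue_on \<Omega>) q \<and> (\<integral>x. q x \<partial>(lebesgue_on \<Omega>)) = 0"

definition Linf :: "'a measure \<Rightarrow> ('a \<Rightarrow> 'b::euclidean_space) \<Rightarrow> bool" where
  "Linf M f \<longleftrightarrow> f \<in> borel_measurable M \<and> esssup M (\<lambda>x. ereal (norm (f x))) < \<infinity>"

definition linf_norm :: "'a measure \<Rightarrow> ('a \<Rightarrow> 'b::euclidean_space) \<Rightarrow> real" where
  "linf_norm M f = real_of_ereal (esssup M (\<lambda>x. ereal (norm (f x))))"

section \<open>Weak derivatives and Sobolev spaces\<close>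

definition locally_integrable :: "'a::euclidean_space set \<Rightarrow> ('a \<Rightarrow> 'b::euclidean_space) \<Rightarrow> bool" where
  "locally_integrable \<Omega> u \<longleftrightarrow> (\<forall>K. compact K \<and> K \<subseteq> \<Omega> \<longrightarrow> integrable (lebesgue_on K) u)"

definition has_weak_deriv ::
  "(real^'n) set \<Rightarrow> 'n \<Rightarrow> (real^'n \<Rightarrow> 'b::euclidean_space) \<Rightarrow> (real^'n \<Rightarrow> 'b) \<Rightarrow> bool" where
  "has_weak_deriv \<Omega> j u g \<longleftrightarrow>
     locally_integrable \<Omega> u \<and> locally_integrable \<Omega> g \<and>
     (\<forall>\<phi>. test_function \<Omega> \<phi> \<longrightarrow>
        (\<integral>x. frechet_derivative \<phi> (at x) (axis j 1) *\<^sub>R u x \<partial>(lebesgue_on \<Omega>)) =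
        - (\<integral>x. \<phi> x *\<^sub>R g x \<partial>(lebesgue_on \<Omega>)))"

text \<open>On an open set \<open>has_weak_deriv\<close> determines the derivative up to null sets; \<open>wderiv\<close> picks a
  representative.\<close>

definition wderiv ::
  "(real^'n) set \<Rightarrow> 'n \<Rightarrow> (real^'n \<Rightarrow> 'b::euclidean_space) \<Rightarrow> (real^'n \<Rightarrow> 'b)" where
  "wderiv \<Omega> j u = (SOME g. has_weak_deriv \<Omega> j u g)"

text \<open>Entry \<open>(i, j)\<close> of the gradient is the derivative of the \<open>i\<close>-th component in direction
  \<open>j\<close>.\<close>

definition wgrad ::
  "(real^'n) set \<Rightarrow> (real^'n \<Rightarrow> ('b::euclidean_space)^'n) \<Rightarrow> (real^'n \<Rightarrow> 'b^'n^'n)" where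
  "wgrad \<Omega> u x = (\<chi> i j. wderiv \<Omega> j u x $ i)"

definition wdiv ::
  "(real^'n) set \<Rightarrow> (real^'n \<Rightarrow> ('b::euclidean_space)^'n) \<Rightarrow> (real^'n \<Rightarrow> 'b)" where
  "wdiv \<Omega> u x = (\<Sum>i\<in>UNIV. wderiv \<Omega> i u x $ i)"

definition H1 :: "(real^'n) set \<Rightarrow> (real^'n \<Rightarrow> 'b::euclidean_space) \<Rightarrow> bool" where
  "H1 \<Omega> u \<longleftrightarrow>
     L2 (lebesgue_on \<Omega>) u \<and> (\<forall>j. \<exists>g. has_weak_deriv \<Omega> j u g \<and> L2 (lebesgue_on \<Omega>) g)"

definition h1_norm :: "(real^'n) set \<Rightarrow> (real^'n \<Rightarrow> 'b::euclidean_space) \<Rightarrow> real" where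
  "h1_norm \<Omega> u =
     sqrt ((l2_norm (lebesgue_on \<Omega>) u)\<^sup>2 + (\<Sum>j\<in>UNIV. (l2_norm (lebesgue_on \<Omega>) (wderiv \<Omega> j u))\<^sup>2))"

definition W1inf :: "(real^'n) set \<Rightarrow> (real^'n \<Rightarrow> real^'n) \<Rightarrow> bool" where
  "W1inf \<Omega> \<beta> \<longleftrightarrow>
     Linf (lebesgue_on \<Omega>) \<beta> \<and> (\<forall>j. \<exists>g. has_weak_deriv \<Omega> j \<beta> g \<and> Linf (lebesgue_on \<Omega>) g)"

text \<open>Pointwise, the Euclidean norm of the field and the Frobenius norm of its gradient are
  used.\<close>

definition w1inf_norm :: "(real^'n) set \<Rightarrow> (real^'n \<Rightarrow> real^'n) \<Rightarrow> real" where
  "w1inf_norm \<Omega> \<beta> = max (linf_norm (lebesgue_on \<Omega>) \<beta>) (linf_norm (lebesgue_on \<Omega>) (wgrad \<Omega> \<beta>))"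

definition divergence_free :: "(real^'n) set \<Rightarrow> (real^'n \<Rightarrow> real^'n) \<Rightarrow> bool" where
  "divergence_free \<Omega> \<beta> \<longleftrightarrow> (AE x in lebesgue_on \<Omega>. wdiv \<Omega> \<beta> x = 0)"

section \<open>Surface measure, traces and functions with zero trace\<close>

text \<open>The \<open>s\<close>-dimensional Hausdorff outer measure for \<open>s \<ge> 1\<close>, normalised so that for
  \<open>s = d - 1\<close> it is the surface measure on hypersurfaces of Euclidean \<open>d\<close>-space. (For \<open>s = 0\<close>
  the convention \<open>0 ^ 0 = 1\<close> would spoil the contribution of the empty set.) It is a metric outer
  measure, hence a measure on the Borel sets by Caratheodory's criterion, so \<open>measure_of\<close> yields
  the intended measure.\<close>

definition hausdorff_outer :: "nat \<Rightarrow> 'a::metric_space set \<Rightarrow> ennreal" where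
  "hausdorff_outer s A =
     (SUP \<delta>\<in>{0<..}.
        INF U\<in>{U :: nat \<Rightarrow> 'a set. A \<subseteq> (\<Union>n. U n) \<and> (\<forall>n. bounded (U n) \<and> diameter (U n) \<le> \<delta>)}.
          (\<Sum>n. ennreal (unit_ball_vol (real s) * (diameter (U n) / 2) ^ s)))"

definition hausdorff_measure :: "nat \<Rightarrow> 'a::metric_space measure" where
  "hausdorff_measure s = measure_of UNIV (sets borel) (hausdorff_outer s)"

definition boundary_measure :: "(real^'n) set \<Rightarrow> (real^'n) measure" where
  "boundary_measure \<Omega> = restrict_space (hausdorff_measure (CARD('n) - 1)) (frontier \<Omega>)"

text \<open>The trace operator is the continuous extension to \<open>H\<^sup>1(\<Omega>)\<close> of the restriction to the
  boundary of functions that are smooth up to the boundary; on a bounded Lipschitz domain the trace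
  \<open>g\<close> of \<open>u\<close> is therefore characterised by the following graph.\<close>

definition has_trace ::
  "(real^'n) set \<Rightarrow> (real^'n \<Rightarrow> 'b::euclidean_space) \<Rightarrow> (real^'n \<Rightarrow> 'b) \<Rightarrow> bool" where
  "has_trace \<Omega> u g \<longleftrightarrow>
     H1 \<Omega> u \<and> L2 (boundary_measure \<Omega>) g \<and>
     (\<exists>\<phi> :: nat \<Rightarrow> real^'n \<Rightarrow> 'b. (\<forall>n. smooth (\<phi> n)) \<and>
        (\<lambda>n. h1_norm \<Omega> (\<lambda>x. \<phi> n x - u x)) \<longlonglongrightarrow> 0 \<and>
        (\<lambda>n. l2_norm (boundary_measure \<Omega>) (\<lambda>x. \<phi> n x - g x)) \<longlonglongrightarrow> 0)"

definition H10 :: "(real^'n) set \<Rightarrow> (real^'n \<Rightarrow> 'b::euclidean_space) \<Rightarrow> bool" where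
  "H10 \<Omega> u \<longleftrightarrow> H1 \<Omega> u \<and> has_trace \<Omega> u (\<lambda>x. 0)"

section \<open>Polyhedral Lipschitz domains\<close>

definition polyhedral_boundary :: "(real^'n) set \<Rightarrow> bool" where
  "polyhedral_boundary \<Omega> \<longleftrightarrow>
     (\<exists>F. finite F \<and> (\<forall>P\<in>F. polytope P \<and> aff_dim P = int CARD('n) - 1) \<and> frontier \<Omega> = \<Union>F)"

text \<open>Near every boundary point, \<open>\<Omega>\<close> lies strictly on one side of the graph, in direction of some
  unit vector \<open>e\<close>, of a Lipschitz function \<open>\<gamma>\<close> on the orthogonal complement of \<open>e\<close>.\<close>

definition lipschitz_boundary :: "(real^'n) set \<Rightarrow> bool" where
  "lipschitz_boundary \<Omega> \<longleftrightarrow>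
     (\<forall>x\<in>frontier \<Omega>. \<exists>r>0. \<exists>e L \<gamma>. norm e = 1 \<and> L-lipschitz_on {z. z \<bullet> e = 0} \<gamma> \<and>
        \<Omega> \<inter> ball x r = {y \<in> ball x r. \<gamma> (y - (y \<bullet> e) *\<^sub>R e) < y \<bullet> e})"

definition polyhedral_lipschitz_domain :: "(real^'n) set \<Rightarrow> bool" where
  "polyhedral_lipschitz_domain \<Omega> \<longleftrightarrow>
     open \<Omega> \<and> bounded \<Omega> \<and> connected \<Omega> \<and> \<Omega> \<noteq> {} \<and> polyhedral_boundary \<Omega> \<and> lipschitz_boundary \<Omega>"

section \<open>Oseen and Stokes operators\<close>

definition cdot :: "complex^'n \<Rightarrow> complex^'n \<Rightarrow> complex" where
  "cdot a b = (\<Sum>i\<in>UNIV. a $ i * cnj (b $ i))"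

definition cddot :: "complex^'n^'n \<Rightarrow> complex^'n^'n \<Rightarrow> complex" where
  "cddot A B = (\<Sum>i\<in>UNIV. \<Sum>j\<in>UNIV. A $ i $ j * cnj (B $ i $ j))"

definition convection ::
  "(real^'n) set \<Rightarrow> (real^'n \<Rightarrow> real^'n) \<Rightarrow> (real^'n \<Rightarrow> complex^'n) \<Rightarrow> (real^'n \<Rightarrow> complex^'n)" where
  "convection \<Omega> \<beta> u x = (\<Sum>j\<in>UNIV. (\<beta> x $ j) *\<^sub>R wderiv \<Omega> j u x)"

definition oseen_solution ::
  "(real^'n) set \<Rightarrow> real \<Rightarrow> (real^'n \<Rightarrow> real^'n) \<Rightarrow> (real^'n \<Rightarrow> complex^'n) \<Rightarrow>
   (real^'n \<Rightarrow> complex^'n) \<Rightarrow> (real^'n \<Rightarrow> complex) \<Rightarrow> bool" where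
  "oseen_solution \<Omega> \<nu> \<beta> f u p \<longleftrightarrow>
     H10 \<Omega> u \<and> L2_zero_mean \<Omega> p \<and>
     (\<forall>v. H10 \<Omega> v \<longrightarrow>
        (\<integral>x. of_real \<nu> * cddot (wgrad \<Omega> u x) (wgrad \<Omega> v x) \<partial>(lebesgue_on \<Omega>))
        + (\<integral>x. cdot (convection \<Omega> \<beta> u x) (v x) \<partial>(lebesgue_on \<Omega>))
        - (\<integral>x. p x * cnj (wdiv \<Omega> v x) \<partial>(lebesgue_on \<Omega>))
        = (\<integral>x. cdot (f x) (v x) \<partial>(lebesgue_on \<Omega>))) \<and>
     (\<forall>q. L2_zero_mean \<Omega> q \<longrightarrow> (\<integral>x. cnj (q x) * wdiv \<Omega> u x \<partial>(lebesgue_on \<Omega>)) = 0)"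

definition stokes_solution ::
  "(real^'n) set \<Rightarrow> real \<Rightarrow> (real^'n \<Rightarrow> complex^'n) \<Rightarrow>
   (real^'n \<Rightarrow> complex^'n) \<Rightarrow> (real^'n \<Rightarrow> complex) \<Rightarrow> bool" where
  "stokes_solution \<Omega> \<nu> f u p \<longleftrightarrow>
     H10 \<Omega> u \<and> L2_zero_mean \<Omega> p \<and>
     (\<forall>v. H10 \<Omega> v \<longrightarrow>
        (\<integral>x. of_real \<nu> * cddot (wgrad \<Omega> u x) (wgrad \<Omega> v x) \<partial>(lebesgue_on \<Omega>))
        - (\<integral>x. p x * cnj (wdiv \<Omega> v x) \<partial>(lebesgue_on \<Omega>))
        = (\<integral>x. cdot (f x) (v x) \<partial>(lebesgue_on \<Omega>))) \<and>
     (\<forall>q. L2_zero_mean \<Omega> q \<longrightarrow> (\<integral>x. cnj (q x) * wdiv \<Omega> u x \<partial>(lebesgue_on \<Omega>)) = 0)"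

text \<open>\<open>T\<close> is the velocity solution operator if it maps every square-integrable right-hand side to
  (a representative of) the velocity of the corresponding solution, which is unique almost
  everywhere.\<close>

definition oseen_operator ::
  "(real^'n) set \<Rightarrow> real \<Rightarrow> (real^'n \<Rightarrow> real^'n) \<Rightarrow>
   ((real^'n \<Rightarrow> complex^'n) \<Rightarrow> (real^'n \<Rightarrow> complex^'n)) \<Rightarrow> bool" where
  "oseen_operator \<Omega> \<nu> \<beta> T \<longleftrightarrow>
     (\<forall>f. L2 (lebesgue_on \<Omega>) f \<longrightarrow> (\<exists>p. oseen_solution \<Omega> \<nu> \<beta> f (T f) p))"

definition stokes_operator ::
  "(real^'n) set \<Rightarrow> real \<Rightarrow> ((real^'n \<Rightarrow> complex^'n) \<Rightarrow> (real^'n \<Rightarrow> complex^'n)) \<Rightarrow> bool" where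
  "stokes_operator \<Omega> \<nu> T \<longleftrightarrow>
     (\<forall>f. L2 (lebesgue_on \<Omega>) f \<longrightarrow> (\<exists>p. stokes_solution \<Omega> \<nu> f (T f) p))"

end

theory Submission
  imports Defs
begin

text \<open>Write \<open>u = T f\<close>, \<open>u\<^sub>S = T\<^sup>S f\<close> and \<open>w = u - u\<^sub>S\<close>. All three are weakly divergence free with zero
  trace, so the pressures disappear when the two problems are tested with \<open>u\<close> and \<open>u\<^sub>S\<close>. Taking real
  parts (\<open>real_weak_form\<close>) leaves two energy identities:
  \<^item> \<open>\<nu> \<parallel>\<nabla>u\<parallel>\<^sup>2 + ((\<beta> \<cdot> \<nabla>)u, u) = (f, u)\<close>, where the convective term vanishes because \<open>\<beta>\<close> is divergence
    free (\<open>convection_skew\<close>). With the Poincare inequality (\<open>poincare\<close>) this bounds \<open>\<parallel>\<nabla>u\<parallel>\<close> by a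
    multiple of \<open>\<parallel>f\<parallel>\<close> that does not depend on \<open>\<beta>\<close>.
  \<^item> \<open>\<nu> \<parallel>\<nabla>w\<parallel>\<^sup>2 = - ((\<beta> \<cdot> \<nabla>)u, w)\<close>, whose right-hand side is at most a multiple of
    \<open>\<parallel>\<beta>\<parallel> \<parallel>\<nabla>u\<parallel> \<parallel>\<nabla>w\<parallel>\<close>.

  Both the Poincare inequality and the skew-symmetry are elementary for smooth fields with compact
  support in \<open>\<Omega>\<close>; for the latter, \<open>2 ((\<beta> \<cdot> \<nabla>)\<psi>) \<cdot> \<psi> = \<beta> \<cdot> \<nabla>\<bar>\<psi>\<bar>\<^sup>2\<close> and \<open>\<bar>\<psi>\<bar>\<^sup>2\<close> is a test function. The
  heart of the development is therefore the density theorem \<open>H10_test_approximable\<close>: a function of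
  \<open>H\<^sup>1(\<Omega>)\<close> with zero trace is an \<open>H\<^sup>1\<close>-limit of such fields. Zero trace means that there are smooth
  \<open>\<phi>\<^sub>n\<close> which converge to \<open>u\<close> in \<open>H\<^sup>1(\<Omega>)\<close> and to \<open>0\<close> in \<open>L\<^sup>2\<close> of the boundary with respect to the
  Hausdorff measure. One multiplies \<open>\<phi>\<^sub>n\<close> by a cutoff with gradient of order \<open>1 / \<epsilon>\<close> that is \<open>1\<close> away
  from the strip of width \<open>\<epsilon>\<close> along the boundary. The product converges because the mass of \<open>\<phi>\<^sub>n\<close> in
  the strip satisfies (\<open>strip_estimate\<close>)
  \<open>\<integral>\<^bsub>strip\<^esub> \<bar>\<phi>\<bar>\<^sup>2 \<le> c(\<epsilon>) \<integral>\<^bsub>\<partial>\<Omega>\<^esub> \<bar>\<phi>\<bar>\<^sup>2 + C \<epsilon>\<^sup>2 \<integral>\<^bsub>wider strip\<^esub> \<bar>\<nabla>\<phi>\<bar>\<^sup>2\<close>: first let \<open>n\<close> tend to infinity, which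
  removes the boundary term whatever \<open>c(\<epsilon>)\<close> is, then let \<open>\<epsilon>\<close> tend to \<open>0\<close>, when the gradient of \<open>u\<close>
  has vanishing mass in the strip.

  The strip estimate comes from following, in each Lipschitz chart, the segments in the chart
  direction down to the boundary (\<open>segment_estimate\<close>, \<open>lipschitz_graph_descent\<close>) and from comparing
  Lebesgue measure with Hausdorff measure under the projection along these segments
  (\<open>projection_integral_le\<close>). The comparison only needs the upper bound that coverings give. It
  presupposes that \<open>hausdorff_measure\<close> is the measure that it is meant to be, which is Caratheodory's
  criterion (\<open>emeasure_hausdorff_measure\<close>), and that the boundary has finite measure, which is where
  its polyhedral shape enters (\<open>hausdorff_outer_polyhedral_boundary_finite\<close>).\<close>

section \<open>Smooth functions and cutoffs\<close>

lemma cont_diff_SucI: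
  assumes "\<And>x. (f has_derivative f' x) (at x)" and "\<And>v. cont_diff k (\<lambda>x. f' x v)"
  shows "cont_diff (Suc k) f"
proof -
  have "frechet_derivative f (at x) = f' x" for x
    using assms(1) by (rule frechet_derivative_at[symmetric])
  then show ?thesis
    using assms by (auto simp: differentiable_def)
qed

lemma cont_diff_Suc_imp_continuous:
  "cont_diff (Suc k) f \<Longrightarrow> continuous_on UNIV f"
  by (auto intro!: continuous_at_imp_continuous_on differentiable_imp_continuous_within)

lemma cont_diff_SucD: "cont_diff (Suc k) f \<Longrightarrow> cont_diff k f"
proof (induction k arbitrary: f)
  case 0
  then show ?case using cont_diff_Suc_imp_continuous[OF 0] by simp
next
  case (Suc k)
  then show ?case by (metis cont_diff.simps(2))
qed

lemma cont_diff_has_derivative: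
  "cont_diff (Suc k) f \<Longrightarrow> (f has_derivative frechet_derivative f (at x)) (at x)"
  by (simp add: frechet_derivative_works[symmetric])

lemma cont_diff_const: "cont_diff k (\<lambda>x. c)"
  by (induction k arbitrary: c) (auto intro!: cont_diff_SucI[where f'="\<lambda>x v. 0"])

lemma cont_diff_add: "cont_diff k f \<Longrightarrow> cont_diff k g \<Longrightarrow> cont_diff k (\<lambda>x. f x + g x)"
proof (induction k arbitrary: f g)
  case 0
  then show ?case by (auto intro: continuous_on_add)
next
  case (Suc k)
  show ?case
    by (rule cont_diff_SucI[OF has_derivative_add[OF Suc.prems[THEN cont_diff_has_derivative]]])
       (use Suc in auto)
qed

text \<open>One induction for all products: the derivative of a product is a sum of products of the same kind.\<close>

lemma cont_diff_bilinear:
  assumes "bounded_bilinear prd"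
  shows "cont_diff k f \<Longrightarrow> cont_diff k g \<Longrightarrow> cont_diff k (\<lambda>x. prd (f x) (g x))"
proof (induction k arbitrary: f g)
  case 0
  then show ?case by (auto intro: bounded_bilinear.continuous_on[OF assms])
next
  case (Suc k)
  show ?case
    by (rule cont_diff_SucI[OF bounded_bilinear.FDERIV[OF assms Suc.prems[THEN cont_diff_has_derivative]]])
       (intro cont_diff_add Suc.IH; use Suc.prems Suc.prems[THEN cont_diff_SucD] in simp)
qed

lemma cont_diff_prod:
  fixes f :: "'i \<Rightarrow> 'a::euclidean_space \<Rightarrow> real"
  assumes "\<And>i. i \<in> I \<Longrightarrow> cont_diff k (f i)"
  shows "cont_diff k (\<lambda>x. \<Prod>i\<in>I. f i x)"
  using assms
  by (induction I rule: infinite_finite_induct)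
     (auto intro: cont_diff_const cont_diff_bilinear[OF bounded_bilinear_mult])

text \<open>The only chain rule that the cutoffs require: they are products of functions of one variable
  applied to the coordinates.\<close>

lemma cont_diff_compose_affine:
  fixes h :: "real \<Rightarrow> 'b::real_normed_vector"
  assumes l: "bounded_linear (l :: 'a::euclidean_space \<Rightarrow> real)"
  shows "cont_diff k h \<Longrightarrow> cont_diff k (\<lambda>x. h (l x + b))"
proof (induction k arbitrary: h)
  case 0
  have "continuous_on UNIV (\<lambda>x. l x + b)"
    by (intro continuous_intros linear_continuous_on[OF l])
  with 0 show ?case
    using continuous_on_compose2[of UNIV h UNIV "\<lambda>x. l x + b"] by auto
next
  case (Suc k)
  have lin: "((\<lambda>x. l x + b) has_derivative l) (at x)" for x
    using has_derivative_add[OF bounded_linear_imp_has_derivative[OF l] has_derivative_const] by simp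
  have hd: "(h has_derivative frechet_derivative h (at t)) (at t)" for t
    using Suc.prems by (rule cont_diff_has_derivative)
  have eq: "frechet_derivative h (at t) r = r *\<^sub>R frechet_derivative h (at t) 1" for t r
    using linear_cmul[OF linear_frechet_derivative, of h "at t" r 1] Suc.prems by simp
  show ?case
  proof (rule cont_diff_SucI)
    show "((\<lambda>x. h (l x + b)) has_derivative (\<lambda>v. l v *\<^sub>R frechet_derivative h (at (l x + b)) 1)) (at x)" for x
      using has_derivative_compose[OF lin hd] by (subst (asm) eq)
    show "cont_diff k (\<lambda>x. l v *\<^sub>R frechet_derivative h (at (l x + b)) 1)" for v
      by (rule cont_diff_bilinear[OF bounded_bilinear_scaleR cont_diff_const Suc.IH]) (use Suc.prems in simp)
  qed
qed

lemma smooth_const: "smooth (\<lambda>x. c)"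
  and smooth_add: "smooth f \<Longrightarrow> smooth g \<Longrightarrow> smooth (\<lambda>x. f x + g x)"
  and smooth_bilinear: "bounded_bilinear prd \<Longrightarrow> smooth f \<Longrightarrow> smooth f' \<Longrightarrow> smooth (\<lambda>x. prd (f x) (f' x))"
  and smooth_prod: "(\<And>i. i \<in> I \<Longrightarrow> smooth (F i)) \<Longrightarrow> smooth (\<lambda>x. \<Prod>i\<in>I. (F i x :: real))"
  and smooth_compose_affine: "bounded_linear (l :: _ \<Rightarrow> real) \<Longrightarrow> smooth h \<Longrightarrow> smooth (\<lambda>x. h (l x + b))"
  unfolding smooth_def
  by (simp_all add: cont_diff_const cont_diff_add cont_diff_bilinear cont_diff_prod cont_diff_compose_affine)

lemma smooth_diff:
  fixes f g :: "'a::euclidean_space \<Rightarrow> 'b::real_normed_vector"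
  assumes "smooth f" "smooth g" shows "smooth (\<lambda>x. f x - g x)"
  using smooth_add[OF assms(1) smooth_bilinear[OF bounded_bilinear_scaleR smooth_const[of "-1"] assms(2)]]
  by simp

lemma smooth_scaleR: "smooth f \<Longrightarrow> smooth g \<Longrightarrow> smooth (\<lambda>x. f x *\<^sub>R g x)"
  by (rule smooth_bilinear[OF bounded_bilinear_scaleR])

lemma smooth_inner: "smooth f \<Longrightarrow> smooth g \<Longrightarrow> smooth (\<lambda>x. f x \<bullet> g x)"
  by (rule smooth_bilinear[OF bounded_bilinear_inner])

lemma smooth_has_derivative: "smooth f \<Longrightarrow> (f has_derivative frechet_derivative f (at x)) (at x)"
  unfolding smooth_def using cont_diff_has_derivative by blast

lemma smooth_frechet_derivative: "smooth f \<Longrightarrow> smooth (\<lambda>x. frechet_derivative f (at x) v)"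
  unfolding smooth_def by (metis cont_diff.simps(2))

lemma smooth_continuous_on: "smooth f \<Longrightarrow> continuous_on S f"
  unfolding smooth_def by (metis cont_diff.simps(1) continuous_on_subset subset_UNIV)

text \<open>\<open>flat_exp 0\<close> is the standard example of a smooth function that is not analytic. The whole
  family is closed under differentiation up to linear combinations, which makes smoothness an
  induction.\<close>

definition flat_exp :: "nat \<Rightarrow> real \<Rightarrow> real" where
  "flat_exp n t = (if t \<le> 0 then 0 else exp (- 1 / t) / t ^ n)"

lemma flat_exp_tendsto_0: "(flat_exp n \<longlongrightarrow> 0) (at_right 0)"
proof -
  have "((\<lambda>y::real. y ^ n / exp y) \<longlongrightarrow> 0) at_top" by (rule tendsto_power_div_exp_0)
  then have "((\<lambda>t::real. inverse t ^ n / exp (inverse t)) \<longlongrightarrow> 0) (at_right 0)"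
    using filterlim_at_right_to_top by (simp add: filterlim_at_right_to_top)
  then show ?thesis
    by (rule Lim_transform_eventually)
       (auto simp: eventually_at_right_less flat_exp_def exp_minus field_simps
             intro!: eventually_at_rightI[of 0 1])
qed

lemma flat_exp_has_derivative:
  "(flat_exp n has_real_derivative (flat_exp (n + 2) t - real n * flat_exp (n + 1) t)) (at t)"
proof -
  consider "t < 0" | "t = 0" | "t > 0" by linarith
  then show ?thesis
  proof cases
    case 1
    have "((\<lambda>t. 0) has_real_derivative 0) (at t)" by simp
    then have "(flat_exp n has_real_derivative 0) (at t)"
      by (rule has_field_derivative_transform_within_open[of _ _ _ "{..<0}"])
         (use 1 in \<open>auto simp: flat_exp_def\<close>)
    then show ?thesis using 1 by (simp add: flat_exp_def)
  next
    case 2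
    have "((\<lambda>h. (flat_exp n (0 + h) - flat_exp n 0) / h) \<longlongrightarrow> 0) (at_right 0)"
      by (rule Lim_transform_eventually[OF flat_exp_tendsto_0[of "n+1"]])
         (auto simp: flat_exp_def field_simps intro!: eventually_at_rightI[of 0 1])
    moreover have "((\<lambda>h. (flat_exp n (0 + h) - flat_exp n 0) / h) \<longlongrightarrow> 0) (at_left 0)"
      by (rule Lim_transform_eventually[OF tendsto_const])
         (auto simp: flat_exp_def intro!: eventually_at_leftI[of "-1"])
    ultimately have "((\<lambda>h. (flat_exp n (0 + h) - flat_exp n 0) / h) \<longlongrightarrow> 0) (at 0)"
      by (simp add: filterlim_split_at)
    then show ?thesis using 2 by (simp add: DERIV_def flat_exp_def)
  next
    case 3
    have "((\<lambda>t. exp (- 1 / t) / t ^ n) has_real_derivative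
            (exp (-1/t) * (1 / t^2) * t ^ n - exp (-1/t) * (real n * t ^ (n - 1))) / (t ^ n * t ^ n)) (at t)"
      using 3 by (auto intro!: derivative_eq_intros simp: power2_eq_square)
    also have "(exp (-1/t) * (1 / t^2) * t ^ n - exp (-1/t) * (real n * t ^ (n - 1))) / (t ^ n * t ^ n)
             = flat_exp (n + 2) t - real n * flat_exp (n + 1) t"
      using 3 by (cases n) (simp_all add: flat_exp_def field_simps power2_eq_square)
    finally show ?thesis
      by (rule has_field_derivative_transform_within_open[of _ _ _ "{0<..}"])
         (use 3 in \<open>auto simp: flat_exp_def\<close>)
  qed
qed

lemma cont_diff_of_real_derivative:
  assumes "\<And>t::real. (f has_real_derivative f' t) (at t)" and "cont_diff k f'"
  shows "cont_diff (Suc k) f"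
  by (rule cont_diff_SucI[OF assms(1)[unfolded has_field_derivative_def]])
     (use cont_diff_bilinear[OF bounded_bilinear_mult assms(2) cont_diff_const] in simp)

lemma smooth_flat_exp: "smooth (flat_exp n)"
proof -
  have "cont_diff k (flat_exp n)" for k
  proof (induction k arbitrary: n)
    case 0
    show ?case
      by (auto intro!: continuous_at_imp_continuous_on DERIV_isCont[OF flat_exp_has_derivative])
  next
    case (Suc k)
    have "cont_diff k (\<lambda>t. flat_exp (n + 2) t + (- real n) * flat_exp (n + 1) t)"
      by (intro cont_diff_add Suc cont_diff_bilinear[OF bounded_bilinear_mult] cont_diff_const)
    then show ?case
      by (intro cont_diff_of_real_derivative[OF flat_exp_has_derivative]) simp
  qed
  then show ?thesis by (simp add: smooth_def)
qed

definition is_smooth_step :: "(real \<Rightarrow> real) \<Rightarrow> bool" where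
  "is_smooth_step s \<longleftrightarrow> smooth s \<and> (\<forall>t. 0 \<le> s t \<and> s t \<le> 1) \<and> (\<forall>t\<le>0. s t = 0) \<and> (\<forall>t\<ge>1. s t = 1) \<and>
     (\<exists>M s'. \<forall>t. (s has_real_derivative s' t) (at t) \<and> \<bar>s' t\<bar> \<le> M)"

text \<open>The normalised antiderivative of the bump \<open>flat_exp 0 t * flat_exp 0 (1 - t)\<close>, which lives on
  the unit interval.\<close>

lemma ex_smooth_step: "\<exists>s. is_smooth_step s"
proof -
  define b where "b t = flat_exp 0 t * flat_exp 0 (1 - t)" for t
  have sm1: "smooth (\<lambda>t::real. flat_exp 0 (1 - t))"
    using smooth_compose_affine[OF bounded_linear_minus[OF bounded_linear_ident] smooth_flat_exp[of 0], of 1]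
    by simp
  have smb: "smooth b"
    unfolding b_def by (rule smooth_bilinear[OF bounded_bilinear_mult smooth_flat_exp sm1])
  have b0: "b t \<ge> 0" "t \<le> 0 \<Longrightarrow> b t = 0" "t \<ge> 1 \<Longrightarrow> b t = 0" "0 < t \<Longrightarrow> t < 1 \<Longrightarrow> b t > 0" for t
    by (auto simp: b_def flat_exp_def)
  have "\<exists>F. \<forall>x::real. -\<infinity> < ereal x \<longrightarrow> ereal x < \<infinity> \<longrightarrow> (F has_vector_derivative b x) (at x)"
    by (rule einterval_antiderivative) (use smooth_continuous_on[OF smb] continuous_on_eq_continuous_at[OF open_UNIV] in auto)
  then obtain F where F: "\<And>x. (F has_real_derivative b x) (at x)"
    by (auto simp: has_real_derivative_iff_has_vector_derivative)
  have mono: "F x \<le> F y" if "x \<le> y" for x y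
    by (rule DERIV_nonneg_imp_nondecreasing[OF that]) (use F b0 in blast)
  have c0: "F t = F 0" if "t \<le> 0" for t
  proof (rule antisym)
    show "F t \<le> F 0" using mono that by blast
    show "F 0 \<le> F t"
      by (rule DERIV_nonpos_imp_nonincreasing[OF that]) (use F b0(2) in \<open>metis order_refl\<close>)
  qed
  have c1: "F t = F 1" if "t \<ge> 1" for t
  proof (rule antisym)
    show "F 1 \<le> F t" using mono that by blast
    show "F t \<le> F 1"
      by (rule DERIV_nonpos_imp_nonincreasing[OF that]) (use F b0(3) in \<open>metis order_refl\<close>)
  qed
  have lt: "F 0 < F 1"
    by (rule DERIV_pos_imp_increasing_open[of 0 1])
       (use F b0(4) in \<open>auto intro!: continuous_at_imp_continuous_on DERIV_isCont[OF F]\<close>)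
  define c where "c = F 1 - F 0"
  define s where "s t = (F t - F 0) / c" for t
  have c: "c > 0" using lt by (simp add: c_def)
  have ds: "(s has_real_derivative b t / c) (at t)" for t
    unfolding s_def using c by (auto intro!: derivative_eq_intros F)
  have "cont_diff k s" for k
  proof (cases k)
    case 0
    then show ?thesis using ds by (auto intro!: continuous_at_imp_continuous_on DERIV_isCont)
  next
    case (Suc m)
    have "cont_diff m (\<lambda>t. b t * (1/c))"
      by (rule cont_diff_bilinear[OF bounded_bilinear_mult _ cont_diff_const]) (use smb in \<open>simp add: smooth_def\<close>)
    with Suc show ?thesis
      using cont_diff_of_real_derivative[OF ds] by simp
  qed
  moreover have "0 \<le> s t" "s t \<le> 1" for t
  proof -
    have "F t \<ge> F 0" using mono[of 0 t] c0[of t] by linarith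
    moreover have "F t \<le> F 1" using mono[of t 1] c1[of t] by linarith
    ultimately show "0 \<le> s t" "s t \<le> 1" using c by (auto simp: s_def c_def)
  qed
  moreover have "s t = 0" if "t \<le> 0" for t using c0[OF that] by (simp add: s_def)
  moreover have "s t = 1" if "t \<ge> 1" for t using c1[OF that] lt by (simp add: s_def c_def)
  moreover have bnd: "\<exists>M. \<forall>t. \<bar>b t / c\<bar> \<le> M"
  proof -
    have "b t \<le> 1" for t
      by (auto simp: b_def flat_exp_def intro!: mult_le_one)
    then have "\<bar>b t / c\<bar> \<le> 1 / c" for t using b0(1)[of t] c by (simp add: divide_right_mono)
    then show ?thesis by blast
  qed
  moreover have "\<exists>M s'. \<forall>t. (s has_real_derivative s' t) (at t) \<and> \<bar>s' t\<bar> \<le> M"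
    using ds bnd by fast
  ultimately have "is_smooth_step s"
    unfolding is_smooth_step_def smooth_def by simp
  then show ?thesis by blast
qed

definition smooth_step :: "real \<Rightarrow> real" where
  "smooth_step = (SOME s. is_smooth_step s)"

lemma smooth_step: "is_smooth_step smooth_step"
  unfolding smooth_step_def using ex_smooth_step by (rule someI_ex)

lemma smooth_step_smooth: "smooth smooth_step"
  and smooth_step_nonneg: "0 \<le> smooth_step t"
  and smooth_step_le_1: "smooth_step t \<le> 1"
  and smooth_step_0: "t \<le> 0 \<Longrightarrow> smooth_step t = 0"
  and smooth_step_1: "t \<ge> 1 \<Longrightarrow> smooth_step t = 1"
  using smooth_step by (auto simp: is_smooth_step_def)

text \<open>A cutoff takes its extreme values \<open>0\<close> and \<open>1\<close> only with zero derivative. This locates the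
  derivative without any discussion of supports.\<close>

lemma differential_zero_at_max:
  fixes f :: "'a::euclidean_space \<Rightarrow> real"
  assumes "smooth f" "\<And>y. f y \<le> f x"
  shows "frechet_derivative f (at x) = (\<lambda>v. 0)"
  by (rule differential_zero_maxmin[of x UNIV f])
     (use assms smooth_has_derivative[OF assms(1)] in auto)

lemma differential_zero_at_min:
  fixes f :: "'a::euclidean_space \<Rightarrow> real"
  assumes "smooth f" "\<And>y. f x \<le> f y"
  shows "frechet_derivative f (at x) = (\<lambda>v. 0)"
  by (rule differential_zero_maxmin[of x UNIV f])
     (use assms smooth_has_derivative[OF assms(1)] in auto)

text \<open>In the product rule for factors bounded by \<open>1\<close> the undifferentiated factors can be dropped.\<close>

lemma abs_derivative_prod_le:
  fixes f :: "'i \<Rightarrow> 'a::euclidean_space \<Rightarrow> real"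
  assumes "\<And>i. i \<in> I \<Longrightarrow> (f i has_derivative f' i) (at x)"
    and "\<And>i. i \<in> I \<Longrightarrow> \<bar>f i x\<bar> \<le> 1"
  shows "\<bar>frechet_derivative (\<lambda>x. \<Prod>i\<in>I. f i x) (at x) v\<bar> \<le> (\<Sum>i\<in>I. \<bar>f' i v\<bar>)"
proof -
  have "frechet_derivative (\<lambda>x. \<Prod>i\<in>I. f i x) (at x) = (\<lambda>y. \<Sum>i\<in>I. f' i y * (\<Prod>j\<in>I - {i}. f j x))"
    by (rule frechet_derivative_at[symmetric], rule has_derivative_prod) (use assms(1) in auto)
  moreover have "\<bar>\<Sum>i\<in>I. f' i v * (\<Prod>j\<in>I - {i}. f j x)\<bar> \<le> (\<Sum>i\<in>I. \<bar>f' i v\<bar>)"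
  proof (rule order_trans[OF sum_abs], rule sum_mono)
    fix i
    have "\<bar>\<Prod>j\<in>I - {i}. f j x\<bar> \<le> 1"
      unfolding abs_prod by (rule prod_le_1) (use assms(2) in auto)
    then show "\<bar>f' i v * (\<Prod>j\<in>I - {i}. f j x)\<bar> \<le> \<bar>f' i v\<bar>"
      by (simp add: abs_mult mult_left_le)
  qed
  ultimately show ?thesis by simp
qed

text \<open>A smooth function that is \<open>1\<close> on the box with corners \<open>a\<close> and \<open>b\<close> shrunk by \<open>1 / k\<close> and
  vanishes outside the box.\<close>

definition plateau :: "real \<Rightarrow> real^'n \<Rightarrow> real^'n \<Rightarrow> real^'n \<Rightarrow> real" where
  "plateau k a b x = (\<Prod>i\<in>UNIV. smooth_step (k * (x $ i - a $ i)) * smooth_step (k * (b $ i - x $ i)))"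

lemma smooth_step_affine:
  "smooth (\<lambda>x::real^'n. smooth_step (k * (x $ i - c)))"
  "smooth (\<lambda>x::real^'n. smooth_step (k * (c - x $ i)))"
proof -
  have "bounded_linear (\<lambda>x::real^'n. k * x $ i)" "bounded_linear (\<lambda>x::real^'n. - k * x $ i)"
    by (intro bounded_linear_const_mult bounded_linear_vec_nth)+
  from this[THEN smooth_compose_affine, OF smooth_step_smooth, of "- k * c"]
    this[THEN smooth_compose_affine, OF smooth_step_smooth, of "k * c"]
  show "smooth (\<lambda>x::real^'n. smooth_step (k * (x $ i - c)))"
    "smooth (\<lambda>x::real^'n. smooth_step (k * (c - x $ i)))"
    by (simp_all add: algebra_simps)
qed

lemma smooth_plateau: "smooth (plateau k a b)"
  unfolding plateau_def[abs_def]
  by (intro smooth_prod smooth_bilinear[OF bounded_bilinear_mult] smooth_step_affine)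

lemma plateau_nonneg: "0 \<le> plateau k a b x"
  and plateau_le_1: "plateau k a b x \<le> 1"
  unfolding plateau_def
  by (auto intro!: prod_nonneg prod_le_1 mult_le_one simp: smooth_step_nonneg smooth_step_le_1)

lemma plateau_eq_1:
  "(\<And>i. 1 \<le> k * (x $ i - a $ i) \<and> 1 \<le> k * (b $ i - x $ i)) \<Longrightarrow> plateau k a b x = 1"
  unfolding plateau_def by (simp add: smooth_step_1)

lemma plateau_nonzeroD:
  assumes "plateau k a b x \<noteq> 0" "k > 0" shows "a $ i < x $ i" "x $ i < b $ i"
proof -
  have "smooth_step (k * (x $ i - a $ i)) \<noteq> 0" "smooth_step (k * (b $ i - x $ i)) \<noteq> 0"
    using assms(1) by (auto simp: plateau_def)
  with assms(2) show "a $ i < x $ i" "x $ i < b $ i"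
    by (metis smooth_step_0 diff_gt_0_iff_gt not_le zero_less_mult_pos)+
qed

text \<open>Each of the \<open>2 * CARD('n)\<close> factors of a plateau has slope at most \<open>k\<close> times that of the step.\<close>

lemma plateau_derivative_bound:
  obtains M where "0 \<le> M"
    and "\<And>k a b v. \<And>x::real^'n. 0 \<le> k \<Longrightarrow> \<bar>frechet_derivative (plateau k a b) (at x) v\<bar> \<le> M * k * norm v"
proof -
  obtain M s' where s': "\<And>t. (smooth_step has_real_derivative s' t) (at t)" "\<And>t. \<bar>s' t\<bar> \<le> M"
    using smooth_step[unfolded is_smooth_step_def] by metis
  have M: "0 \<le> M" using s'(2)[of 0] by linarith
  have "\<bar>frechet_derivative (plateau k a b) (at x) v\<bar> \<le> (real CARD('n) * 2 * M) * k * norm v"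
    if k: "0 \<le> k" for k a b v and x :: "real^'n"
  proof -
    define f' where "f' i w = smooth_step (k * (x $ i - a $ i)) * (s' (k * (b $ i - x $ i)) * (- (k * w $ i)))
       + s' (k * (x $ i - a $ i)) * (k * w $ i) * smooth_step (k * (b $ i - x $ i))" for i and w :: "real^'n"
    have nth: "((\<lambda>x::real^'n. x $ i) has_derivative (\<lambda>v. v $ i)) (at x)" for i
      by (rule bounded_linear_imp_has_derivative) (rule bounded_linear_vec_nth)
    have d1: "((\<lambda>x. smooth_step (k * (x $ i - a $ i))) has_derivative
         (\<lambda>v. s' (k * (x $ i - a $ i)) * (k * v $ i))) (at x)" for i
      by (rule has_derivative_compose[OF _ s'(1)[unfolded has_field_derivative_def]])
         (auto intro!: derivative_eq_intros nth)
    have d2: "((\<lambda>x. smooth_step (k * (b $ i - x $ i))) has_derivative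
         (\<lambda>v. s' (k * (b $ i - x $ i)) * (- (k * v $ i)))) (at x)" for i
      by (rule has_derivative_compose[OF _ s'(1)[unfolded has_field_derivative_def]])
         (auto intro!: derivative_eq_intros nth)
    have hd: "((\<lambda>x. smooth_step (k * (x $ i - a $ i)) * smooth_step (k * (b $ i - x $ i)))
       has_derivative f' i) (at x)" for i
      unfolding f'_def[abs_def] by (rule has_derivative_mult[OF d1 d2])
    have bd: "\<bar>f' i v\<bar> \<le> 2 * M * k * norm v" for i
    proof -
      have p: "\<bar>s' t * (k * v $ i)\<bar> \<le> M * k * norm v" for t
      proof -
        have "\<bar>s' t\<bar> * (k * \<bar>v $ i\<bar>) \<le> M * (k * norm v)"
          using s'(2)[of t] k component_le_norm_cart[of v i] M by (intro mult_mono) auto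
        then show ?thesis using k by (simp add: abs_mult mult.assoc)
      qed
      have q: "\<bar>smooth_step t * r\<bar> \<le> \<bar>r\<bar>" for t r
        using smooth_step_nonneg[of t] smooth_step_le_1[of t] by (simp add: abs_mult mult_left_le_one_le)
      have "\<bar>f' i v\<bar> \<le> \<bar>smooth_step (k * (x $ i - a $ i)) * (s' (k * (b $ i - x $ i)) * (- (k * v $ i)))\<bar>
          + \<bar>smooth_step (k * (b $ i - x $ i)) * (s' (k * (x $ i - a $ i)) * (k * v $ i))\<bar>"
        unfolding f'_def by (simp add: mult.commute abs_triangle_ineq)
      also have "\<dots> \<le> \<bar>s' (k * (b $ i - x $ i)) * (k * v $ i)\<bar> + \<bar>s' (k * (x $ i - a $ i)) * (k * v $ i)\<bar>"
        by (intro add_mono order_trans[OF q]) auto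
      also have "\<dots> \<le> 2 * M * k * norm v" using p[of "k * (b $ i - x $ i)"] p[of "k * (x $ i - a $ i)"] by simp
      finally show ?thesis .
    qed
    have "\<bar>frechet_derivative (plateau k a b) (at x) v\<bar> \<le> (\<Sum>i\<in>UNIV. \<bar>f' i v\<bar>)"
      unfolding plateau_def[abs_def]
      by (rule abs_derivative_prod_le[OF hd])
         (auto simp: abs_mult smooth_step_nonneg smooth_step_le_1 intro!: mult_le_one)
    also have "\<dots> \<le> (\<Sum>i\<in>(UNIV::'n set). 2 * M * k * norm v)" by (intro sum_mono bd)
    finally show ?thesis by (simp add: mult_ac)
  qed
  then show thesis using that[of "real CARD('n) * 2 * M"] M by simp
qed

text \<open>The complement of a product of complements of plateaus over the cells of a grid of mesh \<open>\<epsilon>\<close>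
  that meet \<open>K\<close>. At every point at most \<open>3 ^ CARD('n)\<close> of the plateaus are nonzero, which bounds
  the derivative independently of \<open>K\<close>.\<close>

lemma ex_smooth_cutoff:
  obtains M where "0 \<le> M"
    and "\<And>\<epsilon>. \<And>K::(real^'n) set. 0 < \<epsilon> \<Longrightarrow> bounded K \<Longrightarrow>
      \<exists>\<zeta>. smooth \<zeta> \<and> (\<forall>x. 0 \<le> \<zeta> x \<and> \<zeta> x \<le> 1) \<and> (\<forall>x\<in>K. \<zeta> x = 1) \<and>
        (\<forall>x. \<zeta> x \<noteq> 0 \<longrightarrow> (\<exists>y\<in>K. dist x y \<le> 2 * real CARD('n) * \<epsilon>)) \<and>
        (\<forall>x v. \<bar>frechet_derivative \<zeta> (at x) v\<bar> \<le> M / \<epsilon> * norm v)"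
proof -
  obtain M where M: "0 \<le> M" "\<And>k a b v. \<And>x::real^'n. 0 \<le> k \<Longrightarrow>
      \<bar>frechet_derivative (plateau k a b) (at x) v\<bar> \<le> M * k * norm v"
    by (rule plateau_derivative_bound, rule that)
  have "\<exists>\<zeta>. smooth \<zeta> \<and> (\<forall>x. 0 \<le> \<zeta> x \<and> \<zeta> x \<le> 1) \<and> (\<forall>x\<in>K. \<zeta> x = 1) \<and>
        (\<forall>x. \<zeta> x \<noteq> 0 \<longrightarrow> (\<exists>y\<in>K. dist x y \<le> 2 * real CARD('n) * \<epsilon>)) \<and>
        (\<forall>x v. \<bar>frechet_derivative \<zeta> (at x) v\<bar> \<le> (3 ^ CARD('n) * M) / \<epsilon> * norm v)"
    if e: "0 < \<epsilon>" and bK: "bounded K" for \<epsilon> and K :: "(real^'n) set"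
  proof -
    define cell where "cell x = (\<lambda>i. \<lfloor>x $ i / \<epsilon>\<rfloor>)" for x :: "real^'n"
    define I where "I = cell ` K"
    define p where "p k = plateau (1 / \<epsilon>) (\<chi> i. \<epsilon> * (real_of_int (k i) - 1)) (\<chi> i. \<epsilon> * (real_of_int (k i) + 2))"
      for k :: "'n \<Rightarrow> int"
    define \<zeta>' where "\<zeta>' x = 1 - (\<Prod>k\<in>I. 1 - p k x)" for x
    obtain R where R: "\<And>x. x \<in> K \<Longrightarrow> norm x \<le> R" using bK by (auto simp: bounded_iff)
    have fin: "finite I"
    proof (rule finite_subset)
      show "I \<subseteq> PiE UNIV (\<lambda>i. {\<lfloor>- R / \<epsilon>\<rfloor>..\<lfloor>R / \<epsilon>\<rfloor>})"
      proof (clarsimp simp: I_def cell_def PiE_iff)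
        fix x i assume "x \<in> K"
        then have "\<bar>x $ i\<bar> \<le> R" using R component_le_norm_cart order_trans by blast
        then show "\<lfloor>- (R / \<epsilon>)\<rfloor> \<le> \<lfloor>x $ i / \<epsilon>\<rfloor> \<and> \<lfloor>x $ i / \<epsilon>\<rfloor> \<le> \<lfloor>R / \<epsilon>\<rfloor>"
          using e by (auto intro!: floor_mono simp: divide_right_mono minus_divide_left simp del: minus_divide_left[symmetric])
      qed
    qed (auto intro: finite_PiE)
    have smp: "smooth (p k)" for k unfolding p_def by (rule smooth_plateau)
    have p01: "0 \<le> p k x" "p k x \<le> 1" for k x by (auto simp: p_def plateau_nonneg plateau_le_1)
    have smq: "smooth (\<lambda>x. 1 - p k x)" for k by (intro smooth_diff smooth_const smp)
    have smP: "smooth (\<lambda>x. \<Prod>k\<in>I. 1 - p k x)" by (intro smooth_prod smq)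
    have sm: "smooth \<zeta>'" unfolding \<zeta>'_def[abs_def] by (intro smooth_diff smooth_const smP)
    have prod01: "0 \<le> (\<Prod>k\<in>I. 1 - p k x)" "(\<Prod>k\<in>I. 1 - p k x) \<le> 1" for x
      using p01 by (auto intro!: prod_nonneg prod_le_1)
    have one: "p (cell x) x = 1" for x
      unfolding p_def
    proof (rule plateau_eq_1)
      fix i
      have "real_of_int (cell x i) \<le> x $ i / \<epsilon>" "x $ i / \<epsilon> \<le> real_of_int (cell x i) + 1"
        unfolding cell_def by linarith+
      moreover have "1 / \<epsilon> * (x $ i - \<epsilon> * (c - 1)) = x $ i / \<epsilon> - c + 1"
        "1 / \<epsilon> * (\<epsilon> * (c + 2) - x $ i) = c + 2 - x $ i / \<epsilon>" for c
        using e by (simp_all add: right_diff_distrib diff_divide_distrib)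
      ultimately show "1 \<le> 1 / \<epsilon> * (x $ i - (\<chi> i. \<epsilon> * (real_of_int (cell x i) - 1)) $ i) \<and>
            1 \<le> 1 / \<epsilon> * ((\<chi> i. \<epsilon> * (real_of_int (cell x i) + 2)) $ i - x $ i)"
        by simp
    qed
    have near: "real_of_int (k i) - 1 < x $ i / \<epsilon>" "x $ i / \<epsilon> < real_of_int (k i) + 2" if "p k x \<noteq> 0" for k x i
      using plateau_nonzeroD[OF that[unfolded p_def], of i] e by (auto simp: field_simps)
    have a: "\<zeta>' x = 1" if "x \<in> K" for x
    proof -
      have "cell x \<in> I" using that by (simp add: I_def)
      then have "(\<Prod>k\<in>I. 1 - p k x) = 0" using one fin by (auto simp: prod_zero_iff)
      then show ?thesis by (simp add: \<zeta>'_def)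
    qed
    have b: "\<exists>y\<in>K. dist x y \<le> 2 * real CARD('n) * \<epsilon>" if "\<zeta>' x \<noteq> 0" for x
    proof -
      have "\<exists>k\<in>I. p k x \<noteq> 0"
      proof (rule ccontr)
        assume "\<not> (\<exists>k\<in>I. p k x \<noteq> 0)"
        then have "(\<Prod>k\<in>I. 1 - p k x) = 1" by (intro prod.neutral) auto
        with that show False by (simp add: \<zeta>'_def)
      qed
      then obtain k where "k \<in> I" "p k x \<noteq> 0" by blast
      then obtain y where y: "y \<in> K" "p (cell y) x \<noteq> 0" by (auto simp: I_def)
      have "\<bar>(x - y) $ i\<bar> \<le> 2 * \<epsilon>" for i
      proof -
        have "real_of_int (cell y i) \<le> y $ i / \<epsilon>" "y $ i / \<epsilon> < real_of_int (cell y i) + 1"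
          unfolding cell_def by linarith+
        with near[OF y(2), of i] have "\<bar>x $ i / \<epsilon> - y $ i / \<epsilon>\<bar> \<le> 2" by linarith
        then show ?thesis using e by (simp add: diff_divide_distrib[symmetric] field_simps)
      qed
      then have "(\<Sum>i\<in>UNIV. \<bar>(x - y) $ i\<bar>) \<le> (\<Sum>i\<in>(UNIV::'n set). 2 * \<epsilon>)" by (intro sum_mono)
      with norm_le_l1_cart[of "x - y"] have "dist x y \<le> 2 * real CARD('n) * \<epsilon>"
        by (simp add: dist_norm mult_ac)
      with y(1) show ?thesis by blast
    qed
    have c: "\<bar>frechet_derivative \<zeta>' (at x) v\<bar> \<le> (3 ^ CARD('n) * M) / \<epsilon> * norm v" for x v
    proof -
      define J where "J = PiE UNIV (\<lambda>i. {cell x i - 1..cell x i + 1})"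
      have finJ: "finite J" and cardJ: "card J = 3 ^ CARD('n)"
        by (auto simp: J_def card_PiE intro!: finite_PiE)
      have "frechet_derivative \<zeta>' (at x) v = - frechet_derivative (\<lambda>x. \<Prod>k\<in>I. 1 - p k x) (at x) v"
      proof -
        have "(\<zeta>' has_derivative (\<lambda>v. 0 - frechet_derivative (\<lambda>x. \<Prod>k\<in>I. 1 - p k x) (at x) v)) (at x)"
          unfolding \<zeta>'_def[abs_def] by (intro has_derivative_diff has_derivative_const smooth_has_derivative smP)
        from frechet_derivative_at[OF this] show ?thesis by (metis diff_0)
      qed
      also have "\<bar>\<dots>\<bar> \<le> (\<Sum>k\<in>I. \<bar>0 - frechet_derivative (p k) (at x) v\<bar>)"
        unfolding abs_minus_cancel
        by (rule abs_derivative_prod_le, intro has_derivative_diff has_derivative_const smooth_has_derivative smp)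
           (use p01 in auto)
      also have "\<dots> = (\<Sum>k\<in>I \<inter> J. \<bar>frechet_derivative (p k) (at x) v\<bar>)"
      proof (rule sum.mono_neutral_cong_right[OF fin])
        show "\<forall>k\<in>I - I \<inter> J. \<bar>0 - frechet_derivative (p k) (at x) v\<bar> = 0"
        proof
          fix k assume k: "k \<in> I - I \<inter> J"
          have "p k x = 0"
          proof (rule ccontr)
            assume nz: "p k x \<noteq> 0"
            have "cell x i - 1 \<le> k i \<and> k i \<le> cell x i + 1" for i
              using near[OF nz, of i] unfolding cell_def by linarith
            then have "k \<in> J" by (auto simp: J_def)
            with k show False by blast
          qed
          then have "frechet_derivative (p k) (at x) = (\<lambda>v. 0)"
            by (intro differential_zero_at_min smp) (use p01 in auto)
          then show "\<bar>0 - frechet_derivative (p k) (at x) v\<bar> = 0" by simp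
        qed
      qed auto
      also have "\<dots> \<le> (\<Sum>k\<in>I \<inter> J. M * (1 / \<epsilon>) * norm v)"
        by (intro sum_mono, unfold p_def, rule M(2)) (use e in simp)
      also have "\<dots> \<le> 3 ^ CARD('n) * (M * (1 / \<epsilon>) * norm v)"
      proof -
        have "card (I \<inter> J) \<le> 3 ^ CARD('n)" using card_mono[OF finJ, of "I \<inter> J"] cardJ by simp
        then have "real (card (I \<inter> J)) \<le> 3 ^ CARD('n)" by (metis of_nat_le_iff of_nat_numeral of_nat_power)
        then show ?thesis unfolding sum_constant by (rule mult_right_mono) (use e M(1) in simp)
      qed
      finally show ?thesis by (simp add: field_simps)
    qed
    show ?thesis
      using sm prod01 a b c by (intro exI[of _ \<zeta>']) (auto simp: \<zeta>'_def)
  qed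
  then show thesis using that[of "3 ^ CARD('n) * M"] M(1) by simp
qed

section \<open>Square-integrable functions\<close>

lemma L2_measurable: "L2 M f \<Longrightarrow> f \<in> borel_measurable M"
  and L2_integrable: "L2 M f \<Longrightarrow> integrable M (\<lambda>x. (norm (f x))\<^sup>2)"
  by (auto simp: L2_def)

lemma l2_norm_nonneg: "0 \<le> l2_norm M f"
  by (simp add: l2_norm_def)

lemma l2_norm_squared: "(l2_norm M f)\<^sup>2 = (\<integral>x. (norm (f x))\<^sup>2 \<partial>M)"
  by (simp add: l2_norm_def integral_nonneg_AE)

lemma nn_integral_eq_l2_norm_squared:
  "L2 M f \<Longrightarrow> (\<integral>\<^sup>+x. ennreal ((norm (f x))\<^sup>2) \<partial>M) = ennreal ((l2_norm M f)\<^sup>2)"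
  unfolding l2_norm_squared by (rule nn_integral_eq_integral) (auto simp: L2_def)

lemma l2_norm_cong_AE: "AE x in M. norm (f x) = norm (g x) \<Longrightarrow>
    f \<in> borel_measurable M \<Longrightarrow> g \<in> borel_measurable M \<Longrightarrow> l2_norm M f = l2_norm M g"
  unfolding l2_norm_def by (intro arg_cong[where f=sqrt] integral_cong_AE) auto

lemma L2_bound:
  assumes "L2 M g" "f \<in> borel_measurable M" "AE x in M. norm (f x) \<le> B * norm (g x)"
  shows "L2 M f"
  unfolding L2_def
proof (intro conjI assms(2))
  have "integrable M (\<lambda>x. B\<^sup>2 * (norm (g x))\<^sup>2)" using L2_integrable[OF assms(1)] by simp
  then show "integrable M (\<lambda>x. (norm (f x))\<^sup>2)"
  proof (rule Bochner_Integration.integrable_bound)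
    show "AE x in M. norm ((norm (f x))\<^sup>2) \<le> norm (B\<^sup>2 * (norm (g x))\<^sup>2)"
      using assms(3)
    proof eventually_elim
      case (elim x)
      then have "(norm (f x))\<^sup>2 \<le> (B * norm (g x))\<^sup>2" by (intro power_mono) auto
      then show ?case by (simp add: power_mult_distrib)
    qed
  qed (use assms(2) in simp)
qed

lemma l2_norm_bound:
  assumes "L2 M g" "f \<in> borel_measurable M" "AE x in M. norm (f x) \<le> B * norm (g x)" "0 \<le> B"
  shows "l2_norm M f \<le> B * l2_norm M g"
proof -
  have "(l2_norm M f)\<^sup>2 \<le> (\<integral>x. B\<^sup>2 * (norm (g x))\<^sup>2 \<partial>M)"
    unfolding l2_norm_squared
  proof (rule integral_mono_AE)
    show "AE x in M. (norm (f x))\<^sup>2 \<le> B\<^sup>2 * (norm (g x))\<^sup>2"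
      using assms(3)
    proof eventually_elim
      case (elim x)
      then have "(norm (f x))\<^sup>2 \<le> (B * norm (g x))\<^sup>2" by (intro power_mono) auto
      then show ?case by (simp add: power_mult_distrib)
    qed
  qed (use L2_bound[OF assms(1-3)] assms(1) in \<open>auto simp: L2_def\<close>)
  also have "\<dots> = (B * l2_norm M g)\<^sup>2" by (simp add: power_mult_distrib l2_norm_squared)
  finally show ?thesis
    by (rule power2_le_imp_le) (simp add: assms(4) l2_norm_nonneg)
qed

lemma L2_zero: "L2 M (\<lambda>x. 0)"
  by (simp add: L2_def)

lemma L2_add: assumes "L2 M f" "L2 M g" shows "L2 M (\<lambda>x. f x + g x)"
proof -
  note [measurable] = assms[THEN L2_measurable]
  have "integrable M (\<lambda>x. 2 * (norm (f x))\<^sup>2 + 2 * (norm (g x))\<^sup>2)"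
    using assms[THEN L2_integrable] by simp
  then have "integrable M (\<lambda>x. (norm (f x + g x))\<^sup>2)"
  proof (rule Bochner_Integration.integrable_bound)
    have "(norm (a + b))\<^sup>2 \<le> 2 * (norm a)\<^sup>2 + 2 * (norm b)\<^sup>2" for a b :: 'b
    proof -
      have "(norm (a + b))\<^sup>2 \<le> (norm a + norm b)\<^sup>2"
        by (intro power_mono norm_triangle_ineq) auto
      also have "\<dots> \<le> 2 * (norm a)\<^sup>2 + 2 * (norm b)\<^sup>2"
        using sum_squares_bound[of "norm a" "norm b"] by (simp add: power2_sum)
      finally show ?thesis .
    qed
    then show "AE x in M. norm ((norm (f x + g x))\<^sup>2) \<le> norm (2 * (norm (f x))\<^sup>2 + 2 * (norm (g x))\<^sup>2)"
      by simp
  qed simp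
  then show ?thesis by (simp add: L2_def)
qed

lemma L2_uminus: "L2 M f \<Longrightarrow> L2 M (\<lambda>x. - f x)"
  by (simp add: L2_def)

lemma L2_diff: "L2 M f \<Longrightarrow> L2 M g \<Longrightarrow> L2 M (\<lambda>x. f x - g x)"
  using L2_add[OF _ L2_uminus, of M f g] by simp

lemma L2_sum: "(\<And>i. i \<in> I \<Longrightarrow> L2 M (f i)) \<Longrightarrow> L2 M (\<lambda>x. \<Sum>i\<in>I. f i x)"
  by (induction I rule: infinite_finite_induct) (auto intro: L2_zero L2_add)

lemma L2_integrable_norm_mult:
  assumes "L2 M f" "L2 M g" shows "integrable M (\<lambda>x. norm (f x) * norm (g x))"
proof -
  note [measurable] = assms[THEN L2_measurable]
  have "integrable M (\<lambda>x. (norm (f x))\<^sup>2 + (norm (g x))\<^sup>2)"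
    using assms[THEN L2_integrable] by simp
  then show ?thesis
  proof (rule Bochner_Integration.integrable_bound)
    have "norm a * norm b \<le> (norm a)\<^sup>2 + (norm b)\<^sup>2" for a :: 'b and b :: 'c
    proof -
      have "2 * (norm a * norm b) \<le> (norm a)\<^sup>2 + (norm b)\<^sup>2" "0 \<le> norm a * norm b"
        using sum_squares_bound[of "norm a" "norm b"] by (simp_all add: mult.assoc)
      then show ?thesis by linarith
    qed
    then show "AE x in M. norm (norm (f x) * norm (g x)) \<le> norm ((norm (f x))\<^sup>2 + (norm (g x))\<^sup>2)"
      by simp
  qed simp
qed

text \<open>With \<open>A\<close> and \<open>B\<close> the two norms, integrate the pointwise inequality between geometric and
  arithmetic mean of \<open>B * norm (f x)\<close> and \<open>A * norm (g x)\<close>.\<close>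

lemma L2_Cauchy_Schwarz:
  assumes f: "L2 M f" and g: "L2 M g"
  shows "(\<integral>x. norm (f x) * norm (g x) \<partial>M) \<le> l2_norm M f * l2_norm M g"
proof -
  have zero: "(\<integral>x. norm (u x) * norm (v x) \<partial>M) = 0" if "L2 M u" "l2_norm M u = 0"
    for u :: "'a \<Rightarrow> 'd::euclidean_space" and v :: "'a \<Rightarrow> 'e::euclidean_space"
  proof -
    have "(\<integral>x. (norm (u x))\<^sup>2 \<partial>M) = 0" using that(2) by (metis l2_norm_squared zero_power2)
    then have "AE x in M. (norm (u x))\<^sup>2 = 0"
      using integral_nonneg_eq_0_iff_AE[OF L2_integrable[OF that(1)]] by simp
    then have "AE x in M. norm (u x) * norm (v x) = 0" by eventually_elim simp
    then show ?thesis by (rule integral_eq_zero_AE)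
  qed
  show ?thesis
  proof (cases "l2_norm M f = 0 \<or> l2_norm M g = 0")
    case True
    then show ?thesis using zero[OF f, of g] zero[OF g, of f] by (auto simp: mult.commute)
  next
    case False
    define A where "A = l2_norm M f"
    define B where "B = l2_norm M g"
    have AB: "A > 0" "B > 0" using False l2_norm_nonneg by (auto simp: A_def B_def less_le)
    have "norm (f x) * norm (g x) \<le> B / (2 * A) * (norm (f x))\<^sup>2 + A / (2 * B) * (norm (g x))\<^sup>2" for x
    proof -
      have "0 \<le> (B * norm (f x) - A * norm (g x))\<^sup>2" by simp
      then have "2 * A * B * (norm (f x) * norm (g x)) \<le> B\<^sup>2 * (norm (f x))\<^sup>2 + A\<^sup>2 * (norm (g x))\<^sup>2"
        by (simp add: power2_diff power_mult_distrib algebra_simps)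
      then show ?thesis using AB by (simp add: field_simps power2_eq_square)
    qed
    then have "(\<integral>x. norm (f x) * norm (g x) \<partial>M)
        \<le> (\<integral>x. B / (2 * A) * (norm (f x))\<^sup>2 + A / (2 * B) * (norm (g x))\<^sup>2 \<partial>M)"
      using L2_integrable[OF f] L2_integrable[OF g] L2_integrable_norm_mult[OF f g]
      by (intro integral_mono) auto
    also have "\<dots> = B / (2 * A) * A\<^sup>2 + A / (2 * B) * B\<^sup>2"
      using L2_integrable[OF f] L2_integrable[OF g] by (simp add: A_def B_def l2_norm_squared)
    also have "\<dots> = A * B" using AB by (simp add: field_simps power2_eq_square)
    finally show ?thesis by (simp add: A_def B_def)
  qed
qed

lemma L2_integrable_inner:
  assumes "L2 M f" "L2 M g" shows "integrable M (\<lambda>x. f x \<bullet> g x)"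
  by (rule Bochner_Integration.integrable_bound[OF L2_integrable_norm_mult[OF assms]])
     (use assms[THEN L2_measurable] Cauchy_Schwarz_ineq2 in auto)

lemma abs_integral_inner_le:
  assumes "L2 M f" "L2 M g" shows "\<bar>\<integral>x. f x \<bullet> g x \<partial>M\<bar> \<le> l2_norm M f * l2_norm M g"
proof -
  have "\<bar>\<integral>x. f x \<bullet> g x \<partial>M\<bar> \<le> (\<integral>x. \<bar>f x \<bullet> g x\<bar> \<partial>M)" by (rule integral_abs_bound)
  also have "\<dots> \<le> (\<integral>x. norm (f x) * norm (g x) \<partial>M)"
    using L2_integrable_inner[OF assms] L2_integrable_norm_mult[OF assms]
    by (intro integral_mono) (auto simp: Cauchy_Schwarz_ineq2)
  finally show ?thesis using L2_Cauchy_Schwarz[OF assms] by linarith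
qed

lemma l2_norm_triangle:
  assumes "L2 M f" "L2 M g" shows "l2_norm M (\<lambda>x. f x + g x) \<le> l2_norm M f + l2_norm M g"
proof (rule power2_le_imp_le)
  have "(l2_norm M (\<lambda>x. f x + g x))\<^sup>2 = (\<integral>x. (norm (f x))\<^sup>2 + 2 * (f x \<bullet> g x) + (norm (g x))\<^sup>2 \<partial>M)"
    unfolding l2_norm_squared
    by (intro Bochner_Integration.integral_cong) (auto simp: power2_norm_eq_inner inner_add algebra_simps inner_commute)
  also have "\<dots> = (l2_norm M f)\<^sup>2 + 2 * (\<integral>x. f x \<bullet> g x \<partial>M) + (l2_norm M g)\<^sup>2"
    using L2_integrable_inner[OF assms] assms[THEN L2_integrable] by (simp add: l2_norm_squared)
  also have "\<dots> \<le> (l2_norm M f + l2_norm M g)\<^sup>2"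
    using abs_integral_inner_le[OF assms] by (simp add: power2_sum)
  finally show "(l2_norm M (\<lambda>x. f x + g x))\<^sup>2 \<le> (l2_norm M f + l2_norm M g)\<^sup>2" .
qed (simp add: l2_norm_nonneg)

lemma l2_norm_uminus: "l2_norm M (\<lambda>x. - f x) = l2_norm M f"
  by (simp add: l2_norm_def)

lemma l2_norm_diff_triangle:
  assumes "L2 M f" "L2 M g" shows "l2_norm M (\<lambda>x. f x - g x) \<le> l2_norm M f + l2_norm M g"
  using l2_norm_triangle[OF assms(1) L2_uminus[OF assms(2)]] by (simp add: l2_norm_uminus)

lemma l2_norm_le_add_diff:
  assumes "L2 M f" "L2 M g" shows "l2_norm M f \<le> l2_norm M g + l2_norm M (\<lambda>x. f x - g x)"
  using l2_norm_triangle[OF assms(2) L2_diff[OF assms]] by simp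

lemma L2_tendsto_integral_inner:
  assumes "\<And>k. L2 M (f k)" "\<And>k. L2 M (g k)" "L2 M F" "L2 M G"
    and "(\<lambda>k. l2_norm M (\<lambda>x. f k x - F x)) \<longlonglongrightarrow> 0" "(\<lambda>k. l2_norm M (\<lambda>x. g k x - G x)) \<longlonglongrightarrow> 0"
  shows "(\<lambda>k. \<integral>x. f k x \<bullet> g k x \<partial>M) \<longlonglongrightarrow> (\<integral>x. F x \<bullet> G x \<partial>M)"
proof -
  let ?a = "\<lambda>k. l2_norm M (\<lambda>x. f k x - F x)" and ?b = "\<lambda>k. l2_norm M (\<lambda>x. g k x - G x)"
  have bd: "norm ((\<integral>x. f k x \<bullet> g k x \<partial>M) - (\<integral>x. F x \<bullet> G x \<partial>M))
      \<le> ?a k * ?b k + ?a k * l2_norm M G + l2_norm M F * ?b k" for k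
  proof -
    have d: "L2 M (\<lambda>x. f k x - F x)" "L2 M (\<lambda>x. g k x - G x)" using assms by (auto intro: L2_diff)
    have "(\<integral>x. f k x \<bullet> g k x \<partial>M) - (\<integral>x. F x \<bullet> G x \<partial>M)
      = (\<integral>x. f k x \<bullet> g k x - F x \<bullet> G x \<partial>M)"
      using assms by (simp add: L2_integrable_inner)
    also have "\<dots> = (\<integral>x. (f k x - F x) \<bullet> (g k x - G x) + (f k x - F x) \<bullet> G x + F x \<bullet> (g k x - G x) \<partial>M)"
      by (intro Bochner_Integration.integral_cong) (auto simp: inner_diff)
    also have "\<dots> = (\<integral>x. (f k x - F x) \<bullet> (g k x - G x) \<partial>M) + (\<integral>x. (f k x - F x) \<bullet> G x \<partial>M)
        + (\<integral>x. F x \<bullet> (g k x - G x) \<partial>M)"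
      using assms d by (simp add: L2_integrable_inner)
    finally show ?thesis
      using abs_integral_inner_le[OF d] abs_integral_inner_le[OF d(1) assms(4)]
        abs_integral_inner_le[OF assms(3) d(2)] by simp
  qed
  have lim: "(\<lambda>k. ?a k * ?b k + ?a k * l2_norm M G + l2_norm M F * ?b k) \<longlonglongrightarrow> 0"
    using tendsto_add[OF tendsto_add[OF tendsto_mult[OF assms(5,6)] tendsto_mult_right[OF assms(5), of "l2_norm M G"]]
        tendsto_mult_left[OF assms(6), of "l2_norm M F"]] by simp
  have "(\<lambda>k. (\<integral>x. f k x \<bullet> g k x \<partial>M) - (\<integral>x. F x \<bullet> G x \<partial>M)) \<longlonglongrightarrow> 0"
    by (rule Lim_null_comparison[OF always_eventually[OF allI[OF bd]] lim])
  then show ?thesis by (simp add: LIM_zero_iff)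
qed

lemma L2_mult_bounded:
  fixes f :: "'a \<Rightarrow> 'b::euclidean_space"
  assumes "L2 M f" "a \<in> borel_measurable M" "\<And>x. x \<in> space M \<Longrightarrow> \<bar>a x\<bar> \<le> B"
  shows "L2 M (\<lambda>x. a x *\<^sub>R f x)"
proof (rule L2_bound[OF assms(1), where B=B])
  show "(\<lambda>x. a x *\<^sub>R f x) \<in> borel_measurable M"
    by (rule borel_measurable_scaleR[OF assms(2) L2_measurable[OF assms(1)]])
  show "AE x in M. norm (a x *\<^sub>R f x) \<le> B * norm (f x)"
    by (rule AE_I2) (simp add: mult_right_mono assms(3))
qed

lemma L2_mult_AE_bounded:
  fixes f :: "'a \<Rightarrow> 'b::euclidean_space"
  assumes f: "L2 M f" and a: "a \<in> borel_measurable M" "AE x in M. \<bar>a x\<bar> \<le> B" and B: "0 \<le> B"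
  shows "L2 M (\<lambda>x. a x *\<^sub>R f x)" and "l2_norm M (\<lambda>x. a x *\<^sub>R f x) \<le> B * l2_norm M f"
proof -
  have m: "(\<lambda>x. a x *\<^sub>R f x) \<in> borel_measurable M"
    by (rule borel_measurable_scaleR[OF a(1) L2_measurable[OF f]])
  have ae: "AE x in M. norm (a x *\<^sub>R f x) \<le> B * norm (f x)"
    using a(2) by eventually_elim (simp add: mult_right_mono)
  show "L2 M (\<lambda>x. a x *\<^sub>R f x)" by (rule L2_bound[OF f m ae])
  show "l2_norm M (\<lambda>x. a x *\<^sub>R f x) \<le> B * l2_norm M f" by (rule l2_norm_bound[OF f m ae B])
qed

lemma l2_norm_sum_le:
  "finite I \<Longrightarrow> (\<And>i. i \<in> I \<Longrightarrow> L2 M (f i)) \<Longrightarrow> l2_norm M (\<lambda>x. \<Sum>i\<in>I. f i x) \<le> (\<Sum>i\<in>I. l2_norm M (f i))"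
proof (induction I rule: finite_induct)
  case empty
  then show ?case by (simp add: l2_norm_def)
next
  case (insert i I)
  have "l2_norm M (\<lambda>x. f i x + (\<Sum>i\<in>I. f i x)) \<le> l2_norm M (f i) + l2_norm M (\<lambda>x. \<Sum>i\<in>I. f i x)"
    using insert.prems by (intro l2_norm_triangle L2_sum) auto
  also have "l2_norm M (\<lambda>x. \<Sum>i\<in>I. f i x) \<le> (\<Sum>i\<in>I. l2_norm M (f i))"
    using insert.prems by (intro insert.IH) auto
  finally show ?case using insert.hyps by simp
qed

section \<open>Weak derivatives\<close>

lemma sigma_finite_lebesgue: "sigma_finite_measure (lebesgue :: 'a::euclidean_space measure)"
proof
  obtain A :: "'a set set" where A: "countable A" "A \<subseteq> sets lborel" "\<Union>A = space lborel" "\<forall>a\<in>A. emeasure lborel a \<noteq> \<infinity>"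
    using lborel.sigma_finite_countable by blast
  have "A \<subseteq> sets lebesgue" using A(2) by (auto intro: sets_completionI_sets)
  moreover have "\<forall>a\<in>A. emeasure lebesgue a \<noteq> \<infinity>" using A(2,4) by (auto simp: subset_eq)
  ultimately show "\<exists>A::'a set set. countable A \<and> A \<subseteq> sets lebesgue \<and> \<Union>A = space lebesgue \<and> (\<forall>a\<in>A. emeasure lebesgue a \<noteq> \<infinity>)"
    using A(1,3) by (intro exI[of _ A]) simp
qed

text \<open>The Borel sets over which \<open>f\<close> integrates to zero form a Dynkin system, and the boxes are an
  intersection-stable generator of the Borel sets.\<close>

lemma AE_zero_of_box_integrals:
  fixes f :: "'a::euclidean_space \<Rightarrow> 'b::euclidean_space"
  assumes f: "integrable lebesgue f"
    and box: "\<And>a b. (\<integral>x. indicator (box a b) x *\<^sub>R f x \<partial>lebesgue) = 0"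
  shows "AE x in lebesgue. f x = 0"
proof (rule sigma_finite_measure.density_zero[OF sigma_finite_lebesgue f])
  have total: "(\<integral>x. f x \<partial>lebesgue) = 0"
  proof -
    define B :: "nat \<Rightarrow> 'a set" where "B n = box (- real n *\<^sub>R One) (real n *\<^sub>R One)" for n
    have mem: "\<forall>\<^sub>F n in sequentially. x \<in> B n" for x
    proof -
      obtain N :: nat where N: "norm x < real N" using reals_Archimedean2 by blast
      have "x \<in> B n" if "n \<ge> N" for n
      proof -
        have "\<bar>x \<bullet> i\<bar> < real n" if "i \<in> Basis" for i
          using Basis_le_norm[OF that, of x] N \<open>n \<ge> N\<close> by linarith
        then show ?thesis by (force simp: B_def mem_box abs_less_iff inner_sum_left_Basis)
      qed
      then show ?thesis by (auto simp: eventually_sequentially)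
    qed
    have "(\<lambda>n. \<integral>x. indicator (B n) x *\<^sub>R f x \<partial>lebesgue) \<longlonglongrightarrow> (\<integral>x. f x \<partial>lebesgue)"
    proof (rule integral_dominated_convergence)
      show "integrable lebesgue (\<lambda>x. norm (f x))" using f by simp
      show "AE x in lebesgue. (\<lambda>n. indicator (B n) x *\<^sub>R f x) \<longlonglongrightarrow> f x"
      proof (rule AE_I2, rule tendsto_eventually)
        show "\<forall>\<^sub>F n in sequentially. indicator (B n) x *\<^sub>R f x = f x" for x
          using mem[of x] by eventually_elim simp
      qed
      show "AE x in lebesgue. norm (indicator (B n) x *\<^sub>R f x) \<le> norm (f x)" for n
        by (auto simp: indicator_def)
      show "f \<in> borel_measurable lebesgue" using f by simp
      show "(\<lambda>x. indicator (B n) x *\<^sub>R f x) \<in> borel_measurable lebesgue" for n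
        using f by (intro borel_measurable_scaleR borel_measurable_indicator) (auto simp: B_def)
    qed
    moreover have "(\<lambda>n. \<integral>x. indicator (B n) x *\<^sub>R f x \<partial>lebesgue) \<longlonglongrightarrow> 0"
      unfolding B_def box by simp
    ultimately show ?thesis by (rule LIMSEQ_unique)
  qed
  have borel: "(\<integral>x. indicator A x *\<^sub>R f x \<partial>lebesgue) = 0" if "A \<in> sets borel" for A
  proof -
    let ?G = "range (\<lambda>(a, b). box a b :: 'a set)"
    have sb: "sets borel = sigma_sets UNIV ?G"
      by (simp add: borel_eq_box)
    have int: "Int_stable ?G"
      by (auto simp: Int_stable_def box_Int_box intro: rev_image_eqI)
    have setint: "set_integrable lebesgue X f" if "X \<in> sigma_sets UNIV ?G" for X
      using that f unfolding set_integrable_def sb[symmetric]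
      by (intro integrable_mult_indicator) auto
    have "A \<in> sigma_sets UNIV ?G" using that sb by blast
    from int _ this show ?thesis
    proof (rule sigma_sets_induct_disjoint)
      show "?G \<subseteq> Pow UNIV" by simp
      show "(\<integral>x. indicator A x *\<^sub>R f x \<partial>lebesgue) = 0" if "A \<in> ?G" for A
        using that box by auto
      show "(\<integral>x. indicator {} x *\<^sub>R f x \<partial>lebesgue) = 0" by simp
      show "(\<integral>x. indicator (UNIV - A) x *\<^sub>R f x \<partial>lebesgue) = 0"
        if "A \<in> sigma_sets UNIV ?G" "(\<integral>x. indicator A x *\<^sub>R f x \<partial>lebesgue) = 0" for A
      proof -
        have "(\<integral>x. indicator (UNIV - A) x *\<^sub>R f x \<partial>lebesgue) = (\<integral>x. f x - indicator A x *\<^sub>R f x \<partial>lebesgue)"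
          by (intro Bochner_Integration.integral_cong) (auto simp: indicator_def)
        also have "\<dots> = 0"
          using setint[OF that(1)] f that(2) total by (simp add: set_integrable_def)
        finally show ?thesis .
      qed
      show "(\<integral>x. indicator (\<Union>i::nat. A i) x *\<^sub>R f x \<partial>lebesgue) = 0"
        if A: "disjoint_family A" "range A \<subseteq> sigma_sets UNIV ?G"
          "\<And>i. (\<integral>x. indicator (A i) x *\<^sub>R f x \<partial>lebesgue) = 0" for A
      proof -
        have "(\<Union>i. A i) \<in> sigma_sets UNIV ?G" using A(2) by (intro sigma_sets.Union) auto
        then have "(LINT x:(\<Union>i. A i)|lebesgue. f x) = (\<Sum>i. (LINT x:(A i)|lebesgue. f x))"
          using A(1,2) unfolding sb[symmetric]
          by (intro lebesgue_integral_countable_add setint)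
             (auto simp: disjoint_family_on_def sb[symmetric])
        then show ?thesis using A(3) by (simp add: set_lebesgue_integral_def)
      qed
    qed
  qed
  fix A :: "'a set" assume A: "A \<in> sets lebesgue"
  have "AE x in lebesgue. x \<in> main_part lborel A \<longleftrightarrow> x \<in> A"
    by (rule AE_completion) (rule AE_in_main_part[OF A])
  then have "AE x in lebesgue. indicator A x *\<^sub>R f x = indicator (main_part lborel A) x *\<^sub>R f x"
    by eventually_elim (auto simp: indicator_def)
  moreover have mp: "main_part lborel A \<in> sets lborel" using A by (rule main_part_sets)
  ultimately have "(\<integral>x. indicator A x *\<^sub>R f x \<partial>lebesgue) = (\<integral>x. indicator (main_part lborel A) x *\<^sub>R f x \<partial>lebesgue)"
    using A f by (intro integral_cong_AE borel_measurable_scaleR borel_measurable_indicator) (auto dest: sets_completionI_sets)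
  then show "set_lebesgue_integral lebesgue A f = 0"
    using borel[of "main_part lborel A"] mp by (simp add: set_lebesgue_integral_def)
qed

text \<open>Local integrability is given on compact sets, integrals are taken over \<open>\<Omega>\<close>; a factor with compact
  support in \<open>\<Omega>\<close> mediates between the two.\<close>

lemma lebesgue_on_compact_scaled_integrable:
  fixes u :: "'a::euclidean_space \<Rightarrow> 'b::euclidean_space"
  assumes u: "integrable (lebesgue_on K) u" and K: "compact K"
    and a: "a \<in> borel_measurable borel" "\<And>x. x \<in> K \<Longrightarrow> \<bar>a x\<bar> \<le> B"
    and supp: "\<And>x. x \<notin> K \<Longrightarrow> a x = 0" and \<Omega>: "K \<subseteq> \<Omega>" "\<Omega> \<in> sets lebesgue"
  shows "integrable (lebesgue_on \<Omega>) (\<lambda>x. a x *\<^sub>R u x)"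
    and "(\<integral>x. a x *\<^sub>R u x \<partial>lebesgue_on \<Omega>) = (\<integral>x. a x *\<^sub>R (indicator K x *\<^sub>R u x) \<partial>lebesgue)"
proof -
  have Ks: "K \<in> sets lebesgue" using K compact_imp_closed by (simp add: lmeasurable_compact fmeasurableD)
  have uK: "integrable lebesgue (\<lambda>x. indicator K x *\<^sub>R u x)"
    using u Ks by (simp add: integrable_restrict_space)
  have am: "a \<in> borel_measurable lebesgue" by (rule measurable_completion) (use a(1) in simp)
  have "integrable lebesgue (\<lambda>x. B *\<^sub>R (indicator K x *\<^sub>R u x))" using uK by (rule integrable_scaleR_right)
  then have "integrable lebesgue (\<lambda>x. a x *\<^sub>R (indicator K x *\<^sub>R u x))"
  proof (rule Bochner_Integration.integrable_bound)
    show "AE x in lebesgue. norm (a x *\<^sub>R (indicator K x *\<^sub>R u x)) \<le> norm (B *\<^sub>R (indicator K x *\<^sub>R u x))"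
      using order_trans[OF a(2) abs_ge_self] by (intro AE_I2) (auto simp: indicator_def intro!: mult_right_mono)
  qed (rule borel_measurable_scaleR[OF am borel_measurable_integrable[OF uK]])
  moreover have \<Omega>s: "\<Omega> \<inter> space lebesgue \<in> sets lebesgue" using \<Omega>(2) by simp
  moreover have eq: "indicator \<Omega> x *\<^sub>R a x *\<^sub>R u x = a x *\<^sub>R (indicator K x *\<^sub>R u x)" for x
    using \<Omega>(1) supp by (auto simp: indicator_def)
  ultimately show "integrable (lebesgue_on \<Omega>) (\<lambda>x. a x *\<^sub>R u x)"
    "(\<integral>x. a x *\<^sub>R u x \<partial>lebesgue_on \<Omega>) = (\<integral>x. a x *\<^sub>R (indicator K x *\<^sub>R u x) \<partial>lebesgue)"
    by (simp_all only: integrable_restrict_space[OF \<Omega>s] integral_restrict_space[OF \<Omega>s] eq)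
qed

lemma test_function_mult_integrable:
  fixes u :: "'a::euclidean_space \<Rightarrow> 'b::euclidean_space"
  assumes \<psi>: "test_function \<Omega> \<psi>" and u: "locally_integrable \<Omega> u" and \<Omega>: "\<Omega> \<in> sets lebesgue"
    and a: "continuous_on UNIV a" "\<And>x. x \<notin> closure {x. \<psi> x \<noteq> 0} \<Longrightarrow> a x = 0"
  shows "integrable (lebesgue_on \<Omega>) (\<lambda>x. a x *\<^sub>R u x)"
proof -
  let ?K = "closure {x. \<psi> x \<noteq> 0}"
  have K: "compact ?K" "?K \<subseteq> \<Omega>" using \<psi> by (auto simp: test_function_def)
  have "compact (a ` ?K)" using K(1) a(1) by (meson compact_continuous_image continuous_on_subset subset_UNIV)
  then obtain B where "\<And>y. y \<in> a ` ?K \<Longrightarrow> norm y \<le> B" using compact_imp_bounded bounded_iff by metis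
  then have B: "\<And>x. x \<in> ?K \<Longrightarrow> \<bar>a x\<bar> \<le> B" by auto
  show ?thesis
    by (rule lebesgue_on_compact_scaled_integrable(1)[OF _ K(1) _ B _ K(2) \<Omega>])
       (use u K a in \<open>auto simp: locally_integrable_def intro: borel_measurable_continuous_onI\<close>)
qed

lemma frechet_derivative_zero_outside_support:
  assumes "x \<notin> closure {x. f x \<noteq> 0}"
  shows "frechet_derivative f (at x) = (\<lambda>v. 0)"
proof -
  have "(f has_derivative (\<lambda>v. 0)) (at x)"
    by (rule has_derivative_transform_within_open[of "\<lambda>x. 0" _ _ _ "- closure {x. f x \<noteq> 0}"])
       (use assms closure_subset[of "{x. f x \<noteq> 0}"] in auto)
  then show ?thesis by (rule frechet_derivative_at[symmetric])
qed

lemma test_function_mult_integrable2: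
  fixes u :: "'a::euclidean_space \<Rightarrow> 'b::euclidean_space"
  assumes \<psi>: "test_function \<Omega> \<psi>" and u: "locally_integrable \<Omega> u" and \<Omega>: "\<Omega> \<in> sets lebesgue"
  shows "integrable (lebesgue_on \<Omega>) (\<lambda>x. \<psi> x *\<^sub>R u x)"
    and "integrable (lebesgue_on \<Omega>) (\<lambda>x. frechet_derivative \<psi> (at x) v *\<^sub>R u x)"
proof -
  have sm: "smooth \<psi>" using \<psi> by (simp add: test_function_def)
  show "integrable (lebesgue_on \<Omega>) (\<lambda>x. \<psi> x *\<^sub>R u x)"
    using sm by (intro test_function_mult_integrable[OF assms] smooth_continuous_on)
       (auto simp: closure_def)
  show "integrable (lebesgue_on \<Omega>) (\<lambda>x. frechet_derivative \<psi> (at x) v *\<^sub>R u x)"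
    by (intro test_function_mult_integrable[OF assms] smooth_continuous_on smooth_frechet_derivative sm)
       (simp add: frechet_derivative_zero_outside_support)
qed

lemma test_function_plateau:
  fixes a b :: "real^'n"
  assumes "cbox a b \<subseteq> \<Omega>" "k > 0" shows "test_function \<Omega> (plateau k a b)"
proof -
  have "{x. plateau k a b x \<noteq> 0} \<subseteq> cbox a b"
    using plateau_nonzeroD[OF _ assms(2)] by (force simp: mem_box_cart less_imp_le)
  then have "closure {x. plateau k a b x \<noteq> 0} \<subseteq> cbox a b" by (intro closure_minimal closed_cbox)
  moreover from this have "bounded (closure {x. plateau k a b x \<noteq> 0})"
    by (rule bounded_subset[OF bounded_cbox])
  ultimately show ?thesis
    using assms(1) by (auto simp: test_function_def smooth_plateau compact_eq_bounded_closed)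
qed

lemma plateau_tendsto_indicator:
  fixes a b :: "real^'n"
  shows "(\<lambda>n. plateau (real (Suc n)) a b x) \<longlonglongrightarrow> indicator (box a b) x"
proof (cases "x \<in> box a b")
  case True
  have "\<forall>\<^sub>F n in sequentially. 1 \<le> real (Suc n) * c" if "c > 0" for c :: real
  proof -
    obtain N :: nat where "1 / c < real N" using reals_Archimedean2 by blast
    then have "1 \<le> real (Suc n) * c" if "n \<ge> N" for n
    proof -
      have "1 / c \<le> real (Suc n)" using \<open>1 / c < real N\<close> that by simp
      then show ?thesis using \<open>c > 0\<close> by (simp add: pos_divide_le_eq)
    qed
    then show ?thesis by (auto simp: eventually_sequentially)
  qed
  then have "\<forall>\<^sub>F n in sequentially. 1 \<le> real (Suc n) * (x $ i - a $ i) \<and> 1 \<le> real (Suc n) * (b $ i - x $ i)" for i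
    using True by (intro eventually_conj) (auto simp: mem_box_cart)
  then have "\<forall>\<^sub>F n in sequentially. \<forall>i. 1 \<le> real (Suc n) * (x $ i - a $ i) \<and> 1 \<le> real (Suc n) * (b $ i - x $ i)"
    by (intro eventually_all_finite) auto
  then have "\<forall>\<^sub>F n in sequentially. plateau (real (Suc n)) a b x = indicator (box a b) x"
    by eventually_elim (subst plateau_eq_1, use True in auto)
  then show ?thesis by (rule tendsto_eventually)
next
  case False
  have "plateau (real (Suc n)) a b x = 0" for n
  proof (rule ccontr)
    assume "plateau (real (Suc n)) a b x \<noteq> 0"
    from plateau_nonzeroD[OF this] False show False by (auto simp: mem_box_cart)
  qed
  then show ?thesis using False by simp
qed

text \<open>The fundamental lemma of the calculus of variations. Plateaus converge boundedly to the indicators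
  of boxes, so \<open>h\<close> integrates to zero over every box whose closure lies in \<open>\<Omega>\<close>; countably many closed
  boxes exhaust \<open>\<Omega>\<close>.\<close>

lemma fundamental_lemma:
  fixes h :: "real^'n \<Rightarrow> 'b::euclidean_space"
  assumes \<Omega>: "open \<Omega>" and h: "locally_integrable \<Omega> h"
    and zero: "\<And>\<psi>. test_function \<Omega> \<psi> \<Longrightarrow> (\<integral>x. \<psi> x *\<^sub>R h x \<partial>lebesgue_on \<Omega>) = 0"
  shows "AE x in lebesgue_on \<Omega>. h x = 0"
proof -
  have \<Omega>s: "\<Omega> \<in> sets lebesgue" using \<Omega> by (simp add: sets_completionI_sets)
  have box0: "(\<integral>x. indicator (box a b) x *\<^sub>R h x \<partial>lebesgue) = 0" if ab: "cbox a b \<subseteq> \<Omega>" for a b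
  proof -
    have hI: "integrable (lebesgue_on (cbox a b)) h" using h ab by (auto simp: locally_integrable_def)
    have hI': "integrable lebesgue (\<lambda>x. indicator (cbox a b) x *\<^sub>R h x)"
      using hI by (simp add: integrable_restrict_space)
    let ?p = "\<lambda>n x. plateau (real (Suc n)) a b x"
    have pz: "?p n x = 0" if "x \<notin> cbox a b" for n x
    proof (rule ccontr)
      assume "?p n x \<noteq> 0"
      from plateau_nonzeroD[OF this] that show False by (auto simp: mem_box_cart less_imp_le)
    qed
    have pm: "?p n \<in> borel_measurable borel" for n
      by (intro borel_measurable_continuous_onI smooth_continuous_on smooth_plateau)
    have pml: "?p n \<in> borel_measurable lebesgue" for n
      by (rule measurable_completion) (use pm in simp)
    have "(\<lambda>n. \<integral>x. ?p n x *\<^sub>R (indicator (cbox a b) x *\<^sub>R h x) \<partial>lebesgue)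
        \<longlonglongrightarrow> (\<integral>x. indicator (box a b) x *\<^sub>R (indicator (cbox a b) x *\<^sub>R h x) \<partial>lebesgue)"
    proof (rule integral_dominated_convergence)
      show "integrable lebesgue (\<lambda>x. norm (indicator (cbox a b) x *\<^sub>R h x))" by (rule integrable_norm[OF hI'])
      show "AE x in lebesgue. (\<lambda>n. ?p n x *\<^sub>R (indicator (cbox a b) x *\<^sub>R h x)) \<longlonglongrightarrow> indicator (box a b) x *\<^sub>R (indicator (cbox a b) x *\<^sub>R h x)"
        by (intro AE_I2 tendsto_scaleR plateau_tendsto_indicator tendsto_const)
      show "AE x in lebesgue. norm (?p n x *\<^sub>R (indicator (cbox a b) x *\<^sub>R h x)) \<le> norm (indicator (cbox a b) x *\<^sub>R h x)" for n
        by (intro AE_I2) (auto simp: indicator_def plateau_nonneg plateau_le_1 intro!: mult_left_le_one_le)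
      show "(\<lambda>x. indicator (box a b) x *\<^sub>R (indicator (cbox a b) x *\<^sub>R h x)) \<in> borel_measurable lebesgue"
        by (rule borel_measurable_scaleR[OF borel_measurable_indicator borel_measurable_integrable[OF hI']]) auto
      show "(\<lambda>x. ?p n x *\<^sub>R (indicator (cbox a b) x *\<^sub>R h x)) \<in> borel_measurable lebesgue" for n
        by (rule borel_measurable_scaleR[OF pml borel_measurable_integrable[OF hI']])
    qed
    moreover have "(\<integral>x. ?p n x *\<^sub>R (indicator (cbox a b) x *\<^sub>R h x) \<partial>lebesgue) = 0" for n
    proof -
      have "(\<integral>x. ?p n x *\<^sub>R h x \<partial>lebesgue_on \<Omega>) = (\<integral>x. ?p n x *\<^sub>R (indicator (cbox a b) x *\<^sub>R h x) \<partial>lebesgue)"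
        by (rule lebesgue_on_compact_scaled_integrable(2)[OF hI _ pm _ _ ab \<Omega>s, where B=1])
           (auto simp: plateau_nonneg plateau_le_1 pz simp del: of_nat_Suc)
      then show ?thesis using zero[OF test_function_plateau[OF ab, of "real (Suc n)"]] by simp
    qed
    ultimately have "(\<lambda>n::nat. 0) \<longlonglongrightarrow> (\<integral>x. indicator (box a b) x *\<^sub>R (indicator (cbox a b) x *\<^sub>R h x) \<partial>lebesgue)"
      by (simp only:)
    then have "(\<integral>x. indicator (box a b) x *\<^sub>R (indicator (cbox a b) x *\<^sub>R h x) \<partial>lebesgue) = 0"
      unfolding LIMSEQ_const_iff by (rule sym)
    moreover have "indicator (box a b) x *\<^sub>R (indicator (cbox a b) x *\<^sub>R h x) = indicator (box a b) x *\<^sub>R h x" for x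
      using box_subset_cbox[of a b] by (auto simp: indicator_def)
    ultimately show ?thesis by (simp only:)
  qed
  have AEc: "AE x in lebesgue. x \<in> cbox c d \<longrightarrow> h x = 0" if cd: "cbox c d \<subseteq> \<Omega>" for c d
  proof -
    have "integrable (lebesgue_on (cbox c d)) h" using h cd by (auto simp: locally_integrable_def)
    then have hI: "integrable lebesgue (\<lambda>x. indicator (cbox c d) x *\<^sub>R h x)"
      by (simp add: integrable_restrict_space)
    then have hI': "integrable lebesgue (\<lambda>x. indicator (box c d) x *\<^sub>R h x)"
    proof -
      have "integrable lebesgue (\<lambda>x. indicator (box c d) x *\<^sub>R (indicator (cbox c d) x *\<^sub>R h x))"
        by (rule integrable_mult_indicator[OF _ hI]) auto
      moreover have "indicator (box c d) x *\<^sub>R (indicator (cbox c d) x *\<^sub>R h x) = indicator (box c d) x *\<^sub>R h x" for x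
        using box_subset_cbox[of c d] by (auto simp: indicator_def)
      ultimately show ?thesis by (simp only:)
    qed
    have "AE x in lebesgue. indicator (box c d) x *\<^sub>R h x = 0"
    proof (rule AE_zero_of_box_integrals[OF hI'])
      fix a b
      obtain a' b' where ab: "box a b \<inter> box c d = box a' b'" using box_Int_box by blast
      have "(\<integral>x. indicator (box a' b') x *\<^sub>R h x \<partial>lebesgue) = 0"
      proof (cases "box a' b' = {}")
        case False
        have "box a' b' \<subseteq> cbox c d" using ab box_subset_cbox by blast
        then have "closure (box a' b') \<subseteq> cbox c d" by (rule closure_minimal[OF _ closed_cbox])
        then show ?thesis using False cd by (intro box0) auto
      qed simp
      moreover have "indicator (box a b) x *\<^sub>R (indicator (box c d) x *\<^sub>R h x) = indicator (box a' b') x *\<^sub>R h x" for x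
        using ab[symmetric] by (auto simp: indicator_def)
      ultimately show "(\<integral>x. indicator (box a b) x *\<^sub>R (indicator (box c d) x *\<^sub>R h x) \<partial>lebesgue) = 0" by (simp only:)
    qed
    moreover have "AE x in lebesgue. x \<notin> cbox c d - box c d"
      by (rule AE_not_in) (use negligible_frontier_interval[of c d] in \<open>simp only: negligible_iff_null_sets\<close>)
    ultimately show ?thesis by eventually_elim (auto simp: indicator_def)
  qed
  obtain D where D: "countable D" "D \<subseteq> Pow \<Omega>" "\<And>X. X \<in> D \<Longrightarrow> \<exists>a b. X = cbox a b" "\<Union>D = \<Omega>"
    using open_countable_Union_open_cbox[OF \<Omega>] by metis
  have "AE x in lebesgue. \<forall>X\<in>D. x \<in> X \<longrightarrow> h x = 0"
    using D(1)
  proof (rule AE_ball_countable[THEN iffD2, rule_format])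
    fix X assume "X \<in> D"
    then obtain c d where "X = cbox c d" "cbox c d \<subseteq> \<Omega>" using D(2,3) by blast
    then show "AE x in lebesgue. x \<in> X \<longrightarrow> h x = 0" using AEc by simp
  qed
  then have "AE x in lebesgue. x \<in> \<Omega> \<longrightarrow> h x = 0"
    by eventually_elim (use D(4) in blast)
  then show ?thesis using \<Omega>s by (simp add: AE_restrict_space_iff)
qed

lemma locally_integrable_diff:
  "locally_integrable \<Omega> u \<Longrightarrow> locally_integrable \<Omega> v \<Longrightarrow> locally_integrable \<Omega> (\<lambda>x. u x - v x)"
  unfolding locally_integrable_def by auto

lemma has_weak_deriv_diff:
  assumes \<Omega>: "open \<Omega>" and u: "has_weak_deriv \<Omega> j u g" and v: "has_weak_deriv \<Omega> j v g'"
  shows "has_weak_deriv \<Omega> j (\<lambda>x. u x - v x) (\<lambda>x. g x - g' x)"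
proof -
  have \<Omega>s: "\<Omega> \<in> sets lebesgue" using \<Omega> by (simp add: sets_completionI_sets)
  have li: "locally_integrable \<Omega> u" "locally_integrable \<Omega> v" "locally_integrable \<Omega> g" "locally_integrable \<Omega> g'"
    using u v by (auto simp: has_weak_deriv_def)
  show ?thesis
    unfolding has_weak_deriv_def
  proof (intro conjI allI impI locally_integrable_diff li)
    fix \<psi> assume \<psi>: "test_function \<Omega> \<psi>"
    note I = test_function_mult_integrable2[OF \<psi> _ \<Omega>s]
    show "(\<integral>x. frechet_derivative \<psi> (at x) (axis j 1) *\<^sub>R (u x - v x) \<partial>lebesgue_on \<Omega>) =
        - (\<integral>x. \<psi> x *\<^sub>R (g x - g' x) \<partial>lebesgue_on \<Omega>)"
      using u v \<psi> by (simp add: scaleR_diff_right I li has_weak_deriv_def)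
  qed
qed

text \<open>This makes the representative chosen by \<open>wderiv\<close> irrelevant: up to null sets it is whichever weak
  derivative is at hand.\<close>

lemma has_weak_deriv_unique:
  assumes \<Omega>: "open \<Omega>" and g: "has_weak_deriv \<Omega> j u g" and g': "has_weak_deriv \<Omega> j u g'"
  shows "AE x in lebesgue_on \<Omega>. g x = g' x"
proof -
  have "AE x in lebesgue_on \<Omega>. g x - g' x = 0"
  proof (rule fundamental_lemma[OF \<Omega>])
    have d: "has_weak_deriv \<Omega> j (\<lambda>x. u x - u x) (\<lambda>x. g x - g' x)"
      by (rule has_weak_deriv_diff[OF assms])
    then show "locally_integrable \<Omega> (\<lambda>x. g x - g' x)" by (simp add: has_weak_deriv_def)
    show "(\<integral>x. \<psi> x *\<^sub>R (g x - g' x) \<partial>lebesgue_on \<Omega>) = 0" if "test_function \<Omega> \<psi>" for \<psi>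
      using d that by (simp add: has_weak_deriv_def)
  qed
  then show ?thesis by simp
qed

lemma has_weak_deriv_wderiv: "has_weak_deriv \<Omega> j u g \<Longrightarrow> has_weak_deriv \<Omega> j u (wderiv \<Omega> j u)"
  unfolding wderiv_def by (rule someI[of "has_weak_deriv \<Omega> j u"])

lemma compact_support_integrable:
  fixes f :: "'a::euclidean_space \<Rightarrow> 'b::euclidean_space"
  assumes "continuous_on UNIV f" "compact K" "\<And>x. x \<notin> K \<Longrightarrow> f x = 0"
  shows "integrable lborel f"
proof -
  have "integrable lborel (\<lambda>x. indicator K x *\<^sub>R f x)"
    using assms by (intro borel_integrable_compact) (auto intro: continuous_on_subset)
  moreover have "indicator K x *\<^sub>R f x = f x" for x using assms(3) by (auto simp: indicator_def)
  ultimately show ?thesis by simp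
qed

lemma lborel_integral_translate:
  fixes f :: "'a::euclidean_space \<Rightarrow> 'b::euclidean_space"
  assumes "f \<in> borel_measurable borel"
  shows "(\<integral>x. f (h + x) \<partial>lborel) = (\<integral>x. f x \<partial>lborel)"
    and "integrable lborel (\<lambda>x. f (h + x)) \<longleftrightarrow> integrable lborel f"
proof -
  have "(\<integral>x. f x \<partial>distr lborel borel ((+) h)) = (\<integral>x. f (h + x) \<partial>lborel)"
    using assms by (intro integral_distr) auto
  then show "(\<integral>x. f (h + x) \<partial>lborel) = (\<integral>x. f x \<partial>lborel)" by (simp add: lborel_distr_plus)
  have "integrable (distr lborel borel ((+) h)) f \<longleftrightarrow> integrable lborel (\<lambda>x. f (h + x))"
    using assms by (intro integrable_distr_eq) auto
  then show "integrable lborel (\<lambda>x. f (h + x)) \<longleftrightarrow> integrable lborel f" by (simp add: lborel_distr_plus)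
qed

text \<open>The integral of every difference quotient vanishes by translation invariance; the quotients are
  dominated because \<open>\<psi>\<close> is Lipschitz with compact support.\<close>

lemma integral_frechet_derivative_eq_0:
  fixes \<psi> :: "'a::euclidean_space \<Rightarrow> 'b::euclidean_space"
  assumes sm: "smooth \<psi>" and K: "compact (closure {x. \<psi> x \<noteq> 0})"
  shows "(\<integral>x. frechet_derivative \<psi> (at x) v \<partial>lborel) = 0"
proof -
  let ?K = "closure {x. \<psi> x \<noteq> 0}"
  define D where "D x = frechet_derivative \<psi> (at x) v" for x
  have cD: "continuous_on S D" for S
    unfolding D_def[abs_def] by (intro smooth_continuous_on smooth_frechet_derivative sm)
  have Dz: "D x = 0" if "x \<notin> ?K" for x
    using frechet_derivative_zero_outside_support[OF that] by (simp add: D_def)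
  have \<psi>z: "\<psi> x = 0" if "x \<notin> ?K" for x
    using that closure_subset[of "{x. \<psi> x \<noteq> 0}"] by blast
  have "compact (D ` ?K)" using K cD by (intro compact_continuous_image)
  then obtain C where "0 < C" "\<forall>y\<in>D ` ?K. norm y \<le> C" using compact_imp_bounded bounded_pos by metis
  then have C: "0 < C" "norm (D x) \<le> C" for x using Dz[of x] by (cases "x \<in> ?K"; force)+
  define h where "h n = (1 / real (Suc n)) *\<^sub>R v" for n
  define q where "q n x = real (Suc n) *\<^sub>R (\<psi> (h n + x) - \<psi> x)" for n x
  have lim: "(\<lambda>n. q n x) \<longlonglongrightarrow> D x" for x
  proof -
    define \<gamma> where "\<gamma> t = \<psi> (x + t *\<^sub>R v)" for t :: real
    have "(\<gamma> has_derivative (\<lambda>t. t *\<^sub>R D x)) (at 0)"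
    proof -
      have "((\<lambda>t. x + t *\<^sub>R v) has_derivative (\<lambda>t. t *\<^sub>R v)) (at 0)" by (auto intro!: derivative_eq_intros)
      from has_derivative_compose[OF this, of \<psi>] smooth_has_derivative[OF sm, of x]
      have "(\<gamma> has_derivative (\<lambda>t. frechet_derivative \<psi> (at x) (t *\<^sub>R v))) (at 0)" by (simp add: \<gamma>_def[abs_def])
      moreover have "frechet_derivative \<psi> (at x) (t *\<^sub>R v) = t *\<^sub>R D x" for t
        unfolding D_def using smooth_has_derivative[OF sm, of x] by (intro linear_cmul has_derivative_linear)
      ultimately show ?thesis by simp
    qed
    then have "(\<lambda>y. norm (\<gamma> y - \<gamma> 0 - y *\<^sub>R D x) / norm y) \<midarrow>0\<rightarrow> 0"
      by (simp add: has_derivative_iff_norm)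
    moreover have "filterlim (\<lambda>n. 1 / real (Suc n)) (at 0) sequentially"
      using LIMSEQ_Suc[OF lim_1_over_n[where 'a=real]] by (auto simp: filterlim_at)
    ultimately have "(\<lambda>n. norm (\<gamma> (1 / real (Suc n)) - \<gamma> 0 - (1 / real (Suc n)) *\<^sub>R D x) / norm (1 / real (Suc n))) \<longlonglongrightarrow> 0"
      by (rule filterlim_compose)
    moreover have "norm (\<gamma> (1 / real (Suc n)) - \<gamma> 0 - (1 / real (Suc n)) *\<^sub>R D x) / norm (1 / real (Suc n)) = norm (q n x - D x)" for n
    proof -
      have "q n x - D x = real (Suc n) *\<^sub>R (\<gamma> (1 / real (Suc n)) - \<gamma> 0 - (1 / real (Suc n)) *\<^sub>R D x)"
        by (simp add: q_def \<gamma>_def h_def scaleR_diff_right add.commute)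
      then show ?thesis by (simp add: divide_inverse mult.commute)
    qed
    ultimately have "(\<lambda>n. norm (q n x - D x)) \<longlonglongrightarrow> 0" by simp
    then show ?thesis by (metis LIM_zero_iff tendsto_norm_zero_iff)
  qed
  have qb: "norm (q n x) \<le> C" for n x
  proof -
    have "norm (\<psi> (x + (1 / real (Suc n)) *\<^sub>R v) - \<psi> (x + 0 *\<^sub>R v)) \<le> C * norm (1 / real (Suc n) - 0)"
    proof (rule differentiable_bound[where S=UNIV and f'="\<lambda>t s. frechet_derivative \<psi> (at (x + t *\<^sub>R v)) (s *\<^sub>R v)"])
      fix t :: real
      have l: "((\<lambda>t. x + t *\<^sub>R v) has_derivative (\<lambda>t. t *\<^sub>R v)) (at t)" by (auto intro!: derivative_eq_intros)
      show "((\<lambda>t. \<psi> (x + t *\<^sub>R v)) has_derivative (\<lambda>s. frechet_derivative \<psi> (at (x + t *\<^sub>R v)) (s *\<^sub>R v))) (at t)"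
        by (rule has_derivative_compose[OF l smooth_has_derivative[OF sm]])
      show "onorm (\<lambda>s. frechet_derivative \<psi> (at (x + t *\<^sub>R v)) (s *\<^sub>R v)) \<le> C"
      proof (rule onorm_le)
        fix s :: real
        have "frechet_derivative \<psi> (at (x + t *\<^sub>R v)) (s *\<^sub>R v) = s *\<^sub>R D (x + t *\<^sub>R v)"
          unfolding D_def using smooth_has_derivative[OF sm] by (intro linear_cmul has_derivative_linear)
        then show "norm (frechet_derivative \<psi> (at (x + t *\<^sub>R v)) (s *\<^sub>R v)) \<le> C * norm s"
          using mult_left_mono[OF C(2)[of "x + t *\<^sub>R v"], of "\<bar>s\<bar>"] by (simp add: mult.commute)
      qed
    qed auto
    then show ?thesis by (simp add: q_def h_def add.commute divide_inverse pos_le_divide_eq mult.commute)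
       (simp add: field_simps)
  qed
  define K' where "K' = (\<lambda>(x, t). x - t *\<^sub>R v) ` (?K \<times> {0..1::real})"
  have "continuous_on (?K \<times> {0..1}) (\<lambda>(x, t). x - t *\<^sub>R v)"
    by (simp add: case_prod_beta) (intro continuous_intros)
  then have K': "compact K'" unfolding K'_def using K by (intro compact_continuous_image compact_Times) auto
  have qz: "q n x = 0" if "x \<notin> K'" for n x
  proof -
    have "x \<notin> ?K"
    proof
      assume "x \<in> ?K" then have "x \<in> K'" unfolding K'_def by (intro image_eqI[of _ _ "(x, 0)"]) auto
      with that show False by simp
    qed
    moreover have "h n + x \<notin> ?K"
    proof
      assume "h n + x \<in> ?K" then have "x \<in> K'" unfolding K'_def
        by (intro image_eqI[of _ _ "(h n + x, 1 / real (Suc n))"]) (auto simp: h_def)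
      with that show False by simp
    qed
    ultimately have "\<psi> x = 0" "\<psi> (h n + x) = 0" by (auto intro: \<psi>z)
    then show ?thesis by (simp add: q_def)
  qed
  have \<psi>m: "\<psi> \<in> borel_measurable borel" by (intro borel_measurable_continuous_onI smooth_continuous_on sm)
  have \<psi>i: "integrable lborel \<psi>" by (rule compact_support_integrable[OF smooth_continuous_on[OF sm] K \<psi>z])
  have "(\<lambda>n. \<integral>x. q n x \<partial>lborel) \<longlonglongrightarrow> (\<integral>x. D x \<partial>lborel)"
  proof (rule integral_dominated_convergence)
    have "integrable lborel (indicat_real K')"
      using K' emeasure_bounded_finite[OF compact_imp_bounded[OF K']]
      by (intro integrable_real_indicator) (auto intro: borel_compact)
    then show "integrable lborel (\<lambda>x. C * indicat_real K' x)" by simp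
    show "AE x in lborel. (\<lambda>n. q n x) \<longlonglongrightarrow> D x" by (intro AE_I2 lim)
    show "AE x in lborel. norm (q n x) \<le> C * indicat_real K' x" for n
    proof (rule AE_I2)
      show "norm (q n x) \<le> C * indicat_real K' x" for x
        using qb[of n x] qz[of x n] by (cases "x \<in> K'") auto
    qed
    show "D \<in> borel_measurable lborel" using borel_measurable_continuous_onI[OF cD] by simp
    show "q n \<in> borel_measurable lborel" for n
      unfolding q_def[abs_def] using \<psi>m by measurable
  qed
  moreover have "(\<integral>x. q n x \<partial>lborel) = 0" for n
    using lborel_integral_translate[OF \<psi>m, of "h n"] \<psi>i by (simp add: q_def[abs_def])
  ultimately have "(\<lambda>n::nat. 0) \<longlonglongrightarrow> (\<integral>x. D x \<partial>lborel)" by (simp only:)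
  then have "(\<integral>x. D x \<partial>lborel) = 0" unfolding LIMSEQ_const_iff by (rule sym)
  then show ?thesis by (simp add: D_def)
qed

lemma continuous_integrable_lebesgue_on_compact:
  fixes f :: "'a::euclidean_space \<Rightarrow> 'b::euclidean_space"
  assumes "continuous_on UNIV f" "compact K"
  shows "integrable (lebesgue_on K) f"
proof -
  have "integrable lborel (\<lambda>x. indicator K x *\<^sub>R f x)"
    using assms by (intro borel_integrable_compact) (auto intro: continuous_on_subset)
  then have "integrable lebesgue (\<lambda>x. indicator K x *\<^sub>R f x)"
    by (subst integrable_completion) auto
  moreover have "K \<in> sets lebesgue" using assms(2) by (simp add: lmeasurable_compact fmeasurableD)
  ultimately show ?thesis by (simp add: integrable_restrict_space)
qed

lemma lebesgue_on_integral_eq_lborel: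
  fixes f :: "'a::euclidean_space \<Rightarrow> 'b::euclidean_space"
  assumes "f \<in> borel_measurable borel" "\<And>x. x \<notin> \<Omega> \<Longrightarrow> f x = 0" "\<Omega> \<in> sets lebesgue"
  shows "(\<integral>x. f x \<partial>lebesgue_on \<Omega>) = (\<integral>x. f x \<partial>lborel)"
proof -
  have "(\<integral>x. f x \<partial>lebesgue_on \<Omega>) = (\<integral>x. indicator \<Omega> x *\<^sub>R f x \<partial>lebesgue)"
    using assms(3) by (simp add: integral_restrict_space)
  also have "(\<lambda>x. indicator \<Omega> x *\<^sub>R f x) = f" using assms(2) by (auto simp: indicator_def)
  also have "(\<integral>x. f x \<partial>lebesgue) = (\<integral>x. f x \<partial>lborel)" using assms(1) by (intro integral_completion) simp
  finally show ?thesis .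
qed

text \<open>Integration by parts: \<open>\<psi> x *\<^sub>R \<phi> x\<close> has compact support, so the integral of its derivative
  vanishes.\<close>

lemma smooth_has_weak_deriv:
  fixes \<phi> :: "real^'n \<Rightarrow> 'b::euclidean_space"
  assumes \<Omega>: "open \<Omega>" and sm: "smooth \<phi>"
  shows "has_weak_deriv \<Omega> j \<phi> (\<lambda>x. frechet_derivative \<phi> (at x) (axis j 1))"
proof -
  have \<Omega>s: "\<Omega> \<in> sets lebesgue" using \<Omega> by (simp add: sets_completionI_sets)
  have li: "locally_integrable \<Omega> f" if "smooth f" for f :: "real^'n \<Rightarrow> 'b"
    unfolding locally_integrable_def
    by (intro allI impI continuous_integrable_lebesgue_on_compact smooth_continuous_on that) auto
  note sD = smooth_frechet_derivative[OF sm, of "axis j 1"]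
  show ?thesis
    unfolding has_weak_deriv_def
  proof (intro conjI allI impI li sm sD)
    fix \<psi> assume \<psi>: "test_function \<Omega> \<psi>"
    have s\<psi>: "smooth \<psi>" and K: "compact (closure {x. \<psi> x \<noteq> 0})" "closure {x. \<psi> x \<noteq> 0} \<subseteq> \<Omega>"
      using \<psi> by (auto simp: test_function_def)
    let ?p = "\<lambda>x. \<psi> x *\<^sub>R \<phi> x"
    have sp: "smooth ?p" by (rule smooth_scaleR[OF s\<psi> sm])
    have sub: "closure {x. ?p x \<noteq> 0} \<subseteq> closure {x. \<psi> x \<noteq> 0}" by (rule closure_mono) auto
    have Kp: "compact (closure {x. ?p x \<noteq> 0})"
      using K(1) sub by (meson bounded_subset closed_closure compact_eq_bounded_closed)
    have Dp: "frechet_derivative ?p (at x) v = \<psi> x *\<^sub>R frechet_derivative \<phi> (at x) v + frechet_derivative \<psi> (at x) v *\<^sub>R \<phi> x" for x v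
      using frechet_derivative_at[OF has_derivative_scaleR[OF smooth_has_derivative[OF s\<psi>] smooth_has_derivative[OF sm]]]
      by metis
    have "(\<integral>x. frechet_derivative ?p (at x) (axis j 1) \<partial>lebesgue_on \<Omega>) = (\<integral>x. frechet_derivative ?p (at x) (axis j 1) \<partial>lborel)"
    proof (rule lebesgue_on_integral_eq_lborel[OF _ _ \<Omega>s])
      show "(\<lambda>x. frechet_derivative ?p (at x) (axis j 1)) \<in> borel_measurable borel"
        by (intro borel_measurable_continuous_onI smooth_continuous_on smooth_frechet_derivative sp)
      show "frechet_derivative ?p (at x) (axis j 1) = 0" if "x \<notin> \<Omega>" for x
      proof -
        have "x \<notin> closure {x. ?p x \<noteq> 0}" using sub K(2) that by blast
        from frechet_derivative_zero_outside_support[OF this] show ?thesis by (rule fun_cong)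
      qed
    qed
    also have "\<dots> = 0" by (rule integral_frechet_derivative_eq_0[OF sp Kp])
    finally have "(\<integral>x. \<psi> x *\<^sub>R frechet_derivative \<phi> (at x) (axis j 1) + frechet_derivative \<psi> (at x) (axis j 1) *\<^sub>R \<phi> x \<partial>lebesgue_on \<Omega>) = 0"
      by (simp add: Dp)
    moreover have "(\<integral>x. \<psi> x *\<^sub>R frechet_derivative \<phi> (at x) (axis j 1) + frechet_derivative \<psi> (at x) (axis j 1) *\<^sub>R \<phi> x \<partial>lebesgue_on \<Omega>)
       = (\<integral>x. \<psi> x *\<^sub>R frechet_derivative \<phi> (at x) (axis j 1) \<partial>lebesgue_on \<Omega>) + (\<integral>x. frechet_derivative \<psi> (at x) (axis j 1) *\<^sub>R \<phi> x \<partial>lebesgue_on \<Omega>)"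
      by (intro Bochner_Integration.integral_add test_function_mult_integrable2[OF \<psi> _ \<Omega>s] li sm sD)
    ultimately show "(\<integral>x. frechet_derivative \<psi> (at x) (axis j 1) *\<^sub>R \<phi> x \<partial>lebesgue_on \<Omega>)
       = - (\<integral>x. \<psi> x *\<^sub>R frechet_derivative \<phi> (at x) (axis j 1) \<partial>lebesgue_on \<Omega>)"
      by (simp add: eq_neg_iff_add_eq_0 add.commute)
  qed
qed

lemma wderiv_AE_eq:
  assumes "open \<Omega>" "has_weak_deriv \<Omega> j u g"
  shows "AE x in lebesgue_on \<Omega>. wderiv \<Omega> j u x = g x"
  by (rule has_weak_deriv_unique[OF assms(1) has_weak_deriv_wderiv[OF assms(2)] assms(2)])

lemma borel_measurable_lebesgue_on_AE:
  fixes f :: "'a::euclidean_space \<Rightarrow> 'b::euclidean_space"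
  assumes f: "f \<in> borel_measurable (lebesgue_on \<Omega>)" and ae: "AE x in lebesgue_on \<Omega>. f x = g x" and \<Omega>: "\<Omega> \<in> sets lebesgue"
  shows "g \<in> borel_measurable (lebesgue_on \<Omega>)"
proof -
  have "(\<lambda>x. indicator \<Omega> x *\<^sub>R f x) \<in> borel_measurable lebesgue"
    using f \<Omega> by (simp add: borel_measurable_restrict_space_iff)
  moreover have "AE x in lebesgue. indicator \<Omega> x *\<^sub>R f x = indicator \<Omega> x *\<^sub>R g x"
    using ae \<Omega> by (auto simp: AE_restrict_space_iff indicator_def)
  ultimately have "(\<lambda>x. indicator \<Omega> x *\<^sub>R g x) \<in> borel_measurable lebesgue" by (rule borel_measurable_AE)
  then show ?thesis using \<Omega> by (simp add: borel_measurable_restrict_space_iff)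
qed

lemma H1_has_weak_deriv: "H1 \<Omega> u \<Longrightarrow> has_weak_deriv \<Omega> j u (wderiv \<Omega> j u)"
  unfolding H1_def using has_weak_deriv_wderiv by blast

text \<open>The definition of \<open>H1\<close> provides some square-integrable weak derivative; \<open>wderiv\<close> agrees with it
  almost everywhere, and Lebesgue measure is complete.\<close>

lemma H1_wderiv_L2:
  assumes \<Omega>: "open \<Omega>" and u: "H1 \<Omega> u" shows "L2 (lebesgue_on \<Omega>) (wderiv \<Omega> j u)"
proof -
  have \<Omega>s: "\<Omega> \<in> sets lebesgue" using \<Omega> by (simp add: sets_completionI_sets)
  obtain g where g: "has_weak_deriv \<Omega> j u g" "L2 (lebesgue_on \<Omega>) g" using u by (auto simp: H1_def)
  have ae: "AE x in lebesgue_on \<Omega>. wderiv \<Omega> j u x = g x" by (rule wderiv_AE_eq[OF \<Omega> g(1)])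
  have "wderiv \<Omega> j u \<in> borel_measurable (lebesgue_on \<Omega>)"
    using ae by (intro borel_measurable_lebesgue_on_AE[OF L2_measurable[OF g(2)] _ \<Omega>s]) (auto elim: eventually_mono)
  then show ?thesis
    by (rule L2_bound[OF g(2), where B=1]) (use ae in \<open>auto elim: eventually_mono\<close>)
qed

lemma H1_diff:
  assumes \<Omega>: "open \<Omega>" and "H1 \<Omega> u" "H1 \<Omega> v" shows "H1 \<Omega> (\<lambda>x. u x - v x)"
  unfolding H1_def
proof (intro conjI allI)
  show "L2 (lebesgue_on \<Omega>) (\<lambda>x. u x - v x)" using assms by (auto simp: H1_def intro: L2_diff)
  show "\<exists>g. has_weak_deriv \<Omega> j (\<lambda>x. u x - v x) g \<and> L2 (lebesgue_on \<Omega>) g" for j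
    using has_weak_deriv_diff[OF \<Omega> H1_has_weak_deriv[OF assms(2)] H1_has_weak_deriv[OF assms(3)]]
      L2_diff[OF H1_wderiv_L2[OF \<Omega> assms(2)] H1_wderiv_L2[OF \<Omega> assms(3)]] by blast
qed

text \<open>\<open>wderiv\<close> is additive only up to null sets, which norms do not see.\<close>

lemma l2_norm_wderiv_diff:
  assumes \<Omega>: "open \<Omega>" and u: "H1 \<Omega> u" and v: "H1 \<Omega> v"
  shows "l2_norm (lebesgue_on \<Omega>) (wderiv \<Omega> j (\<lambda>x. u x - v x))
    = l2_norm (lebesgue_on \<Omega>) (\<lambda>x. wderiv \<Omega> j u x - wderiv \<Omega> j v x)"
proof (rule l2_norm_cong_AE)
  show "AE x in lebesgue_on \<Omega>. norm (wderiv \<Omega> j (\<lambda>x. u x - v x) x) = norm (wderiv \<Omega> j u x - wderiv \<Omega> j v x)"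
    using wderiv_AE_eq[OF \<Omega> has_weak_deriv_diff[where j=j, OF \<Omega> H1_has_weak_deriv[OF u] H1_has_weak_deriv[OF v]]]
    by eventually_elim simp
qed (use assms in \<open>auto intro!: L2_measurable L2_diff H1_wderiv_L2 H1_diff\<close>)

lemma continuous_L2_bounded:
  fixes f :: "'a::euclidean_space \<Rightarrow> 'b::euclidean_space"
  assumes "continuous_on UNIV f" "bounded \<Omega>" "\<Omega> \<in> sets lebesgue"
  shows "L2 (lebesgue_on \<Omega>) f"
proof -
  have fm: "f \<in> borel_measurable lebesgue"
    by (rule measurable_completion) (use assms(1) in \<open>auto intro: borel_measurable_continuous_onI\<close>)
  have c: "compact (closure \<Omega>)" using assms(2) by (simp add: compact_closure)
  have cs: "closure \<Omega> \<in> sets lebesgue" using c by (simp add: lmeasurable_compact fmeasurableD)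
  have "integrable (lebesgue_on (closure \<Omega>)) (\<lambda>x. (norm (f x))\<^sup>2)"
    using assms(1) c by (intro continuous_integrable_lebesgue_on_compact continuous_intros) auto
  then have "set_integrable lebesgue (closure \<Omega>) (\<lambda>x. (norm (f x))\<^sup>2)"
    using cs by (simp add: integrable_restrict_space set_integrable_def)
  then have "set_integrable lebesgue \<Omega> (\<lambda>x. (norm (f x))\<^sup>2)"
    using assms(3) closure_subset by (rule set_integrable_subset)
  then have "integrable (lebesgue_on \<Omega>) (\<lambda>x. (norm (f x))\<^sup>2)"
    using assms(3) by (simp add: integrable_restrict_space set_integrable_def)
  then show ?thesis using fm by (auto simp: L2_def intro: measurable_restrict_space1)
qed

lemma smooth_H1:
  fixes \<phi> :: "real^'n \<Rightarrow> 'b::euclidean_space"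
  assumes \<Omega>: "open \<Omega>" "bounded \<Omega>" and sm: "smooth \<phi>" shows "H1 \<Omega> \<phi>"
  unfolding H1_def
proof (intro conjI allI)
  have \<Omega>s: "\<Omega> \<in> sets lebesgue" using \<Omega> by (simp add: sets_completionI_sets)
  show "L2 (lebesgue_on \<Omega>) \<phi>" by (rule continuous_L2_bounded[OF smooth_continuous_on[OF sm] \<Omega>(2) \<Omega>s])
  show "\<exists>g. has_weak_deriv \<Omega> j \<phi> g \<and> L2 (lebesgue_on \<Omega>) g" for j
    using smooth_has_weak_deriv[OF \<Omega>(1) sm]
      continuous_L2_bounded[OF smooth_continuous_on[OF smooth_frechet_derivative[OF sm]] \<Omega>(2) \<Omega>s] by blast
qed

lemma l2_norm_wderiv_smooth_diff:
  fixes \<phi> :: "real^'n \<Rightarrow> 'b::euclidean_space"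
  assumes \<Omega>: "open \<Omega>" "bounded \<Omega>" and sm: "smooth \<phi>" and u: "H1 \<Omega> u"
  shows "l2_norm (lebesgue_on \<Omega>) (wderiv \<Omega> j (\<lambda>x. \<phi> x - u x))
    = l2_norm (lebesgue_on \<Omega>) (\<lambda>x. frechet_derivative \<phi> (at x) (axis j 1) - wderiv \<Omega> j u x)"
proof (rule l2_norm_cong_AE)
  note \<phi>1 = smooth_H1[OF \<Omega> sm]
  have \<Omega>s: "\<Omega> \<in> sets lebesgue" using \<Omega> by (simp add: sets_completionI_sets)
  show "AE x in lebesgue_on \<Omega>. norm (wderiv \<Omega> j (\<lambda>x. \<phi> x - u x) x) = norm (frechet_derivative \<phi> (at x) (axis j 1) - wderiv \<Omega> j u x)"
    using wderiv_AE_eq[OF \<Omega>(1) has_weak_deriv_diff[where j=j, OF \<Omega>(1) smooth_has_weak_deriv[OF \<Omega>(1) sm] H1_has_weak_deriv[OF u]]]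
    by eventually_elim simp
  show "wderiv \<Omega> j (\<lambda>x. \<phi> x - u x) \<in> borel_measurable (lebesgue_on \<Omega>)"
    by (intro L2_measurable H1_wderiv_L2 H1_diff \<Omega> \<phi>1 u)
  show "(\<lambda>x. frechet_derivative \<phi> (at x) (axis j 1) - wderiv \<Omega> j u x) \<in> borel_measurable (lebesgue_on \<Omega>)"
    by (intro L2_measurable L2_diff H1_wderiv_L2 \<Omega> u
        continuous_L2_bounded[OF smooth_continuous_on[OF smooth_frechet_derivative[OF sm]] \<Omega>(2) \<Omega>s])
qed

section \<open>Hausdorff measure\<close>

definition hgauge :: "nat \<Rightarrow> 'a::metric_space set \<Rightarrow> ennreal" where
  "hgauge s U = ennreal (unit_ball_vol (real s) * (diameter U / 2) ^ s)"

definition fine_covers :: "real \<Rightarrow> 'a::metric_space set \<Rightarrow> (nat \<Rightarrow> 'a set) set" where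
  "fine_covers \<delta> A = {U. A \<subseteq> (\<Union>n. U n) \<and> (\<forall>n. bounded (U n) \<and> diameter (U n) \<le> \<delta>)}"

text \<open>The outer measure at scale \<open>\<delta>\<close>, whose supremum over all scales is the Hausdorff outer
  measure.\<close>

definition hcontent :: "nat \<Rightarrow> real \<Rightarrow> 'a::metric_space set \<Rightarrow> ennreal" where
  "hcontent s \<delta> A = (INF U\<in>fine_covers \<delta> A. \<Sum>n. hgauge s (U n))"

lemma hausdorff_outer_eq: "hausdorff_outer s A = (SUP \<delta>\<in>{0<..}. hcontent s \<delta> A)"
  unfolding hausdorff_outer_def hcontent_def fine_covers_def hgauge_def ..

lemma hcontent_le_hausdorff_outer: "0 < \<delta> \<Longrightarrow> hcontent s \<delta> A \<le> hausdorff_outer s A"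
  unfolding hausdorff_outer_eq by (auto intro: SUP_upper)

lemma hgauge_empty: "0 < s \<Longrightarrow> hgauge s {} = 0"
  by (simp add: hgauge_def)

lemma hcontent_mono: "A \<subseteq> B \<Longrightarrow> hcontent s \<delta> A \<le> hcontent s \<delta> B"
  unfolding hcontent_def by (rule INF_superset_mono) (auto simp: fine_covers_def)

lemma hcontent_antimono: "\<delta> \<le> \<delta>' \<Longrightarrow> hcontent s \<delta>' A \<le> hcontent s \<delta> A"
  unfolding hcontent_def by (rule INF_superset_mono) (auto simp: fine_covers_def intro: order_trans)

lemma hausdorff_outer_mono: "A \<subseteq> B \<Longrightarrow> hausdorff_outer s A \<le> hausdorff_outer s B"
  unfolding hausdorff_outer_eq by (intro SUP_mono) (auto intro: hcontent_mono)

lemma hcontent_le_finite_cover: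
  assumes "0 < s" "0 \<le> \<delta>" "finite I" "A \<subseteq> (\<Union>i\<in>I. U i)"
    and "\<And>i. i \<in> I \<Longrightarrow> bounded (U i) \<and> diameter (U i) \<le> \<delta>"
  shows "hcontent s \<delta> A \<le> (\<Sum>i\<in>I. hgauge s (U i))"
proof -
  obtain h where h: "bij_betw h {0..<card I} I"
    using ex_bij_betw_nat_finite[OF assms(3)] by blast
  define V where "V n = (if n < card I then U (h n) else {})" for n
  have hI: "h n \<in> I" if "n < card I" for n
    using bij_betwE[OF h] that by auto
  have cov: "A \<subseteq> (\<Union>n. V n)"
  proof
    fix x assume "x \<in> A"
    then obtain i where i: "i \<in> I" "x \<in> U i" using assms(4) by blast
    then obtain n where "n < card I" "h n = i"
      using bij_betw_imp_surj_on[OF h] by (metis atLeastLessThan_iff imageE)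
    then show "x \<in> (\<Union>n. V n)" using i by (auto simp: V_def intro!: exI[of _ n])
  qed
  have "V \<in> fine_covers \<delta> A"
    using cov assms(2,5) hI by (auto simp: fine_covers_def V_def)
  then have "hcontent s \<delta> A \<le> (\<Sum>n. hgauge s (V n))"
    unfolding hcontent_def by (rule INF_lower)
  also have "\<dots> = (\<Sum>n<card I. hgauge s (V n))"
    by (rule suminf_finite) (auto simp: V_def hgauge_empty assms(1))
  also have "\<dots> = (\<Sum>n\<in>{0..<card I}. hgauge s (U (h n)))"
    by (rule sum.cong) (auto simp: V_def)
  also have "\<dots> = (\<Sum>i\<in>I. hgauge s (U i))"
    by (rule sum.reindex_bij_betw[OF h])
  finally show ?thesis .
qed

lemma hausdorff_outer_empty: "0 < s \<Longrightarrow> hausdorff_outer s {} = 0"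
  unfolding hausdorff_outer_eq
proof (rule antisym[OF SUP_least])
  fix \<delta> :: real assume "0 < s" "\<delta> \<in> {0<..}"
  then show "hcontent s \<delta> {} \<le> 0"
    using hcontent_le_finite_cover[of s \<delta> "{}" "{}"] by simp
qed simp

text \<open>As for every outer measure defined by coverings: choose a cover of \<open>A n\<close> that is optimal up to
  \<open>e / 2 ^ Suc n\<close> and enumerate the pairs of indices.\<close>

lemma hcontent_countably_subadditive:
  "hcontent s \<delta> (\<Union>n. A n) \<le> (\<Sum>n. hcontent s \<delta> (A n))"
proof (rule ennreal_le_epsilon)
  fix e :: real assume fin: "(\<Sum>n. hcontent s \<delta> (A n)) < top" and e: "0 < e"
  have "\<exists>U. U \<in> fine_covers \<delta> (A n) \<and> (\<Sum>m. hgauge s (U m)) \<le> hcontent s \<delta> (A n) + ennreal (e * (1/2) ^ Suc n)" for n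
  proof -
    have "hcontent s \<delta> (A n) < top"
      using fin ennreal_suminf_lessD by blast
    moreover have "0 < ennreal (e * (1/2) ^ Suc n)"
      using e by simp
    ultimately have "hcontent s \<delta> (A n) < hcontent s \<delta> (A n) + ennreal (e * (1/2) ^ Suc n)"
      using ennreal_add_left_cancel_less[of "hcontent s \<delta> (A n)" 0] by simp
    then show ?thesis
      unfolding hcontent_def INF_less_iff by (auto intro: less_imp_le)
  qed
  then obtain U where U: "\<And>n. U n \<in> fine_covers \<delta> (A n)"
    "\<And>n. (\<Sum>m. hgauge s (U n m)) \<le> hcontent s \<delta> (A n) + ennreal (e * (1/2) ^ Suc n)" by metis
  define V where "V i = (case prod_decode i of (n, m) \<Rightarrow> U n m)" for i
  have "V \<in> fine_covers \<delta> (\<Union>n. A n)"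
    unfolding fine_covers_def
  proof (intro CollectI conjI allI subsetI)
    fix x assume "x \<in> (\<Union>n. A n)"
    then obtain n where "x \<in> A n" by blast
    then obtain m where "x \<in> U n m" using U(1)[of n] by (auto simp: fine_covers_def)
    then show "x \<in> (\<Union>i. V i)" by (auto simp: V_def intro!: exI[of _ "prod_encode (n, m)"])
  qed (use U(1) in \<open>auto simp: V_def fine_covers_def split: prod.split\<close>)
  then have "hcontent s \<delta> (\<Union>n. A n) \<le> (\<Sum>i. hgauge s (V i))"
    unfolding hcontent_def by (rule INF_lower)
  also have "\<dots> = (\<Sum>i. (\<lambda>(n, m). hgauge s (U n m)) (prod_decode i))"
    by (simp add: V_def prod.case_distrib)
  also have "\<dots> = (\<Sum>n. \<Sum>m. hgauge s (U n m))"
    by (rule suminf_ennreal_2dimen) simp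
  also have "\<dots> \<le> (\<Sum>n. hcontent s \<delta> (A n) + ennreal (e * (1/2) ^ Suc n))"
    by (intro suminf_le U(2)) auto
  also have "\<dots> = (\<Sum>n. hcontent s \<delta> (A n)) + (\<Sum>n. ennreal (e * (1/2) ^ Suc n))"
    by (rule suminf_add[symmetric]) auto
  also have "(\<Sum>n. ennreal (e * (1/2) ^ Suc n)) = ennreal e"
    using sums_mult[OF power_half_series, of e] e by (intro suminf_ennreal_eq) auto
  finally show "hcontent s \<delta> (\<Union>n. A n) \<le> (\<Sum>n. hcontent s \<delta> (A n)) + ennreal e" .
qed

lemma hausdorff_outer_countably_subadditive:
  "hausdorff_outer s (\<Union>n. A n) \<le> (\<Sum>n. hausdorff_outer s (A n))"
  unfolding hausdorff_outer_eq[of s "\<Union>n. A n"]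
proof (rule SUP_least)
  fix \<delta> :: real assume "\<delta> \<in> {0<..}"
  then show "hcontent s \<delta> (\<Union>n. A n) \<le> (\<Sum>n. hausdorff_outer s (A n))"
    by (intro order_trans[OF hcontent_countably_subadditive] suminf_le) (auto intro: hcontent_le_hausdorff_outer)
qed

lemma hausdorff_outer_Un_le:
  assumes "0 < s" shows "hausdorff_outer s (A \<union> B) \<le> hausdorff_outer s A + hausdorff_outer s B"
proof -
  have "hausdorff_outer s (A \<union> B) \<le> (\<Sum>n. hausdorff_outer s (binaryset A B n))"
    using hausdorff_outer_countably_subadditive[of s "binaryset A B"] by (simp add: UN_binaryset_eq)
  also have "\<dots> = hausdorff_outer s A + hausdorff_outer s B"
    by (rule suminf_binaryset_eq) (rule hausdorff_outer_empty[OF assms])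
  finally show ?thesis .
qed

text \<open>A set of diameter less than the distance of \<open>A\<close> and \<open>B\<close> meets at most one of them, so a fine
  cover of \<open>A \<union> B\<close> splits into a cover of \<open>A\<close> and a cover of \<open>B\<close>.\<close>

lemma hausdorff_outer_separated:
  assumes s: "0 < s" and \<eta>: "0 < \<eta>" and sep: "\<And>x y. x \<in> A \<Longrightarrow> y \<in> B \<Longrightarrow> \<eta> \<le> dist x y"
  shows "hausdorff_outer s A + hausdorff_outer s B \<le> hausdorff_outer s (A \<union> B)"
proof -
  have split: "hcontent s \<delta> A + hcontent s \<delta> B \<le> hcontent s \<delta> (A \<union> B)" if \<delta>: "0 < \<delta>" "\<delta> < \<eta>" for \<delta>
    unfolding hcontent_def[of _ _ "A \<union> B"]
  proof (rule INF_greatest)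
    fix U assume U: "U \<in> fine_covers \<delta> (A \<union> B)"
    define UA where "UA n = (if U n \<inter> A = {} then {} else U n)" for n
    define UB where "UB n = (if U n \<inter> B = {} then {} else U n)" for n
    have "UA \<in> fine_covers \<delta> A" "UB \<in> fine_covers \<delta> B"
      using U \<delta>(1) by (fastforce simp: fine_covers_def UA_def UB_def)+
    then have "hcontent s \<delta> A + hcontent s \<delta> B \<le> (\<Sum>n. hgauge s (UA n)) + (\<Sum>n. hgauge s (UB n))"
      unfolding hcontent_def by (intro add_mono INF_lower)
    also have "\<dots> = (\<Sum>n. hgauge s (UA n) + hgauge s (UB n))" by (rule suminf_add) auto
    also have "\<dots> \<le> (\<Sum>n. hgauge s (U n))"
    proof (intro suminf_le allI)
      fix n
      have "U n \<inter> A = {} \<or> U n \<inter> B = {}"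
      proof (rule ccontr)
        assume "\<not> ?thesis"
        then obtain x y where xy: "x \<in> U n" "x \<in> A" "y \<in> U n" "y \<in> B" by blast
        have "dist x y \<le> diameter (U n)"
          using U xy by (auto simp: fine_covers_def intro: diameter_bounded_bound)
        also have "\<dots> \<le> \<delta>" using U by (auto simp: fine_covers_def)
        finally show False using sep[OF xy(2,4)] \<delta>(2) by linarith
      qed
      then show "hgauge s (UA n) + hgauge s (UB n) \<le> hgauge s (U n)"
        by (auto simp: UA_def UB_def hgauge_empty[OF s])
    qed auto
    finally show "hcontent s \<delta> A + hcontent s \<delta> B \<le> (\<Sum>n. hgauge s (U n))" .
  qed
  have "hcontent s \<delta>1 A + hcontent s \<delta>2 B \<le> hausdorff_outer s (A \<union> B)" if "0 < \<delta>1" "0 < \<delta>2" for \<delta>1 \<delta>2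
  proof -
    define \<delta> where "\<delta> = min (min \<delta>1 \<delta>2) (\<eta> / 2)"
    have \<delta>: "0 < \<delta>" "\<delta> < \<eta>" "\<delta> \<le> \<delta>1" "\<delta> \<le> \<delta>2" using that \<eta> by (auto simp: \<delta>_def)
    have "hcontent s \<delta>1 A + hcontent s \<delta>2 B \<le> hcontent s \<delta> A + hcontent s \<delta> B"
      by (intro add_mono hcontent_antimono \<delta>)
    also have "\<dots> \<le> hcontent s \<delta> (A \<union> B)" by (rule split[OF \<delta>(1,2)])
    also have "\<dots> \<le> hausdorff_outer s (A \<union> B)" by (rule hcontent_le_hausdorff_outer[OF \<delta>(1)])
    finally show ?thesis .
  qed
  note le = this
  have ne: "{0<..} \<noteq> ({}::real set)" by (metis greaterThan_iff less_numeral_extra(1) empty_iff)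
  show ?thesis
    unfolding hausdorff_outer_eq[of s A] ennreal_SUP_add_left[OF ne, symmetric]
  proof (rule SUP_least)
    fix \<delta>1 :: real assume "\<delta>1 \<in> {0<..}"
    then show "hcontent s \<delta>1 A + hausdorff_outer s B \<le> hausdorff_outer s (A \<union> B)"
      unfolding hausdorff_outer_eq[of s B] ennreal_SUP_add_right[OF ne]
      by (intro SUP_least le) auto
  qed
qed

text \<open>The shells \<open>R k\<close> around \<open>C\<close> with indices of equal parity are separated, so their measures are
  summable when \<open>E\<close> has finite measure, and the shells that \<open>L n\<close> omits from \<open>E - C\<close> contribute
  arbitrarily little.\<close>

lemma hausdorff_outer_closed_split:
  fixes C E :: "'a::metric_space set"
  assumes s: "0 < s" and C: "closed C"
  shows "hausdorff_outer s (E \<inter> C) + hausdorff_outer s (E - C) \<le> hausdorff_outer s E"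
proof (cases "C = {} \<or> hausdorff_outer s E = top")
  case True
  then show ?thesis by (auto simp: hausdorff_outer_empty[OF s])
next
  case False
  let ?f = "hausdorff_outer s"
  let ?g = "\<lambda>x. infdist x C"
  have ne: "C \<noteq> {}" and fin: "?f E < top" using False by (auto simp: less_top)
  have fin': "?f A < top" if "A \<subseteq> E" for A
    using hausdorff_outer_mono[OF that, of s] fin by (metis order.strict_trans1)
  have lip: "?g x - ?g y \<le> dist x y" for x y
    using infdist_triangle[of x C y] by linarith
  define L where "L n = {x \<in> E. 1 / 2 ^ n < ?g x}" for n :: nat
  define R where "R k = {x \<in> E. 1 / 2 ^ Suc k < ?g x \<and> ?g x \<le> 1 / 2 ^ k}" for k :: nat
  \<comment> \<open>Consecutive shells touch, but shells whose indices differ by at least \<open>2\<close> are separated.\<close>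
  have par: "?f (\<Union>k\<in>{k. k < n \<and> P k}. R k) + ?f (R n) \<le> ?f ((\<Union>k\<in>{k. k < n \<and> P k}. R k) \<union> R n)"
    if P: "\<And>k. k < n \<Longrightarrow> P k \<Longrightarrow> Suc k < n" for n P
  proof (rule hausdorff_outer_separated[OF s, of "1 / 2 ^ n"])
    fix x y assume "x \<in> (\<Union>k\<in>{k. k < n \<and> P k}. R k)" and y: "y \<in> R n"
    then obtain k where k: "k < n" "P k" "x \<in> R k" by blast
    have "Suc (Suc k) \<le> n" using P[OF k(1,2)] by simp
    then have "2 ^ Suc (Suc k) \<le> (2::real) ^ n" by (intro power_increasing) auto
    then have "2 * (1 / 2 ^ n) \<le> 1 / (2::real) ^ Suc k" by (simp add: field_simps)
    with k(3) y lip[of x y] show "1 / 2 ^ n \<le> dist x y" by (auto simp: R_def)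
  qed simp
  have "(\<Sum>k<n. ?f (R k)) \<le> ?f (\<Union>k\<in>{k. k < n \<and> even k}. R k) + ?f (\<Union>k\<in>{k. k < n \<and> odd k}. R k)" for n
  proof (induction n)
    case (Suc n)
    have eq: "(\<Union>k\<in>{k. k < Suc n \<and> P k}. R k) = (if P n then (\<Union>k\<in>{k. k < n \<and> P k}. R k) \<union> R n else (\<Union>k\<in>{k. k < n \<and> P k}. R k))" for P
      by (auto simp: less_Suc_eq)
    have comb: "a + c \<le> e' + d" "a + c \<le> d + e'" if "a \<le> b + d" "b + c \<le> e'" for a b c d e' :: ennreal
    proof -
      have "a + c \<le> (b + d) + c" using that(1) by (rule add_right_mono)
      also have "\<dots> = (b + c) + d" by (simp add: ac_simps)
      also have "\<dots> \<le> e' + d" using that(2) by (rule add_right_mono)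
      finally show "a + c \<le> e' + d" "a + c \<le> d + e'" by (simp_all add: add.commute)
    qed
    have parity: "Suc k < n" if "k < n" "even k = even n" for k using that by (metis Suc_lessI even_Suc)
    show ?case
    proof (cases "even n")
      case True
      then have "?f (\<Union>k\<in>{k. k < n \<and> even k}. R k) + ?f (R n) \<le> ?f ((\<Union>k\<in>{k. k < n \<and> even k}. R k) \<union> R n)"
        by (intro par parity) auto
      from comb(1)[OF Suc this] show ?thesis
        unfolding eq using True by simp
    next
      case False
      then have "?f (\<Union>k\<in>{k. k < n \<and> odd k}. R k) + ?f (R n) \<le> ?f ((\<Union>k\<in>{k. k < n \<and> odd k}. R k) \<union> R n)"
        by (intro par parity) auto
      from comb(2)[OF Suc[unfolded add.commute[of "?f (\<Union>k\<in>{k. k < n \<and> even k}. R k)"]] this] show ?thesis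
        unfolding eq using False by simp
    qed
  qed simp
  also have "?f (\<Union>k\<in>{k. k < n \<and> even k}. R k) + ?f (\<Union>k\<in>{k. k < n \<and> odd k}. R k) \<le> ?f E + ?f E" for n
    by (intro add_mono hausdorff_outer_mono) (auto simp: R_def)
  finally have "(\<Sum>k. ?f (R k)) \<le> ?f E + ?f E"
    unfolding suminf_eq_SUP by (intro SUP_least)
  also have "\<dots> < top" using fin by simp
  finally have sumfin: "(\<Sum>k. ?f (R k)) < top" .
  define r where "r k = enn2real (?f (R k))" for k
  have r: "?f (R k) = ennreal (r k)" for k
    unfolding r_def using fin'[of "R k"] by (simp add: R_def ennreal_enn2real less_top)
  have r0: "0 \<le> r k" for k by (simp add: r_def)
  have sr: "summable r"
    using sumfin r0 unfolding r by (intro summable_suminf_not_top) auto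
  show ?thesis
  proof (rule ennreal_le_epsilon)
    fix e :: real assume e: "0 < e"
    obtain n where n: "(\<Sum>k. r (k + n)) < e"
      using suminf_exist_split[OF e sr] r0 by (metis abs_of_nonneg abs_ge_self le_less_trans order_refl real_norm_def)
    have "E - C \<subseteq> L n \<union> (\<Union>k. R (k + n))"
    proof
      fix x assume x: "x \<in> E - C"
      then have g: "0 < ?g x" using infdist_pos_not_in_closed[OF C ne, of x] by simp
      show "x \<in> L n \<union> (\<Union>k. R (k + n))"
      proof (cases "1 / 2 ^ n < ?g x")
        case False
        obtain m where "(1/2) ^ m < ?g x" using real_arch_pow_inv[OF g, of "1/2"] by auto
        then have ex: "\<exists>m. 1 / 2 ^ m < ?g x" by (auto simp: power_one_over)
        define m where "m = (LEAST m. 1 / 2 ^ m < ?g x)"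
        have m: "1 / 2 ^ m < ?g x" unfolding m_def using ex by (rule LeastI_ex)
        have "n < m"
        proof (rule ccontr)
          assume "\<not> n < m"
          then have "1 / 2 ^ n \<le> 1 / (2::real) ^ m" by (intro divide_left_mono power_increasing) auto
          with m False show False by linarith
        qed
        then obtain k where k: "m = Suc (k + n)" by (metis less_imp_Suc_add add.commute)
        have "\<not> 1 / 2 ^ (k + n) < ?g x" using not_less_Least[of "k + n" "\<lambda>m. 1 / 2 ^ m < ?g x"] k m_def by simp
        with m k x have "x \<in> R (k + n)" by (simp add: R_def)
        then show ?thesis by blast
      qed (use x in \<open>simp add: L_def\<close>)
    qed
    then have "?f (E - C) \<le> ?f (L n \<union> (\<Union>k. R (k + n)))" by (rule hausdorff_outer_mono)
    also have "\<dots> \<le> ?f (L n) + ?f (\<Union>k. R (k + n))" by (rule hausdorff_outer_Un_le[OF s])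
    also have "?f (\<Union>k. R (k + n)) \<le> (\<Sum>k. ?f (R (k + n)))" by (rule hausdorff_outer_countably_subadditive)
    also have "\<dots> = ennreal (\<Sum>k. r (k + n))"
      unfolding r using summable_ignore_initial_segment[OF sr] r0 by (intro suminf_ennreal2) auto
    also have "\<dots> \<le> ennreal e" using n by (intro ennreal_leI) simp
    finally have "?f (E - C) \<le> ?f (L n) + ennreal e" by (simp add: add_left_mono)
    then have "?f (E \<inter> C) + ?f (E - C) \<le> (?f (E \<inter> C) + ?f (L n)) + ennreal e"
      by (metis add.assoc add_left_mono)
    also have "?f (E \<inter> C) + ?f (L n) \<le> ?f ((E \<inter> C) \<union> L n)"
    proof (rule hausdorff_outer_separated[OF s, of "1 / 2 ^ n"])
      fix x y assume "x \<in> E \<inter> C" "y \<in> L n"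
      then show "1 / 2 ^ n \<le> dist x y" using lip[of y x] by (simp add: L_def dist_commute)
    qed simp
    also have "\<dots> \<le> ?f E" by (rule hausdorff_outer_mono) (auto simp: L_def)
    finally show "?f (E \<inter> C) + ?f (E - C) \<le> ?f E + ennreal e" by (simp add: add_right_mono)
  qed
qed

text \<open>Caratheodory's criterion for the metric outer measure \<open>hausdorff_outer s\<close>. Only this identifies
  \<open>hausdorff_measure\<close>: \<open>measure_of\<close> yields the zero measure unless its argument is a measure.\<close>

lemma emeasure_hausdorff_measure:
  assumes s: "0 < s" and A: "A \<in> sets (borel :: 'a::metric_space measure)"
  shows "emeasure (hausdorff_measure s) A = hausdorff_outer s A"
proof -
  let ?f = "hausdorff_outer s :: 'a set \<Rightarrow> ennreal"
  let ?L = "lambda_system UNIV (Pow UNIV) ?f"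
  have "outer_measure_space (Pow UNIV) ?f"
    unfolding outer_measure_space_def positive_def increasing_def countably_subadditive_def
    by (auto simp: hausdorff_outer_empty[OF s] hausdorff_outer_mono hausdorff_outer_countably_subadditive)
  then have ms: "measure_space UNIV ?L ?f"
    by (rule sigma_algebra.caratheodory_lemma[OF sigma_algebra_Pow])
  then have sa: "sigma_algebra UNIV ?L" by (simp add: measure_space_def)
  have "C \<in> ?L" if "closed C" for C :: "'a set"
  proof -
    have "?f (x \<inter> C) + ?f (x - C) = ?f x" for x
    proof (rule antisym[OF hausdorff_outer_closed_split[OF s that]])
      have "x = (x \<inter> C) \<union> (x - C)" by blast
      then show "?f x \<le> ?f (x \<inter> C) + ?f (x - C)"
        using hausdorff_outer_Un_le[OF s] by metis
    qed
    then show ?thesis unfolding algebra.lambda_system_eq[OF algebra_Pow] by simp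
  qed
  then have "Collect closed \<subseteq> ?L" by blast
  then have "sigma_sets UNIV (Collect closed) \<subseteq> ?L" by (rule sigma_algebra.sigma_sets_subset[OF sa])
  then have "sets borel \<subseteq> ?L"
    unfolding borel_eq_closed by simp
  then have "measure_space UNIV (sets borel) ?f"
    by (rule measure_down[OF ms, rotated]) (metis sets.sigma_algebra_axioms space_borel)
  then have "positive (sets borel) ?f" "countably_additive (sets borel) ?f"
    by (auto simp: measure_space_def)
  then show ?thesis
    unfolding hausdorff_measure_def
    by (intro emeasure_measure_of_sigma A) (metis sets.sigma_algebra_axioms space_borel)
qed

lemma sets_hausdorff_measure: "sets (hausdorff_measure s :: 'a::metric_space measure) = sets borel"
  unfolding hausdorff_measure_def by (metis sets.sets_measure_of_eq space_borel)

text \<open>For a coordinate \<open>m\<close> in which \<open>a\<close> is largest in absolute value, the equation of the hyperplane gives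
  the \<open>m\<close>-th coordinate as a Lipschitz function of the others.\<close>

lemma hyperplane_norm_le_other_coordinates:
  fixes a :: "real^'n"
  assumes a: "a \<noteq> 0"
  obtains m where "\<And>x y. a \<bullet> x = a \<bullet> y \<Longrightarrow> norm (x - y) \<le> 2 * (\<Sum>i\<in>UNIV - {m}. \<bar>x $ i - y $ i\<bar>)"
proof -
  have "\<exists>m. \<forall>i. \<bar>a $ i\<bar> \<le> \<bar>a $ m\<bar>"
  proof -
    have "Max (range (\<lambda>i. \<bar>a $ i\<bar>)) \<in> range (\<lambda>i. \<bar>a $ i\<bar>)" by (rule Max_in) auto
    then obtain m where "Max (range (\<lambda>i. \<bar>a $ i\<bar>)) = \<bar>a $ m\<bar>" by blast
    moreover have "\<bar>a $ i\<bar> \<le> Max (range (\<lambda>i. \<bar>a $ i\<bar>))" for i by (rule Max_ge) auto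
    ultimately show ?thesis by auto
  qed
  then obtain m where m: "\<And>i. \<bar>a $ i\<bar> \<le> \<bar>a $ m\<bar>" by blast
  have am: "\<bar>a $ m\<bar> > 0"
  proof (rule ccontr)
    assume "\<not> \<bar>a $ m\<bar> > 0"
    then have "a $ i = 0" for i using m[of i] by simp
    with a show False by (simp add: vec_eq_iff)
  qed
  have "norm (x - y) \<le> 2 * (\<Sum>i\<in>UNIV - {m}. \<bar>x $ i - y $ i\<bar>)" if "a \<bullet> x = a \<bullet> y" for x y
  proof -
    define d where "d i = x $ i - y $ i" for i
    have "(\<Sum>i\<in>UNIV. a $ i * d i) = 0"
      using that by (simp add: inner_vec_def d_def right_diff_distrib sum_subtractf)
    then have "a $ m * d m = - (\<Sum>i\<in>UNIV - {m}. a $ i * d i)"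
      by (simp add: sum.remove[of UNIV m])
    then have "\<bar>a $ m\<bar> * \<bar>d m\<bar> = \<bar>\<Sum>i\<in>UNIV - {m}. a $ i * d i\<bar>" by (metis abs_minus abs_mult)
    also have "\<dots> \<le> (\<Sum>i\<in>UNIV - {m}. \<bar>a $ m\<bar> * \<bar>d i\<bar>)"
      by (rule order_trans[OF sum_abs], rule sum_mono) (simp add: abs_mult m mult_right_mono)
    also have "\<dots> = \<bar>a $ m\<bar> * (\<Sum>i\<in>UNIV - {m}. \<bar>d i\<bar>)" by (simp add: sum_distrib_left)
    finally have dm: "\<bar>d m\<bar> \<le> (\<Sum>i\<in>UNIV - {m}. \<bar>d i\<bar>)" using am by simp
    have "norm (x - y) \<le> (\<Sum>i\<in>UNIV. \<bar>d i\<bar>)" using norm_le_l1_cart[of "x - y"] by (simp add: d_def)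
    also have "\<dots> = \<bar>d m\<bar> + (\<Sum>i\<in>UNIV - {m}. \<bar>d i\<bar>)" by (simp add: sum.remove[of UNIV m])
    finally show ?thesis using dm by (simp add: d_def)
  qed
  then show thesis by (rule that)
qed

text \<open>A grid of mesh \<open>h = 2 * R / N\<close> in the \<open>s\<close> coordinates other than \<open>m\<close> covers the piece by \<open>(N + 1) ^ s\<close>
  sets of diameter at most \<open>2 * s * h\<close>, and the product of this number with \<open>h ^ s\<close> is bounded in \<open>N\<close>.\<close>

lemma hausdorff_outer_hyperplane_piece_finite:
  fixes P :: "(real^'n) set"
  assumes P: "bounded P" "P \<subseteq> {x. a \<bullet> x = b}" and a: "a \<noteq> 0" and n: "CARD('n) \<ge> 2"
  shows "hausdorff_outer (CARD('n) - 1) P < top"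
proof -
  define s where "s = CARD('n) - 1"
  have s: "0 < s" using n by (simp add: s_def)
  obtain m where m: "\<And>x y. a \<bullet> x = a \<bullet> y \<Longrightarrow> norm (x - y) \<le> 2 * (\<Sum>i\<in>UNIV - {m}. \<bar>x $ i - y $ i\<bar>)"
    using hyperplane_norm_le_other_coordinates[OF a] by metis
  obtain R where R: "0 < R" "\<And>x. x \<in> P \<Longrightarrow> norm x \<le> R" using P(1) by (auto simp: bounded_pos)
  define B where "B = ennreal (unit_ball_vol (real s) * (4 * real s * R) ^ s)"
  have "hcontent s \<delta> P \<le> B" if \<delta>: "0 < \<delta>" for \<delta>
  proof -
    obtain N :: nat where N: "4 * real s * R / \<delta> < real N" using reals_Archimedean2 by blast
    have N0: "0 < real N" using N \<delta> R(1) by (smt (verit) divide_nonneg_pos mult_nonneg_nonneg of_nat_0_le_iff)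
    define h where "h = 2 * R / N"
    have h: "0 < h" using R(1) N0 by (simp add: h_def)
    define I where "I = PiE (UNIV - {m}) (\<lambda>i. {0..int N})"
    define U where "U k = {x \<in> P. \<forall>i\<in>UNIV - {m}. \<lfloor>(x $ i + R) / h\<rfloor> = k i}" for k
    have finI: "finite I" and cardI: "card I = (N + 1) ^ s"
      by (auto simp: I_def card_PiE s_def nat_add_distrib intro!: finite_PiE)
    have cov: "P \<subseteq> (\<Union>k\<in>I. U k)"
    proof
      fix x assume x: "x \<in> P"
      define k where "k = (\<lambda>i\<in>UNIV - {m}. \<lfloor>(x $ i + R) / h\<rfloor>)"
      have "0 \<le> \<lfloor>(x $ i + R) / h\<rfloor> \<and> \<lfloor>(x $ i + R) / h\<rfloor> \<le> int N" for i
      proof -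
        have "\<bar>x $ i\<bar> \<le> R" using R(2)[OF x] component_le_norm_cart order_trans by blast
        then have "0 \<le> (x $ i + R) / h" "(x $ i + R) / h \<le> 2 * R / h" using h by (auto intro!: divide_right_mono)
        moreover have "2 * R / h = real N" using R(1) N0 by (simp add: h_def)
        ultimately show ?thesis by (metis floor_mono floor_of_nat of_nat_0 zero_le_floor)
      qed
      then have "k \<in> I" by (auto simp: k_def I_def)
      moreover have "x \<in> U k" using x by (auto simp: U_def k_def)
      ultimately show "x \<in> (\<Union>k\<in>I. U k)" by blast
    qed
    have dU: "diameter (U k) \<le> 2 * real s * h" for k
    proof (rule diameter_le)
      show "U k \<noteq> {} \<or> 0 \<le> 2 * real s * h" using h by simp
      fix x y assume xy: "x \<in> U k" "y \<in> U k"
      have "\<bar>x $ i - y $ i\<bar> \<le> h" if "i \<in> UNIV - {m}" for i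
      proof -
        have "\<lfloor>(x $ i + R) / h\<rfloor> = \<lfloor>(y $ i + R) / h\<rfloor>" using xy that by (simp add: U_def)
        then have "\<bar>(x $ i + R) / h - (y $ i + R) / h\<bar> \<le> 1" by linarith
        then have "\<bar>(x $ i - y $ i) / h\<bar> \<le> 1" by (simp add: diff_divide_distrib[symmetric])
        then show ?thesis using h by (simp add: abs_divide pos_divide_le_eq)
      qed
      then have "(\<Sum>i\<in>UNIV - {m}. \<bar>x $ i - y $ i\<bar>) \<le> (\<Sum>i\<in>UNIV - {m}. h)" by (intro sum_mono)
      also have "\<dots> = real s * h" by (simp add: s_def)
      finally have sum: "(\<Sum>i\<in>UNIV - {m}. \<bar>x $ i - y $ i\<bar>) \<le> real s * h" .
      show "norm (x - y) \<le> 2 * real s * h"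
      proof -
        have "a \<bullet> x = b" "a \<bullet> y = b" using xy P(2) by (auto simp: U_def)
        then have "norm (x - y) \<le> 2 * (\<Sum>i\<in>UNIV - {m}. \<bar>x $ i - y $ i\<bar>)" by (intro m) simp
        with sum show ?thesis by linarith
      qed
    qed
    have d\<delta>: "2 * real s * h \<le> \<delta>" 
    proof -
      have "4 * real s * R < real N * \<delta>" using N by (simp only: pos_divide_less_eq[OF \<delta>])
      then have "4 * real s * R / real N \<le> \<delta>" by (simp only: pos_divide_le_eq[OF N0] mult.commute less_imp_le)
      then show ?thesis by (simp add: h_def)
    qed
    have "hcontent s \<delta> P \<le> (\<Sum>k\<in>I. hgauge s (U k))"
    proof (rule hcontent_le_finite_cover[OF s _ finI cov])
      show "bounded (U k) \<and> diameter (U k) \<le> \<delta>" for k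
        using bounded_subset[OF P(1), of "U k"] dU[of k] d\<delta> by (auto simp: U_def)
    qed (use \<delta> in simp)
    also have "\<dots> \<le> (\<Sum>k\<in>I. ennreal (unit_ball_vol (real s) * (real s * h) ^ s))"
      unfolding hgauge_def
    proof (intro sum_mono ennreal_leI mult_left_mono power_mono)
      show "diameter (U k) / 2 \<le> real s * h" for k using dU[of k] by simp
      show "0 \<le> diameter (U k) / 2" for k
        using bounded_subset[OF P(1), of "U k"] by (auto simp: U_def intro!: diameter_ge_0)
    qed simp
    also have "\<dots> = ennreal (real ((N + 1) ^ s) * (unit_ball_vol (real s) * (real s * h) ^ s))"
      by (simp add: cardI ennreal_mult' ennreal_of_nat_eq_real_of_nat)
    also have "\<dots> \<le> B"
      unfolding B_def
    proof (rule ennreal_leI)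
      have "real (N + 1) ^ s * (real s * h) ^ s = (real (N + 1) * (real s * h)) ^ s" by (simp add: power_mult_distrib)
      also have "\<dots> \<le> (4 * real s * R) ^ s"
      proof (rule power_mono)
        have "real (N + 1) \<le> 2 * real N" using N0 by simp
        then have "real (N + 1) * (real s * h) \<le> (2 * real N) * (real s * h)" using h by (intro mult_right_mono) auto
        also have "\<dots> = 4 * real s * R" using N0 by (simp add: h_def)
        finally show "real (N + 1) * (real s * h) \<le> 4 * real s * R" .
      qed (use h in simp)
      finally have "unit_ball_vol (real s) * (real (N + 1) ^ s * (real s * h) ^ s) \<le> unit_ball_vol (real s) * (4 * real s * R) ^ s"
        by (rule mult_left_mono) simp
      then show "real ((N + 1) ^ s) * (unit_ball_vol (real s) * (real s * h) ^ s) \<le> unit_ball_vol (real s) * (4 * real s * R) ^ s"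
        by (simp add: mult_ac)
    qed
    finally show ?thesis .
  qed
  then have "hausdorff_outer s P \<le> B" unfolding hausdorff_outer_eq by (intro SUP_least) auto
  also have "\<dots> < top" by (simp add: B_def)
  finally show ?thesis by (simp add: s_def)
qed

text \<open>Since the Bochner integral of a function that is not integrable is \<open>0\<close>, convergence to \<open>0\<close> in
  \<open>l2_norm (boundary_measure \<Omega>)\<close> says something about smooth functions only because of this bound.\<close>

lemma hausdorff_outer_polyhedral_boundary_finite:
  fixes \<Omega> :: "(real^'n) set"
  assumes "polyhedral_boundary \<Omega>" and n: "CARD('n) \<ge> 2"
  shows "hausdorff_outer (CARD('n) - 1) (frontier \<Omega>) < top"
proof -
  obtain F where F: "finite F" "\<And>P. P \<in> F \<Longrightarrow> polytope P \<and> aff_dim P = int CARD('n) - 1" "frontier \<Omega> = \<Union>F"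
    using assms(1) by (auto simp: polyhedral_boundary_def)
  have "hausdorff_outer (CARD('n) - 1) P < top" if "P \<in> F" for P
  proof -
    have "aff_dim P < int DIM(real^'n)" using F(2)[OF that] by simp
    then obtain a b where "a \<noteq> 0" "P \<subseteq> {x. a \<bullet> x = b}"
      using aff_lowdim_subset_hyperplane by blast
    then show ?thesis
      using F(2)[OF that] polytope_imp_bounded n by (intro hausdorff_outer_hyperplane_piece_finite) auto
  qed
  with F(1) have "hausdorff_outer (CARD('n) - 1) (\<Union>F) < top"
  proof (induction F rule: finite_induct)
    case empty
    show ?case using n by (simp add: hausdorff_outer_empty)
  next
    case (insert P F)
    have "hausdorff_outer (CARD('n) - 1) (P \<union> \<Union>F) \<le> hausdorff_outer (CARD('n) - 1) P + hausdorff_outer (CARD('n) - 1) (\<Union>F)"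
      using n by (intro hausdorff_outer_Un_le) simp
    also have "\<dots> < top"
    proof -
      have "hausdorff_outer (CARD('n) - 1) P < top" using insert.prems by blast
      moreover have "hausdorff_outer (CARD('n) - 1) (\<Union>F) < top"
        using insert.IH insert.prems by (meson insertCI)
      ultimately show ?thesis by (simp only: ennreal_add_less_top)
    qed
    finally show ?case by (simp only: Union_insert)
  qed
  then show ?thesis by (simp add: F(3))
qed

lemma space_hausdorff_measure: "space (hausdorff_measure s :: 'a::metric_space measure) = UNIV"
  using sets_eq_imp_space_eq[OF sets_hausdorff_measure] by simp

section \<open>Integration along segments and projection to the boundary\<close>

text \<open>The fundamental theorem of calculus and the Cauchy-Schwarz inequality on an interval.\<close>

lemma norm_increment_squared_le:
  fixes g g' :: "real \<Rightarrow> 'b::euclidean_space"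
  assumes g: "\<And>t. 0 \<le> t \<Longrightarrow> t \<le> \<tau> \<Longrightarrow> (g has_vector_derivative g' t) (at t within {0..\<tau>})"
    and g': "continuous_on {0..\<tau>} g'" and \<tau>: "0 \<le> \<tau>"
  shows "ennreal ((norm (g \<tau> - g 0))\<^sup>2) \<le> ennreal \<tau> * (\<integral>\<^sup>+s. ennreal ((norm (g' s))\<^sup>2) * indicator {0..\<tau>} s \<partial>lborel)"
proof -
  define F where "F s = indicator {0..\<tau>} s *\<^sub>R g' s" for s
  define J where "J s = (indicator {0..\<tau>} s :: real)" for s
  have hb: "has_bochner_integral lborel F (g \<tau> - g 0)"
    unfolding F_def[abs_def] by (rule has_bochner_integral_FTC_Icc[OF \<tau> g g'])
  have Fi: "integrable lborel F" using hb by (rule integrable.intros)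
  have "integrable lborel (\<lambda>s. indicator {0..\<tau>} s *\<^sub>R (norm (g' s))\<^sup>2)"
    using g' by (intro borel_integrable_compact continuous_intros) auto
  moreover have "indicator {0..\<tau>} s *\<^sub>R (norm (g' s))\<^sup>2 = (norm (F s))\<^sup>2" for s
    by (simp add: F_def indicator_def)
  ultimately have FL: "L2 lborel F"
    using borel_measurable_integrable[OF Fi] by (simp add: L2_def)
  have J2: "(norm (J s))\<^sup>2 = indicator {0..\<tau>} s" for s by (simp add: J_def indicator_def)
  have JL: "L2 lborel J"
    unfolding L2_def J2 using \<tau> by (auto simp: J_def[abs_def] intro!: integrable_real_indicator)
  have Jn: "l2_norm lborel J = sqrt \<tau>"
    unfolding l2_norm_def J2 using \<tau> by simp
  have "norm (g \<tau> - g 0) = norm (\<integral>s. F s \<partial>lborel)" using has_bochner_integral_integral_eq[OF hb] by simp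
  also have "\<dots> \<le> (\<integral>s. norm (F s) \<partial>lborel)" by (rule integral_norm_bound)
  also have "\<dots> = (\<integral>s. norm (J s) * norm (F s) \<partial>lborel)"
    by (intro Bochner_Integration.integral_cong) (auto simp: J_def F_def indicator_def)
  also have "\<dots> \<le> sqrt \<tau> * l2_norm lborel F" using L2_Cauchy_Schwarz[OF JL FL] by (simp add: Jn)
  finally have "(norm (g \<tau> - g 0))\<^sup>2 \<le> (sqrt \<tau> * l2_norm lborel F)\<^sup>2" by (intro power_mono) auto
  also have "\<dots> = \<tau> * (l2_norm lborel F)\<^sup>2" using \<tau> by (simp add: power_mult_distrib)
  finally have "ennreal ((norm (g \<tau> - g 0))\<^sup>2) \<le> ennreal \<tau> * ennreal ((l2_norm lborel F)\<^sup>2)"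
    using \<tau> by (simp add: ennreal_mult[symmetric] ennreal_leI)
  also have "ennreal ((l2_norm lborel F)\<^sup>2) = (\<integral>\<^sup>+s. ennreal ((norm (F s))\<^sup>2) \<partial>lborel)"
    by (rule nn_integral_eq_l2_norm_squared[OF FL, symmetric])
  also have "\<dots> = (\<integral>\<^sup>+s. ennreal ((norm (g' s))\<^sup>2) * indicator {0..\<tau>} s \<partial>lborel)"
    by (intro nn_integral_cong) (auto simp: F_def indicator_def)
  finally show ?thesis .
qed

lemma nn_integral_lborel_translate:
  fixes f :: "'a::euclidean_space \<Rightarrow> ennreal"
  assumes "f \<in> borel_measurable borel"
  shows "(\<integral>\<^sup>+x. f (h + x) \<partial>lborel) = (\<integral>\<^sup>+x. f x \<partial>lborel)"
proof -
  have "(\<integral>\<^sup>+x. f x \<partial>distr lborel borel ((+) h)) = (\<integral>\<^sup>+x. f (h + x) \<partial>lborel)"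
    using assms by (intro nn_integral_distr) auto
  then show ?thesis by (simp add: lborel_distr_plus)
qed

text \<open>Integrating along the segments from \<open>x\<close> to \<open>x - \<tau> x *\<^sub>R e\<close>. By Fubini and translation
  invariance the integral over all these segments costs only a factor \<open>h\<close>.\<close>

lemma segment_estimate:
  fixes \<phi> :: "'a::euclidean_space \<Rightarrow> 'b::euclidean_space"
  assumes sm: "smooth \<phi>" and S[measurable]: "S \<in> sets borel" "S' \<in> sets borel" "\<tau> \<in> borel_measurable borel"
    and \<tau>: "\<And>x. x \<in> S \<Longrightarrow> 0 \<le> \<tau> x \<and> \<tau> x \<le> h" and h: "0 \<le> h"
    and seg: "\<And>x s. x \<in> S \<Longrightarrow> 0 \<le> s \<Longrightarrow> s < \<tau> x \<Longrightarrow> x - s *\<^sub>R e \<in> S'"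
  shows "(\<integral>\<^sup>+x. ennreal ((norm (\<phi> x))\<^sup>2) * indicator S x \<partial>lborel)
    \<le> 2 * (\<integral>\<^sup>+x. ennreal ((norm (\<phi> (x - \<tau> x *\<^sub>R e)))\<^sup>2) * indicator S x \<partial>lborel)
      + ennreal (2 * h\<^sup>2) * (\<integral>\<^sup>+x. ennreal ((norm (frechet_derivative \<phi> (at x) e))\<^sup>2) * indicator S' x \<partial>lborel)"
proof -
  define G where "G y = ennreal ((norm (frechet_derivative \<phi> (at y) e))\<^sup>2) * indicator S' y" for y
  have \<phi>m[measurable]: "\<phi> \<in> borel_measurable borel" by (intro borel_measurable_continuous_onI smooth_continuous_on sm)
  have Dm[measurable]: "(\<lambda>x. frechet_derivative \<phi> (at x) e) \<in> borel_measurable borel"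
    by (intro borel_measurable_continuous_onI smooth_continuous_on smooth_frechet_derivative sm)
  have Gm[measurable]: "G \<in> borel_measurable borel" unfolding G_def by measurable
  have pw: "ennreal ((norm (\<phi> x))\<^sup>2) * indicator S x
    \<le> 2 * (ennreal ((norm (\<phi> (x - \<tau> x *\<^sub>R e)))\<^sup>2) * indicator S x)
      + ennreal (2 * h) * (\<integral>\<^sup>+s. G (x - s *\<^sub>R e) * indicator {0..h} s \<partial>lborel)" for x
  proof (cases "x \<in> S")
    case True
    have t: "0 \<le> \<tau> x" "\<tau> x \<le> h" using \<tau>[OF True] by auto
    let ?g = "\<lambda>s. \<phi> (x - s *\<^sub>R e)" and ?g' = "\<lambda>s. - frechet_derivative \<phi> (at (x - s *\<^sub>R e)) e"
    have "ennreal ((norm (?g (\<tau> x) - ?g 0))\<^sup>2) \<le> ennreal (\<tau> x) * (\<integral>\<^sup>+s. ennreal ((norm (?g' s))\<^sup>2) * indicator {0..\<tau> x} s \<partial>lborel)"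
    proof (rule norm_increment_squared_le[OF _ _ t(1)])
      fix s :: real
      have l: "((\<lambda>s. x - s *\<^sub>R e) has_derivative (\<lambda>r. - (r *\<^sub>R e))) (at s)" by (auto intro!: derivative_eq_intros)
      have "(?g has_derivative (\<lambda>r. frechet_derivative \<phi> (at (x - s *\<^sub>R e)) (- (r *\<^sub>R e)))) (at s)"
        by (rule has_derivative_compose[OF l smooth_has_derivative[OF sm]])
      moreover have "frechet_derivative \<phi> (at (x - s *\<^sub>R e)) (- (r *\<^sub>R e)) = r *\<^sub>R ?g' s" for r
        using linear_cmul[OF has_derivative_linear[OF smooth_has_derivative[OF sm]], of "x - s *\<^sub>R e" "- r" e] by simp
      ultimately show "(?g has_vector_derivative ?g' s) (at s within {0..\<tau> x})"
        by (auto simp: has_vector_derivative_def intro: has_derivative_at_withinI)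
    next
      have "continuous_on {0..\<tau> x} (\<lambda>s. x - s *\<^sub>R e)" by (intro continuous_intros)
      then show "continuous_on {0..\<tau> x} ?g'"
        by (intro continuous_on_minus continuous_on_compose2[OF smooth_continuous_on[OF smooth_frechet_derivative[OF sm], of UNIV]]) auto
    qed
    also have "\<dots> \<le> ennreal h * (\<integral>\<^sup>+s. G (x - s *\<^sub>R e) * indicator {0..h} s \<partial>lborel)"
    proof (intro mult_mono ennreal_leI nn_integral_mono_AE)
      show "AE s in lborel. ennreal ((norm (?g' s))\<^sup>2) * indicator {0..\<tau> x} s \<le> G (x - s *\<^sub>R e) * indicator {0..h} s"
        using AE_lborel_singleton[of "\<tau> x"]
        by eventually_elim (use seg[OF True] t in \<open>auto simp: G_def indicator_def\<close>)
    qed (use t in auto)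
    finally have inc: "ennreal ((norm (?g (\<tau> x) - ?g 0))\<^sup>2) \<le> ennreal h * (\<integral>\<^sup>+s. G (x - s *\<^sub>R e) * indicator {0..h} s \<partial>lborel)" .
    have "(norm (\<phi> x))\<^sup>2 \<le> 2 * (norm (?g (\<tau> x)))\<^sup>2 + 2 * (norm (?g (\<tau> x) - ?g 0))\<^sup>2"
    proof -
      have "norm (\<phi> x) \<le> norm (?g (\<tau> x)) + norm (?g (\<tau> x) - ?g 0)"
        using norm_triangle_ineq4[of "?g (\<tau> x)" "?g (\<tau> x) - ?g 0"] by simp
      then have "(norm (\<phi> x))\<^sup>2 \<le> (norm (?g (\<tau> x)) + norm (?g (\<tau> x) - ?g 0))\<^sup>2" by (intro power_mono) auto
      also have "\<dots> \<le> 2 * (norm (?g (\<tau> x)))\<^sup>2 + 2 * (norm (?g (\<tau> x) - ?g 0))\<^sup>2"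
        using sum_squares_bound[of "norm (?g (\<tau> x))" "norm (?g (\<tau> x) - ?g 0)"] by (simp add: power2_sum)
      finally show ?thesis .
    qed
    then have "ennreal ((norm (\<phi> x))\<^sup>2) \<le> ennreal (2 * (norm (?g (\<tau> x)))\<^sup>2 + 2 * (norm (?g (\<tau> x) - ?g 0))\<^sup>2)" by (rule ennreal_leI)
    also have "\<dots> = 2 * ennreal ((norm (?g (\<tau> x)))\<^sup>2) + 2 * ennreal ((norm (?g (\<tau> x) - ?g 0))\<^sup>2)"
      by (simp add: ennreal_plus ennreal_mult')
    also have "\<dots> \<le> 2 * ennreal ((norm (?g (\<tau> x)))\<^sup>2) + 2 * (ennreal h * (\<integral>\<^sup>+s. G (x - s *\<^sub>R e) * indicator {0..h} s \<partial>lborel))"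
      by (intro add_left_mono mult_left_mono inc) auto
    finally show ?thesis using True h by (simp add: ennreal_mult' mult.assoc)
  qed simp
  have "(\<integral>\<^sup>+x. ennreal ((norm (\<phi> x))\<^sup>2) * indicator S x \<partial>lborel)
    \<le> (\<integral>\<^sup>+x. 2 * (ennreal ((norm (\<phi> (x - \<tau> x *\<^sub>R e)))\<^sup>2) * indicator S x)
      + ennreal (2 * h) * (\<integral>\<^sup>+s. G (x - s *\<^sub>R e) * indicator {0..h} s \<partial>lborel) \<partial>lborel)"
    by (intro nn_integral_mono pw)
  also have "\<dots> = 2 * (\<integral>\<^sup>+x. ennreal ((norm (\<phi> (x - \<tau> x *\<^sub>R e)))\<^sup>2) * indicator S x \<partial>lborel)
      + ennreal (2 * h) * (\<integral>\<^sup>+x. \<integral>\<^sup>+s. G (x - s *\<^sub>R e) * indicator {0..h} s \<partial>lborel \<partial>lborel)"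
  proof -
    have m1: "(\<lambda>x. ennreal ((norm (\<phi> (x - \<tau> x *\<^sub>R e)))\<^sup>2) * indicator S x) \<in> borel_measurable lborel" by measurable
    have m2: "(\<lambda>x. \<integral>\<^sup>+s. G (x - s *\<^sub>R e) * indicator {0..h} s \<partial>lborel) \<in> borel_measurable lborel" by measurable
    show ?thesis
      using m1 m2 by (simp add: nn_integral_add nn_integral_cmult)
  qed
  also have "(\<integral>\<^sup>+x. \<integral>\<^sup>+s. G (x - s *\<^sub>R e) * indicator {0..h} s \<partial>lborel \<partial>lborel)
      = (\<integral>\<^sup>+s. \<integral>\<^sup>+x. G (x - s *\<^sub>R e) * indicator {0..h} s \<partial>lborel \<partial>lborel)"
    by (rule lborel_pair.Fubini') measurable
  also have "\<dots> = (\<integral>\<^sup>+s. (\<integral>\<^sup>+x. G x \<partial>lborel) * indicator {0..h} s \<partial>lborel)"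
  proof (intro nn_integral_cong)
    fix s :: real
    have "(\<integral>\<^sup>+x. G (x - s *\<^sub>R e) * indicator {0..h} s \<partial>lborel) = (\<integral>\<^sup>+x. G (x - s *\<^sub>R e) \<partial>lborel) * indicator {0..h} s"
      by (rule nn_integral_multc) measurable
    also have "(\<integral>\<^sup>+x. G (x - s *\<^sub>R e) \<partial>lborel) = (\<integral>\<^sup>+x. G x \<partial>lborel)"
      using nn_integral_lborel_translate[OF Gm, of "- s *\<^sub>R e"] by simp
    finally show "(\<integral>\<^sup>+x. G (x - s *\<^sub>R e) * indicator {0..h} s \<partial>lborel) = (\<integral>\<^sup>+x. G x \<partial>lborel) * indicator {0..h} s" .
  qed
  also have "\<dots> = (\<integral>\<^sup>+x. G x \<partial>lborel) * ennreal h"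
    using h by (subst nn_integral_cmult) auto
  finally show ?thesis
    using h by (simp add: G_def power2_eq_square ennreal_mult' mult_ac)
qed

text \<open>A tube of length \<open>h\<close> over a set of diameter \<open>\<rho>\<close> is covered by about \<open>h / \<rho>\<close> balls of radius
  \<open>2 * \<rho>\<close>.\<close>

lemma tube_measure_bound:
  fixes e :: "real^'n"
  assumes e: "norm e = 1" and h: "0 \<le> h" and n: "CARD('n) \<ge> 2"
  obtains c where "0 < c" and "\<And>U. bounded U \<Longrightarrow> diameter U \<le> 1 \<Longrightarrow>
    \<exists>B\<in>sets lborel. {x. \<exists>s\<in>{0..h}. x - s *\<^sub>R e \<in> U} \<subseteq> B \<and> emeasure lborel B \<le> ennreal c * hgauge (CARD('n) - 1) U"
proof -
  define m where "m = CARD('n) - 1"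
  have d: "CARD('n) = Suc m" using n by (simp add: m_def)
  define w where "w = unit_ball_vol (real CARD('n))"
  define c where "c = (h + 2) * w * 2 ^ CARD('n) * 2 ^ m / unit_ball_vol (real m)"
  have c: "0 < c" unfolding c_def w_def using h by (intro divide_pos_pos mult_pos_pos) auto
  have "\<exists>B\<in>sets lborel. {x. \<exists>s\<in>{0..h}. x - s *\<^sub>R e \<in> U} \<subseteq> B \<and> emeasure lborel B \<le> ennreal c * hgauge m U"
    if U: "bounded U" "diameter U \<le> 1" for U
  proof -
    consider "U = {}" | "U \<noteq> {}" "diameter U = 0" | "U \<noteq> {}" "diameter U > 0"
      using diameter_ge_0[OF U(1)] by linarith
    then show ?thesis
    proof cases
      case 1
      then show ?thesis by (intro bexI[of _ "{}"]) auto
    next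
      case 2
      then obtain y where y: "y \<in> U" by blast
      have Uy: "U \<subseteq> {y}" using diameter_bounded_bound[OF U(1) _ y] 2(2) by auto
      let ?B = "(+) y ` span {e}"
      have "closed ?B" by (intro closed_translation closed_subspace subspace_span)
      then have B: "?B \<in> sets lborel" by simp
      have "dim (span {e}) \<le> 1" using dim_le_card'[of "{e}"] by (simp add: dim_span)
      then have "negligible ?B" using n by (intro negligible_translation negligible_lowdim) simp
      then have "emeasure lborel ?B = 0" using B by (simp add: negligible_iff_emeasure0)
      moreover have "{x. \<exists>s\<in>{0..h}. x - s *\<^sub>R e \<in> U} \<subseteq> ?B"
      proof clarify
        fix x s assume "x - s *\<^sub>R e \<in> U"
        then have "x - s *\<^sub>R e = y" using Uy by blast
        then have "x = y + s *\<^sub>R e" by (simp add: algebra_simps)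
        then show "x \<in> ?B" by (simp add: span_base span_scale)
      qed
      ultimately show ?thesis using B by (intro bexI[of _ ?B]) auto
    next
      case 3
      define \<rho> where "\<rho> = diameter U"
      have \<rho>: "0 < \<rho>" "\<rho> \<le> 1" using 3 U by (auto simp: \<rho>_def)
      obtain y where y: "y \<in> U" using 3 by blast
      define N where "N = nat \<lfloor>h / \<rho>\<rfloor>"
      let ?b = "\<lambda>k::nat. cball (y + (real k * \<rho>) *\<^sub>R e) (2 * \<rho>)"
      let ?B = "\<Union>k\<in>{0..N}. ?b k"
      have hr: "0 \<le> h / \<rho>" using h \<rho> by simp
      have sub: "{x. \<exists>s\<in>{0..h}. x - s *\<^sub>R e \<in> U} \<subseteq> ?B"
      proof clarify
        fix x s assume s: "s \<in> {0..h}" and x: "x - s *\<^sub>R e \<in> U"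
        define k where "k = nat \<lfloor>s / \<rho>\<rfloor>"
        have sr: "0 \<le> s / \<rho>" using s \<rho> by simp
        have "s / \<rho> \<le> h / \<rho>" using s \<rho> by (simp add: divide_right_mono)
        then have kN: "k \<le> N" unfolding k_def N_def by (intro nat_mono floor_mono)
        have "real k \<le> s / \<rho>" "s / \<rho> < real k + 1" using sr unfolding k_def by linarith+
        then have "real k * \<rho> \<le> s" "s < (real k + 1) * \<rho>"
          by (simp_all only: pos_le_divide_eq[OF \<rho>(1)] pos_divide_less_eq[OF \<rho>(1)])
        then have ks: "\<bar>s - real k * \<rho>\<bar> \<le> \<rho>" by (simp add: distrib_right)
        have "norm (x - (y + (real k * \<rho>) *\<^sub>R e)) \<le> norm (x - s *\<^sub>R e - y) + norm ((s - real k * \<rho>) *\<^sub>R e)"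
          by (rule order_trans[OF _ norm_triangle_ineq]) (simp add: algebra_simps)
        also have "norm (x - s *\<^sub>R e - y) \<le> \<rho>"
          using diameter_bounded_bound[OF U(1) x y] by (simp add: \<rho>_def dist_norm)
        also have "norm ((s - real k * \<rho>) *\<^sub>R e) \<le> \<rho>" using ks e by simp
        finally have "x \<in> ?b k" by (simp add: dist_norm norm_minus_commute)
        then show "x \<in> ?B" using kN by auto
      qed
      have "emeasure lborel ?B \<le> (\<Sum>k\<in>{0..N}. emeasure lborel (?b k))"
        by (rule emeasure_subadditive_finite) auto
      also have "\<dots> = ennreal (real (N + 1) * (w * (2 * \<rho>) ^ CARD('n)))"
        using \<rho> by (simp add: emeasure_cball w_def ennreal_mult' ennreal_of_nat_eq_real_of_nat ennreal_plus[symmetric] del: ennreal_plus)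
      also have "\<dots> \<le> ennreal (c * (unit_ball_vol (real m) * (\<rho> / 2) ^ m))"
      proof (rule ennreal_leI)
        have "real N \<le> h / \<rho>" using hr unfolding N_def by linarith
        then have "real (N + 1) * \<rho> \<le> (h / \<rho> + 1) * \<rho>" using \<rho> by (intro mult_right_mono) auto
        also have "\<dots> = h + \<rho>" using \<rho> by (simp add: distrib_right)
        finally have N\<rho>: "real (N + 1) * \<rho> \<le> h + 2" using \<rho>(2) by linarith
        have "real (N + 1) * (w * (2 * \<rho>) ^ CARD('n)) = (real (N + 1) * \<rho>) * (w * 2 ^ CARD('n) * \<rho> ^ m)"
          unfolding d by (simp add: power_mult_distrib mult_ac)
        also have "\<dots> \<le> (h + 2) * (w * 2 ^ CARD('n) * \<rho> ^ m)"
          using \<rho> by (intro mult_right_mono[OF N\<rho>]) (auto simp: w_def)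
        also have "\<dots> = c * (unit_ball_vol (real m) * (\<rho> / 2) ^ m)"
        proof -
          have "unit_ball_vol (real m) \<noteq> 0"
            using unit_ball_vol_pos[of "real m"] by (metis of_nat_0_le_iff less_irrefl)
          then show ?thesis by (simp add: c_def power_divide)
        qed
        finally show "real (N + 1) * (w * (2 * \<rho>) ^ CARD('n)) \<le> c * (unit_ball_vol (real m) * (\<rho> / 2) ^ m)" .
      qed
      also have "\<dots> = ennreal c * hgauge m U"
        using c by (simp add: hgauge_def \<rho>_def ennreal_mult')
      finally show ?thesis using sub by (intro bexI[of _ ?B]) auto
    qed
  qed
  then show thesis using that[of c] c by (simp add: m_def)
qed

text \<open>The preimage of a cover under the projection \<open>x - t x *\<^sub>R e\<close> is a cover by tubes of length \<open>h\<close>. The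
  constant depends on \<open>h\<close>; this is harmless because it multiplies boundary values that tend to \<open>0\<close>.\<close>

lemma projection_measure_le:
  fixes e :: "real^'n" and t :: "real^'n \<Rightarrow> real"
  assumes e: "norm e = 1" and h: "0 \<le> h" and n: "CARD('n) \<ge> 2"
    and S[measurable]: "S \<in> sets borel" "t \<in> borel_measurable borel"
    and t: "\<And>x. x \<in> S \<Longrightarrow> 0 \<le> t x \<and> t x \<le> h"
  obtains c where "0 < c" and "\<And>A. emeasure lborel (S \<inter> (\<lambda>x. x - t x *\<^sub>R e) -` A) \<le> ennreal c * hausdorff_outer (CARD('n) - 1) A"
proof -
  let ?s = "CARD('n) - 1" and ?\<pi> = "\<lambda>x. x - t x *\<^sub>R e"
  obtain c where c: "0 < c" and tube: "\<And>U. bounded U \<Longrightarrow> diameter U \<le> 1 \<Longrightarrow>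
    \<exists>B\<in>sets lborel. {x. \<exists>s\<in>{0..h}. x - s *\<^sub>R e \<in> U} \<subseteq> B \<and> emeasure lborel B \<le> ennreal c * hgauge ?s U"
    by (rule tube_measure_bound[OF e h n], rule that)
  have "emeasure lborel (S \<inter> ?\<pi> -` A) \<le> ennreal c * hausdorff_outer ?s A" for A
  proof -
    let ?X = "emeasure lborel (S \<inter> ?\<pi> -` A)"
    have "?X / ennreal c \<le> hcontent ?s 1 A"
      unfolding hcontent_def
    proof (rule INF_greatest)
      fix U assume U: "U \<in> fine_covers 1 A"
      have "\<exists>B. B \<in> sets lborel \<and> {x. \<exists>s\<in>{0..h}. x - s *\<^sub>R e \<in> U n} \<subseteq> B \<and> emeasure lborel B \<le> ennreal c * hgauge ?s (U n)" for n
        using tube[of "U n"] U by (auto simp: fine_covers_def)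
      from choice[OF allI[OF this]] obtain B where "\<forall>n. B n \<in> sets lborel \<and> {x. \<exists>s\<in>{0..h}. x - s *\<^sub>R e \<in> U n} \<subseteq> B n \<and>
        emeasure lborel (B n) \<le> ennreal c * hgauge ?s (U n)" ..
      then have B: "\<And>n. B n \<in> sets lborel" "\<And>n. {x. \<exists>s\<in>{0..h}. x - s *\<^sub>R e \<in> U n} \<subseteq> B n"
        "\<And>n. emeasure lborel (B n) \<le> ennreal c * hgauge ?s (U n)" by blast+
      have "S \<inter> ?\<pi> -` A \<subseteq> (\<Union>n. B n)"
      proof
        fix x assume x: "x \<in> S \<inter> ?\<pi> -` A"
        then obtain n where "?\<pi> x \<in> U n" using U by (auto simp: fine_covers_def)
        then have "x \<in> {x. \<exists>s\<in>{0..h}. x - s *\<^sub>R e \<in> U n}" using t[of x] x by auto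
        then show "x \<in> (\<Union>n. B n)" using B(2) by blast
      qed
      then have "?X \<le> emeasure lborel (\<Union>n. B n)" using B(1) by (intro emeasure_mono) auto
      also have "\<dots> \<le> (\<Sum>n. emeasure lborel (B n))" using B(1) by (intro emeasure_subadditive_countably) auto
      also have "\<dots> \<le> (\<Sum>n. ennreal c * hgauge ?s (U n))" by (intro suminf_le B(3)) auto
      also have "\<dots> = ennreal c * (\<Sum>n. hgauge ?s (U n))" by simp
      finally show "?X / ennreal c \<le> (\<Sum>n. hgauge ?s (U n))"
        using c by (intro divide_le_posI_ennreal) auto
    qed
    also have "\<dots> \<le> hausdorff_outer ?s A" by (rule hcontent_le_hausdorff_outer) simp
    finally have "?X / ennreal c * ennreal c \<le> hausdorff_outer ?s A * ennreal c" by (rule mult_right_mono) simp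
    moreover have "?X / ennreal c * ennreal c = ?X"
      unfolding ennreal_divide_times using c by simp
    ultimately show ?thesis by (simp add: mult.commute)
  qed
  then show thesis using that c by blast
qed

text \<open>The image of Lebesgue measure on \<open>S\<close> under the projection has a multiple of the Hausdorff measure on
  \<open>\<Gamma>\<close> as an upper bound, so integrals compare as well.\<close>

lemma projection_integral_le:
  fixes e :: "real^'n" and t :: "real^'n \<Rightarrow> real"
  assumes e: "norm e = 1" and h: "0 \<le> h" and n: "CARD('n) \<ge> 2"
    and S[measurable]: "S \<in> sets borel" "t \<in> borel_measurable borel"
    and t: "\<And>x. x \<in> S \<Longrightarrow> 0 \<le> t x \<and> t x \<le> h"
    and \<Gamma>: "\<Gamma> \<in> sets borel" "\<And>x. x \<in> S \<Longrightarrow> x - t x *\<^sub>R e \<in> \<Gamma>"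
  obtains c where "0 < c" and "\<And>f. f \<in> borel_measurable borel \<Longrightarrow>
      (\<integral>\<^sup>+x. f (x - t x *\<^sub>R e) * indicator S x \<partial>lborel) \<le> ennreal c * (\<integral>\<^sup>+x. f x \<partial>restrict_space (hausdorff_measure (CARD('n) - 1)) \<Gamma>)"
proof -
  let ?\<pi> = "\<lambda>x. x - t x *\<^sub>R e"
  let ?H = "hausdorff_measure (CARD('n) - 1) :: (real^'n) measure"
  have s: "0 < CARD('n) - 1" using n by simp
  obtain c where c: "0 < c" and le: "\<And>A. emeasure lborel (S \<inter> ?\<pi> -` A) \<le> ennreal c * hausdorff_outer (CARD('n) - 1) A"
    by (rule projection_measure_le[OF e h n S t], assumption, rule that)
  define N where "N = distr (density lborel (indicator S)) borel ?\<pi>"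
  define M where "M = density ?H (\<lambda>x. ennreal c * indicator \<Gamma> x)"
  note [measurable_cong] = sets_hausdorff_measure
  have \<Gamma>H[measurable]: "\<Gamma> \<in> sets ?H" using \<Gamma>(1) by (simp add: sets_hausdorff_measure)
  have sN: "sets N = sets borel" and sM: "sets M = sets borel"
    by (simp_all add: N_def M_def sets_hausdorff_measure)
  have pm[measurable]: "?\<pi> \<in> borel_measurable borel" by measurable
  have "N \<le> M"
    unfolding le_measure[OF sN[unfolded sM[symmetric]]]
  proof
    fix A assume "A \<in> sets N"
    then have A[measurable]: "A \<in> sets borel" by (simp add: sN)
    have vm: "?\<pi> -` A \<in> sets borel" using measurable_sets[OF pm A] by simp
    have "emeasure N A = emeasure (density lborel (indicator S)) (?\<pi> -` A)"
      unfolding N_def by (subst emeasure_distr) auto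
    also have "\<dots> = (\<integral>\<^sup>+x. indicator S x * indicator (?\<pi> -` A) x \<partial>lborel)"
      using vm by (intro emeasure_density) auto
    also have "\<dots> = (\<integral>\<^sup>+x. indicator (S \<inter> ?\<pi> -` A) x \<partial>lborel)"
      by (intro nn_integral_cong) (auto simp: indicator_def)
    also have "\<dots> = emeasure lborel (S \<inter> ?\<pi> -` A)" using vm by (intro nn_integral_indicator) auto
    also have "S \<inter> ?\<pi> -` A = S \<inter> ?\<pi> -` (A \<inter> \<Gamma>)" using \<Gamma>(2) by blast
    also have "emeasure lborel (S \<inter> ?\<pi> -` (A \<inter> \<Gamma>)) \<le> ennreal c * hausdorff_outer (CARD('n) - 1) (A \<inter> \<Gamma>)" by (rule le)
    also have "hausdorff_outer (CARD('n) - 1) (A \<inter> \<Gamma>) = emeasure ?H (A \<inter> \<Gamma>)"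
      using A \<Gamma>(1) by (intro emeasure_hausdorff_measure[OF s, symmetric]) auto
    also have "ennreal c * emeasure ?H (A \<inter> \<Gamma>) = emeasure M A"
    proof -
      have AH: "A \<in> sets ?H" using A by (simp add: sets_hausdorff_measure)
      have "emeasure M A = (\<integral>\<^sup>+x. ennreal c * indicator \<Gamma> x * indicator A x \<partial>?H)"
        unfolding M_def using AH by (intro emeasure_density) auto
      also have "\<dots> = (\<integral>\<^sup>+x. ennreal c * indicator (A \<inter> \<Gamma>) x \<partial>?H)"
        by (intro nn_integral_cong) (auto simp: indicator_def)
      also have "\<dots> = ennreal c * emeasure ?H (A \<inter> \<Gamma>)" using AH \<Gamma>H by (intro nn_integral_cmult_indicator sets.Int)
      finally show ?thesis by simp
    qed
    finally show "emeasure N A \<le> emeasure M A" .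
  qed
  then have mono: "nn_integral N f \<le> nn_integral M f" for f
    by (intro nn_integral_mono_measure) (simp add: sN sM)
  have "(\<integral>\<^sup>+x. f (?\<pi> x) * indicator S x \<partial>lborel) \<le> ennreal c * (\<integral>\<^sup>+x. f x \<partial>restrict_space ?H \<Gamma>)"
    if f[measurable]: "f \<in> borel_measurable borel" for f
  proof -
    have fH: "f \<in> borel_measurable ?H" by measurable
    have "nn_integral N f = (\<integral>\<^sup>+x. f (?\<pi> x) \<partial>density lborel (indicator S))"
      unfolding N_def by (rule nn_integral_distr) auto
    also have "\<dots> = (\<integral>\<^sup>+x. f (?\<pi> x) * indicator S x \<partial>lborel)"
      by (subst nn_integral_density) (auto simp: mult.commute)
    finally have a: "(\<integral>\<^sup>+x. f (?\<pi> x) * indicator S x \<partial>lborel) = nn_integral N f" by simp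
    have "nn_integral M f = (\<integral>\<^sup>+x. ennreal c * (f x * indicator \<Gamma> x) \<partial>?H)"
      unfolding M_def using fH by (subst nn_integral_density) (auto simp: mult_ac)
    also have "\<dots> = ennreal c * (\<integral>\<^sup>+x. f x * indicator \<Gamma> x \<partial>?H)"
      using fH by (intro nn_integral_cmult) measurable
    also have "(\<integral>\<^sup>+x. f x * indicator \<Gamma> x \<partial>?H) = (\<integral>\<^sup>+x. f x \<partial>restrict_space ?H \<Gamma>)"
      by (rule nn_integral_restrict_space[symmetric]) simp
    finally show ?thesis using mono[of f] a by simp
  qed
  then show thesis using that c by blast
qed

section \<open>Strips along a Lipschitz boundary\<close>

text \<open>Positive above the graph of \<open>\<gamma>\<close> in direction \<open>e\<close>; \<open>y - height e \<gamma> y *\<^sub>R e\<close> lies on the graph.\<close>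

definition height :: "'a::real_inner \<Rightarrow> ('a \<Rightarrow> real) \<Rightarrow> 'a \<Rightarrow> real" where
  "height e \<gamma> y = y \<bullet> e - \<gamma> (y - (y \<bullet> e) *\<^sub>R e)"

text \<open>The orthogonal projection along \<open>e\<close> does not increase distances.\<close>

lemma height_lipschitz:
  assumes e: "norm e = 1" and L: "L-lipschitz_on {z. z \<bullet> e = 0} \<gamma>"
  shows "\<bar>height e \<gamma> x - height e \<gamma> y\<bar> \<le> (1 + L) * dist x y"
proof -
  have ee: "e \<bullet> e = 1" using e by (simp add: norm_eq_1)
  let ?p = "\<lambda>y. y - (y \<bullet> e) *\<^sub>R e"
  have p0: "?p y \<bullet> e = 0" for y by (simp add: inner_diff_left ee)
  have "dist (?p x) (?p y) \<le> dist x y"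
  proof -
    have "norm (z - (z \<bullet> e) *\<^sub>R e) \<le> norm z" for z
    proof -
      have "(z - (z \<bullet> e) *\<^sub>R e) \<bullet> (z - (z \<bullet> e) *\<^sub>R e) = z \<bullet> z - (z \<bullet> e) * (z \<bullet> e)"
        by (simp only: inner_diff_left inner_diff_right inner_scaleR_left inner_scaleR_right ee inner_commute[of e z]) simp
      then show ?thesis unfolding norm_le by simp
    qed
    from this[of "x - y"] have "norm (?p (x - y)) \<le> norm (x - y)" .
    moreover have "?p (x - y) = ?p x - ?p y" by (simp add: inner_diff_left algebra_simps)
    ultimately show ?thesis by (simp add: dist_norm)
  qed
  then have "dist (\<gamma> (?p x)) (\<gamma> (?p y)) \<le> L * dist x y"
    using lipschitz_onD[OF L, of "?p x" "?p y"] p0 lipschitz_on_nonneg[OF L]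
    by (smt (verit) mem_Collect_eq mult_left_mono)
  moreover have "\<bar>x \<bullet> e - y \<bullet> e\<bar> \<le> dist x y"
    using Cauchy_Schwarz_ineq2[of "x - y" e] e by (simp add: inner_diff_left dist_norm)
  moreover have "\<bar>height e \<gamma> x - height e \<gamma> y\<bar> \<le> \<bar>x \<bullet> e - y \<bullet> e\<bar> + dist (\<gamma> (?p x)) (\<gamma> (?p y))"
    by (simp add: height_def dist_real_def)
  ultimately show ?thesis by (simp add: distrib_right)
qed

lemma height_shift:
  assumes "norm e = 1" shows "height e \<gamma> (y - s *\<^sub>R e) = height e \<gamma> y - s"
proof -
  have ee: "e \<bullet> e = 1" using assms by (simp add: norm_eq_1)
  then have eq: "y - s *\<^sub>R e - ((y - s *\<^sub>R e) \<bullet> e) *\<^sub>R e = y - (y \<bullet> e) *\<^sub>R e"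
    by (simp add: inner_diff_left algebra_simps)
  have "height e \<gamma> (y - s *\<^sub>R e) = (y - s *\<^sub>R e) \<bullet> e - \<gamma> (y - (y \<bullet> e) *\<^sub>R e)" unfolding height_def eq ..
  then show ?thesis using ee by (simp add: height_def inner_diff_left)
qed

lemma continuous_on_height:
  assumes "norm e = 1" "L-lipschitz_on {z. z \<bullet> e = 0} \<gamma>" shows "continuous_on UNIV (height e \<gamma>)"
proof -
  have "(1 + L)-lipschitz_on UNIV (height e \<gamma>)"
    using height_lipschitz[OF assms] lipschitz_on_nonneg[OF assms(2)]
    by (auto simp: lipschitz_on_def dist_real_def)
  then show ?thesis by (rule lipschitz_on_continuous_on)
qed

text \<open>Near a boundary point of a Lipschitz domain, following the direction \<open>- e\<close> from a point of the
  domain leads to the boundary after a length comparable to the distance from the boundary.\<close>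

lemma lipschitz_graph_descent:
  fixes \<Omega> :: "'a::euclidean_space set"
  assumes \<Omega>: "open \<Omega>" and e: "norm e = 1" and L: "L-lipschitz_on {z. z \<bullet> e = 0} \<gamma>"
    and graph: "\<Omega> \<inter> ball x0 r = {y \<in> ball x0 r. \<gamma> (y - (y \<bullet> e) *\<^sub>R e) < y \<bullet> e}"
    and K: "1 + L \<le> K" and \<epsilon>: "0 \<le> \<epsilon>" "2 * (K * \<epsilon>) < r" and ne: "frontier \<Omega> \<noteq> {}"
    and x: "x \<in> \<Omega>" "x \<in> ball x0 (r / 2)" "infdist x (frontier \<Omega>) \<le> \<epsilon>"
  shows "0 \<le> height e \<gamma> x" "height e \<gamma> x \<le> K * \<epsilon>" "x - height e \<gamma> x *\<^sub>R e \<in> frontier \<Omega>"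
    "\<And>s. 0 \<le> s \<Longrightarrow> s < height e \<gamma> x \<Longrightarrow> x - s *\<^sub>R e \<in> \<Omega> \<and> infdist (x - s *\<^sub>R e) (frontier \<Omega>) \<le> K * \<epsilon>"
proof -
  let ?t = "height e \<gamma>"
  have L0: "0 \<le> L" by (rule lipschitz_on_nonneg[OF L])
  have K1: "1 \<le> K" using K L0 by simp
  have mem: "y \<in> \<Omega> \<longleftrightarrow> 0 < ?t y" if "y \<in> ball x0 r" for y
    using graph that by (auto simp: height_def set_eq_iff)
  have ct: "continuous_on UNIV ?t" by (rule continuous_on_height[OF e L])
  have int: "interior \<Omega> = \<Omega>" using \<Omega> by (rule interior_open)
  have front0: "?t y = 0" if y: "y \<in> frontier \<Omega>" "y \<in> ball x0 r" for y
  proof (rule antisym)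
    show "?t y \<le> 0" using mem[OF y(2)] y(1) int by (auto simp: frontier_def not_less)
    show "0 \<le> ?t y"
    proof (rule ccontr)
      assume "\<not> 0 \<le> ?t y"
      define W where "W = ball x0 r \<inter> {z. ?t z < 0}"
      have "open {z. ?t z < 0}" by (rule open_Collect_less[OF ct continuous_on_const])
      then have "open W" by (simp add: W_def open_Int)
      moreover have "y \<in> W" using y \<open>\<not> 0 \<le> ?t y\<close> by (simp add: W_def)
      moreover have "y \<in> closure \<Omega>" using y(1) by (simp add: frontier_def)
      ultimately obtain z where "z \<in> \<Omega>" "z \<in> W"
        by (metis IntI closure_iff_nhds_not_empty empty_iff order_refl Int_iff ex_in_conv)
      then show False using mem[of z] by (auto simp: W_def)
    qed
  qed
  obtain y where y: "y \<in> frontier \<Omega>" "infdist x (frontier \<Omega>) = dist x y"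
    using infdist_attains_inf[OF frontier_closed ne, of x] by auto
  have xb: "dist x0 x < r / 2" using x(2) by simp
  have "\<epsilon> \<le> K * \<epsilon>" using K1 \<epsilon>(1) mult_right_mono[of 1 K \<epsilon>] by simp
  then have "dist x0 y < r" using dist_triangle[of x0 y x] xb y(2) x(3) \<epsilon>(2) by linarith
  then have "?t y = 0" using front0[OF y(1)] by simp
  then have "?t x \<le> (1 + L) * dist x y" using height_lipschitz[OF e L, of x y] by simp
  also have "\<dots> \<le> K * \<epsilon>" using K L0 y(2) x(3) by (intro mult_mono) auto
  finally show tx: "?t x \<le> K * \<epsilon>" .
  have "x \<in> ball x0 r" using xb zero_le_dist[of x0 x] by (simp, linarith)
  then have t0: "0 < ?t x" using mem x(1) by blast
  then show "0 \<le> ?t x" by simp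
  have inball: "x - s *\<^sub>R e \<in> ball x0 r" if "0 \<le> s" "s \<le> ?t x" for s
  proof -
    have "dist x0 (x - s *\<^sub>R e) \<le> dist x0 x + dist x (x - s *\<^sub>R e)" by (rule dist_triangle)
    also have "dist x (x - s *\<^sub>R e) = s" using that e by (simp add: dist_norm)
    finally show ?thesis using that tx \<epsilon>(2) xb by simp
  qed
  have in\<Omega>: "x - s *\<^sub>R e \<in> \<Omega>" if "0 \<le> s" "s < ?t x" for s
    using mem[OF inball[of s]] that by (simp add: height_shift[OF e])
  show fr: "x - ?t x *\<^sub>R e \<in> frontier \<Omega>"
    unfolding frontier_def int
  proof
    show "x - ?t x *\<^sub>R e \<notin> \<Omega>" using mem[OF inball[of "?t x"]] t0 by (simp add: height_shift[OF e])
    show "x - ?t x *\<^sub>R e \<in> closure \<Omega>"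
      unfolding closure_approachable
    proof (intro allI impI)
      fix d :: real assume d: "0 < d"
      define s where "s = max 0 (?t x - d / 2)"
      have s: "0 \<le> s" "s < ?t x" "?t x - s < d" using t0 d by (auto simp: s_def)
      have "dist (x - s *\<^sub>R e) (x - ?t x *\<^sub>R e) = norm ((?t x - s) *\<^sub>R e)"
        by (simp add: dist_norm algebra_simps)
      also have "\<dots> < d" using s e by simp
      finally show "\<exists>y\<in>\<Omega>. dist y (x - ?t x *\<^sub>R e) < d" using in\<Omega>[OF s(1,2)] by blast
    qed
  qed
  show "x - s *\<^sub>R e \<in> \<Omega> \<and> infdist (x - s *\<^sub>R e) (frontier \<Omega>) \<le> K * \<epsilon>" if s: "0 \<le> s" "s < ?t x" for s
  proof
    have "infdist (x - s *\<^sub>R e) (frontier \<Omega>) \<le> dist (x - s *\<^sub>R e) (x - ?t x *\<^sub>R e)" by (rule infdist_le[OF fr])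
    also have "\<dots> = norm ((?t x - s) *\<^sub>R e)" by (simp add: dist_norm algebra_simps)
    also have "\<dots> \<le> K * \<epsilon>" using s e tx by simp
    finally show "infdist (x - s *\<^sub>R e) (frontier \<Omega>) \<le> K * \<epsilon>" .
  qed (rule in\<Omega>[OF s])
qed

definition strip :: "'a::metric_space set \<Rightarrow> real \<Rightarrow> 'a set" where
  "strip \<Omega> \<epsilon> = {x \<in> \<Omega>. infdist x (frontier \<Omega>) \<le> \<epsilon>}"

lemma strip_borel: "open \<Omega> \<Longrightarrow> strip \<Omega> \<epsilon> \<in> sets borel"
proof -
  assume "open \<Omega>"
  moreover have "closed {x. infdist x (frontier \<Omega>) \<le> \<epsilon>}"
    by (intro closed_Collect_le continuous_on_infdist continuous_on_id continuous_on_const)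
  ultimately have "\<Omega> \<inter> {x. infdist x (frontier \<Omega>) \<le> \<epsilon>} \<in> sets borel" by auto
  then show ?thesis by (simp add: strip_def Collect_conj_eq)
qed

text \<open>Compactness of the boundary turns the local graphs into finitely many charts with a common constant.
  A chart consists of an open set \<open>V\<close>, the direction \<open>e\<close> and the height \<open>t\<close> above the boundary.\<close>

lemma lipschitz_boundary_charts:
  fixes \<Omega> :: "(real^'n) set"
  assumes \<Omega>: "open \<Omega>" "bounded \<Omega>" "\<Omega> \<noteq> {}" and lip: "lipschitz_boundary \<Omega>"
  obtains K \<epsilon>0 :: real and E :: "((real^'n) set \<times> (real^'n) \<times> (real^'n \<Rightarrow> real)) set"
  where "1 \<le> K" "0 < \<epsilon>0" "finite E"
    and "\<And>V e t. (V, e, t) \<in> E \<Longrightarrow> open V \<and> norm e = 1 \<and> continuous_on UNIV t"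
    and "\<And>V e t \<epsilon> x. (V, e, t) \<in> E \<Longrightarrow> 0 \<le> \<epsilon> \<Longrightarrow> \<epsilon> \<le> \<epsilon>0 \<Longrightarrow> x \<in> strip \<Omega> \<epsilon> \<inter> V \<Longrightarrow>
        0 \<le> t x \<and> t x \<le> K * \<epsilon> \<and> x - t x *\<^sub>R e \<in> frontier \<Omega> \<and>
        (\<forall>s. 0 \<le> s \<longrightarrow> s < t x \<longrightarrow> x - s *\<^sub>R e \<in> strip \<Omega> (K * \<epsilon>))"
    and "\<And>\<epsilon>. \<epsilon> \<le> \<epsilon>0 \<Longrightarrow> strip \<Omega> \<epsilon> \<subseteq> (\<Union>(V, e, t)\<in>E. V)"
proof -
  let ?\<Gamma> = "frontier \<Omega>"
  have "\<Omega> \<noteq> UNIV" using \<Omega>(2) not_bounded_UNIV by metis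
  then have ne: "?\<Gamma> \<noteq> {}" using \<Omega>(3) frontier_not_empty by blast
  have cpt: "compact ?\<Gamma>" using \<Omega>(2) by (simp add: compact_frontier_bounded)
  have "\<exists>p. case p of (r, e, L, \<gamma>) \<Rightarrow> 0 < r \<and> norm e = 1 \<and> L-lipschitz_on {z. z \<bullet> e = 0} \<gamma> \<and>
        \<Omega> \<inter> ball x r = {y \<in> ball x r. \<gamma> (y - (y \<bullet> e) *\<^sub>R e) < y \<bullet> e}" if "x \<in> ?\<Gamma>" for x
    using lip that unfolding lipschitz_boundary_def by fast
  from bchoice[OF ballI[OF this]] obtain p where p: "\<forall>x\<in>?\<Gamma>. case p x of (r, e, L, \<gamma>) \<Rightarrow> 0 < r \<and> norm e = 1 \<and> L-lipschitz_on {z. z \<bullet> e = 0} \<gamma> \<and>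
        \<Omega> \<inter> ball x r = {y \<in> ball x r. \<gamma> (y - (y \<bullet> e) *\<^sub>R e) < y \<bullet> e}" ..
  define r e L \<gamma> where "r x = fst (p x)" and "e x = fst (snd (p x))" and "L x = fst (snd (snd (p x)))" and "\<gamma> x = snd (snd (snd (p x)))" for x
  have q: "0 < r x" "norm (e x) = 1" "(L x)-lipschitz_on {z. z \<bullet> e x = 0} (\<gamma> x)"
        "\<Omega> \<inter> ball x (r x) = {y \<in> ball x (r x). \<gamma> x (y - (y \<bullet> e x) *\<^sub>R e x) < y \<bullet> e x}" if "x \<in> ?\<Gamma>" for x
    using bspec[OF p that] by (auto simp: r_def e_def L_def \<gamma>_def case_prod_beta)
  have "?\<Gamma> \<subseteq> (\<Union>x\<in>?\<Gamma>. ball x (r x / 2))" 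
  proof
    fix x assume "x \<in> ?\<Gamma>"
    then show "x \<in> (\<Union>x\<in>?\<Gamma>. ball x (r x / 2))" using q(1)[of x] by (intro UN_I[of x]) auto
  qed
  then obtain D where D: "D \<subseteq> ?\<Gamma>" "finite D" "?\<Gamma> \<subseteq> (\<Union>x\<in>D. ball x (r x / 2))"
    using compactE_image[OF cpt, of ?\<Gamma> "\<lambda>x. ball x (r x / 2)"] by auto
  have Dne: "D \<noteq> {}" using D(3) ne by auto
  have op: "open (\<Union>x\<in>D. ball x (r x / 2))" by auto
  obtain \<delta> where \<delta>: "0 < \<delta>" "(\<Union>x\<in>?\<Gamma>. ball x \<delta>) \<subseteq> (\<Union>x\<in>D. ball x (r x / 2))"
    using compact_subset_open_imp_ball_epsilon_subset[OF cpt op D(3)] by blast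
  define K where "K = 1 + (\<Sum>x\<in>D. L x)"
  have L0: "0 \<le> L x" if "x \<in> D" for x using lipschitz_on_nonneg[OF q(3)] D(1) that by blast
  have K: "1 + L x \<le> K" if "x \<in> D" for x
    unfolding K_def using member_le_sum[OF that _ D(2), of L] L0 by auto
  have K1: "1 \<le> K" unfolding K_def using L0 by (simp add: sum_nonneg)
  define r0 where "r0 = Min (r ` D)"
  have r0: "0 < r0" "\<And>x. x \<in> D \<Longrightarrow> r0 \<le> r x"
    using D(1,2) Dne q(1) by (auto simp: r0_def Min_gr_iff)
  \<comment> \<open>Strips thinner than \<open>\<epsilon>0\<close> lie in the half balls, and segments of length \<open>K * \<epsilon>0\<close> that start
    there stay in the full balls.\<close>
  define \<epsilon>0 where "\<epsilon>0 = min (\<delta> / 2) (r0 / (4 * K))"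
  have \<epsilon>0: "0 < \<epsilon>0" using \<delta> r0 K1 by (simp add: \<epsilon>0_def)
  define E where "E = (\<lambda>x. (ball x (r x / 2), e x, height (e x) (\<gamma> x))) ` D"
  show thesis
  proof (rule that[of K \<epsilon>0 E])
    show "finite E" unfolding E_def using D(2) by simp
    show "open V \<and> norm e' = 1 \<and> continuous_on UNIV t" if VE: "(V, e', t) \<in> E" for V e' t
      using VE q(2,3) D(1) by (auto simp: E_def intro: continuous_on_height)
    show "0 \<le> t x \<and> t x \<le> K * \<epsilon> \<and> x - t x *\<^sub>R e' \<in> ?\<Gamma> \<and> (\<forall>s. 0 \<le> s \<longrightarrow> s < t x \<longrightarrow> x - s *\<^sub>R e' \<in> strip \<Omega> (K * \<epsilon>))"
      if VE: "(V, e', t) \<in> E" and \<epsilon>: "0 \<le> \<epsilon>" "\<epsilon> \<le> \<epsilon>0" and x: "x \<in> strip \<Omega> \<epsilon> \<inter> V" for V e' t \<epsilon> x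
    proof -
      obtain x0 where x0: "x0 \<in> D" "V = ball x0 (r x0 / 2)" "e' = e x0" "t = height (e x0) (\<gamma> x0)"
        using VE by (auto simp: E_def)
      have x0\<Gamma>: "x0 \<in> ?\<Gamma>" using x0(1) D(1) by blast
      have small: "2 * (K * \<epsilon>) < r x0"
      proof -
        have "K * \<epsilon> \<le> K * (r0 / (4 * K))" using \<epsilon> K1 by (intro mult_left_mono) (auto simp: \<epsilon>0_def)
        also have "\<dots> = r0 / 4" using K1 by simp
        finally show ?thesis using r0(1) r0(2)[OF x0(1)] by linarith
      qed
      have xs: "x \<in> \<Omega>" "x \<in> ball x0 (r x0 / 2)" "infdist x ?\<Gamma> \<le> \<epsilon>" using x x0(2) by (auto simp: strip_def)
      note desc = lipschitz_graph_descent[OF \<Omega>(1) q(2,3,4)[OF x0\<Gamma>] K[OF x0(1)] \<epsilon>(1) small ne xs]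
      show ?thesis unfolding x0(3,4) strip_def using desc by blast
    qed
    show "strip \<Omega> \<epsilon> \<subseteq> (\<Union>(V, e, t)\<in>E. V)" if "\<epsilon> \<le> \<epsilon>0" for \<epsilon>
    proof
      fix x assume x: "x \<in> strip \<Omega> \<epsilon>"
      obtain y where y: "y \<in> ?\<Gamma>" "infdist x ?\<Gamma> = dist x y"
        using infdist_attains_inf[OF frontier_closed ne, of x] by auto
      have "dist y x < \<delta>" using x y(2) that \<delta>(1) by (auto simp: strip_def \<epsilon>0_def dist_commute)
      then have "x \<in> ball y \<delta>" by simp
      then have "x \<in> (\<Union>x\<in>D. ball x (r x / 2))" using \<delta>(2) y(1) by blast
      then show "x \<in> (\<Union>(V, e, t)\<in>E. V)" by (auto simp: E_def)
    qed
  qed (use K1 \<epsilon>0 in auto)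
qed

text \<open>Cauchy-Schwarz for the expansion of \<open>e\<close> in the standard basis.\<close>

lemma directional_derivative_squared_le:
  fixes \<phi> :: "real^'n \<Rightarrow> 'b::euclidean_space"
  assumes sm: "smooth \<phi>" and e: "norm e = 1"
  shows "(norm (frechet_derivative \<phi> (at x) e))\<^sup>2 \<le> (\<Sum>j\<in>UNIV. (norm (frechet_derivative \<phi> (at x) (axis j 1)))\<^sup>2)"
proof -
  let ?D = "frechet_derivative \<phi> (at x)"
  have lin: "linear ?D" using smooth_has_derivative[OF sm] has_derivative_linear by blast
  have "e = (\<Sum>j\<in>UNIV. (e $ j) *\<^sub>R axis j 1)" by (simp add: basis_expansion scalar_mult_eq_scaleR[symmetric])
  then have "?D e = (\<Sum>j\<in>UNIV. (e $ j) *\<^sub>R ?D (axis j 1))"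
    using linear_sum[OF lin, of "\<lambda>j. (e $ j) *\<^sub>R axis j 1" UNIV] by (simp add: linear_cmul[OF lin])
  then have "norm (?D e) \<le> (\<Sum>j\<in>UNIV. \<bar>e $ j\<bar> * norm (?D (axis j 1)))"
    by (metis (no_types, lifting) norm_scaleR norm_sum sum.cong)
  also have "\<dots> \<le> L2_set (\<lambda>j. e $ j) UNIV * L2_set (\<lambda>j. norm (?D (axis j 1))) UNIV"
    using L2_set_mult_ineq[of "\<lambda>j. e $ j" "\<lambda>j. norm (?D (axis j 1))" UNIV] by simp
  also have "L2_set (\<lambda>j. e $ j) UNIV = 1" using e by (simp add: norm_vec_def L2_set_def)
  finally have "(norm (?D e))\<^sup>2 \<le> (L2_set (\<lambda>j. norm (?D (axis j 1))) UNIV)\<^sup>2" by (intro power_mono) auto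
  also have "\<dots> = (\<Sum>j\<in>UNIV. (norm (?D (axis j 1)))\<^sup>2)" unfolding L2_set_def by (simp add: sum_nonneg)
  finally show ?thesis .
qed

text \<open>In every chart, each point of the strip is joined to the boundary by a segment of length at most
  \<open>K * \<epsilon>\<close> that stays in the wider strip. The boundary term comes with a constant that may grow as the
  strip gets thinner, the gradient term with the square of the length of the segments.\<close>

lemma strip_estimate:
  fixes \<Omega> :: "(real^'n) set"
  assumes \<Omega>: "open \<Omega>" "bounded \<Omega>" "\<Omega> \<noteq> {}" and lip: "lipschitz_boundary \<Omega>" and n: "CARD('n) \<ge> 2"
  obtains C K \<epsilon>0 :: real where "0 \<le> C" "1 \<le> K" "0 < \<epsilon>0"
    and "\<And>\<epsilon>. 0 < \<epsilon> \<Longrightarrow> \<epsilon> \<le> \<epsilon>0 \<Longrightarrow> \<exists>c\<ge>0. \<forall>\<phi>::real^'n \<Rightarrow> 'b::euclidean_space. smooth \<phi> \<longrightarrow>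
      (\<integral>\<^sup>+x. ennreal ((norm (\<phi> x))\<^sup>2) * indicator (strip \<Omega> \<epsilon>) x \<partial>lborel)
      \<le> ennreal c * (\<integral>\<^sup>+x. ennreal ((norm (\<phi> x))\<^sup>2) \<partial>boundary_measure \<Omega>)
        + ennreal (C * \<epsilon>\<^sup>2) * (\<Sum>j\<in>UNIV. \<integral>\<^sup>+x. ennreal ((norm (frechet_derivative \<phi> (at x) (axis j 1)))\<^sup>2) * indicator (strip \<Omega> (K * \<epsilon>)) x \<partial>lborel)"
proof -
  obtain K \<epsilon>0 and E :: "((real^'n) set \<times> (real^'n) \<times> (real^'n \<Rightarrow> real)) set"
    where K: "1 \<le> K" and \<epsilon>0: "0 < \<epsilon>0" and fin: "finite E"
    and E: "\<And>V e t. (V, e, t) \<in> E \<Longrightarrow> open V \<and> norm e = 1 \<and> continuous_on UNIV t"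
    and desc: "\<And>V e t \<epsilon> x. (V, e, t) \<in> E \<Longrightarrow> 0 \<le> \<epsilon> \<Longrightarrow> \<epsilon> \<le> \<epsilon>0 \<Longrightarrow> x \<in> strip \<Omega> \<epsilon> \<inter> V \<Longrightarrow>
        0 \<le> t x \<and> t x \<le> K * \<epsilon> \<and> x - t x *\<^sub>R e \<in> frontier \<Omega> \<and>
        (\<forall>s. 0 \<le> s \<longrightarrow> s < t x \<longrightarrow> x - s *\<^sub>R e \<in> strip \<Omega> (K * \<epsilon>))"
    and cov: "\<And>\<epsilon>. \<epsilon> \<le> \<epsilon>0 \<Longrightarrow> strip \<Omega> \<epsilon> \<subseteq> (\<Union>(V, e, t)\<in>E. V)"
    by (rule lipschitz_boundary_charts[OF \<Omega> lip], rule that)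
  define C where "C = real (card E) * (2 * K\<^sup>2)"
  let ?B = "\<lambda>\<phi>::real^'n \<Rightarrow> 'b. \<integral>\<^sup>+x. ennreal ((norm (\<phi> x))\<^sup>2) \<partial>boundary_measure \<Omega>"
  let ?G = "\<lambda>(\<phi>::real^'n \<Rightarrow> 'b) \<epsilon>. \<Sum>j\<in>UNIV. \<integral>\<^sup>+x. ennreal ((norm (frechet_derivative \<phi> (at x) (axis j 1)))\<^sup>2) * indicator (strip \<Omega> (K * \<epsilon>)) x \<partial>lborel"
  have "\<exists>c\<ge>0. \<forall>\<phi>::real^'n \<Rightarrow> 'b. smooth \<phi> \<longrightarrow>
      (\<integral>\<^sup>+x. ennreal ((norm (\<phi> x))\<^sup>2) * indicator (strip \<Omega> \<epsilon>) x \<partial>lborel)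
      \<le> ennreal c * ?B \<phi> + ennreal (C * \<epsilon>\<^sup>2) * ?G \<phi> \<epsilon>" if \<epsilon>: "0 < \<epsilon>" "\<epsilon> \<le> \<epsilon>0" for \<epsilon>
  proof -
    have h0: "0 \<le> K * \<epsilon>" using K \<epsilon> by simp
    have chart: "\<exists>c>0. \<forall>f. f \<in> borel_measurable borel \<longrightarrow>
        (\<integral>\<^sup>+x. f (x - t x *\<^sub>R e) * indicator (strip \<Omega> \<epsilon> \<inter> V) x \<partial>lborel) \<le> ennreal c * (\<integral>\<^sup>+x. f x \<partial>boundary_measure \<Omega>)"
      if VE: "(V, e, t) \<in> E" for V e t
    proof -
      have S: "strip \<Omega> \<epsilon> \<inter> V \<in> sets borel" using strip_borel[OF \<Omega>(1)] E[OF VE] by auto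
      have tm: "t \<in> borel_measurable borel" using E[OF VE] by (simp add: borel_measurable_continuous_onI)
      have e: "norm e = 1" using E[OF VE] by simp
      have fr: "frontier \<Omega> \<in> sets borel" by (simp add: frontier_closed)
      show ?thesis
        unfolding boundary_measure_def
        by (rule projection_integral_le[OF e h0 n S tm _ fr]) (use desc[OF VE less_imp_le[OF \<epsilon>(1)] \<epsilon>(2)] in auto)
    qed
    then have "\<forall>p\<in>E. \<exists>c>0. case p of (V, e, t) \<Rightarrow> \<forall>f. f \<in> borel_measurable borel \<longrightarrow>
        (\<integral>\<^sup>+x. f (x - t x *\<^sub>R e) * indicator (strip \<Omega> \<epsilon> \<inter> V) x \<partial>lborel) \<le> ennreal c * (\<integral>\<^sup>+x. f x \<partial>boundary_measure \<Omega>)"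
      by fast
    from bchoice[OF this] obtain c where c: "\<forall>p\<in>E. 0 < c p \<and> (case p of (V, e, t) \<Rightarrow> \<forall>f. f \<in> borel_measurable borel \<longrightarrow>
        (\<integral>\<^sup>+x. f (x - t x *\<^sub>R e) * indicator (strip \<Omega> \<epsilon> \<inter> V) x \<partial>lborel) \<le> ennreal (c p) * (\<integral>\<^sup>+x. f x \<partial>boundary_measure \<Omega>))" by blast
    have "(\<integral>\<^sup>+x. ennreal ((norm (\<phi> x))\<^sup>2) * indicator (strip \<Omega> \<epsilon>) x \<partial>lborel)
      \<le> ennreal (\<Sum>p\<in>E. 2 * c p) * ?B \<phi> + ennreal (C * \<epsilon>\<^sup>2) * ?G \<phi> \<epsilon>" if sm: "smooth \<phi>" for \<phi> :: "real^'n \<Rightarrow> 'b"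
    proof -
      have \<phi>m[measurable]: "\<phi> \<in> borel_measurable borel" by (intro borel_measurable_continuous_onI smooth_continuous_on sm)
      have Dm[measurable]: "(\<lambda>x. frechet_derivative \<phi> (at x) v) \<in> borel_measurable borel" for v
        by (intro borel_measurable_continuous_onI smooth_continuous_on smooth_frechet_derivative sm)
      have Sm[measurable]: "strip \<Omega> \<epsilon>' \<in> sets borel" for \<epsilon>' by (rule strip_borel[OF \<Omega>(1)])
      have Vm: "fst p \<in> sets borel" if "p \<in> E" for p using E[of "fst p" "fst (snd p)" "snd (snd p)"] that by simp
      have one: "(\<integral>\<^sup>+x. ennreal ((norm (\<phi> x))\<^sup>2) * indicator (strip \<Omega> \<epsilon> \<inter> fst p) x \<partial>lborel)
          \<le> ennreal (2 * c p) * ?B \<phi> + ennreal (2 * K\<^sup>2 * \<epsilon>\<^sup>2) * ?G \<phi> \<epsilon>" if pE: "p \<in> E" for p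
      proof -
        obtain V e t where p: "p = (V, e, t)" by (cases p)
        have VE: "(V, e, t) \<in> E" using pE p by simp
        have S: "strip \<Omega> \<epsilon> \<inter> V \<in> sets borel" using E[OF VE] by auto
        have tm: "t \<in> borel_measurable borel" using E[OF VE] by (simp add: borel_measurable_continuous_onI)
        have e: "norm e = 1" using E[OF VE] by simp
        have "(\<integral>\<^sup>+x. ennreal ((norm (\<phi> x))\<^sup>2) * indicator (strip \<Omega> \<epsilon> \<inter> V) x \<partial>lborel)
          \<le> 2 * (\<integral>\<^sup>+x. ennreal ((norm (\<phi> (x - t x *\<^sub>R e)))\<^sup>2) * indicator (strip \<Omega> \<epsilon> \<inter> V) x \<partial>lborel)
            + ennreal (2 * (K * \<epsilon>)\<^sup>2) * (\<integral>\<^sup>+x. ennreal ((norm (frechet_derivative \<phi> (at x) e))\<^sup>2) * indicator (strip \<Omega> (K * \<epsilon>)) x \<partial>lborel)"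
          by (rule segment_estimate[OF sm S Sm tm _ h0]) (use desc[OF VE less_imp_le[OF \<epsilon>(1)] \<epsilon>(2)] in auto)
        also have "\<dots> \<le> 2 * (ennreal (c p) * ?B \<phi>) + ennreal (2 * (K * \<epsilon>)\<^sup>2) * ?G \<phi> \<epsilon>"
        proof (intro add_mono mult_left_mono)
          have "\<forall>f. f \<in> borel_measurable borel \<longrightarrow>
            (\<integral>\<^sup>+x. f (x - t x *\<^sub>R e) * indicator (strip \<Omega> \<epsilon> \<inter> V) x \<partial>lborel) \<le> ennreal (c p) * (\<integral>\<^sup>+x. f x \<partial>boundary_measure \<Omega>)"
            using bspec[OF c pE] by (simp add: p)
          from this[rule_format, of "\<lambda>x. ennreal ((norm (\<phi> x))\<^sup>2)"]
          show "(\<integral>\<^sup>+x. ennreal ((norm (\<phi> (x - t x *\<^sub>R e)))\<^sup>2) * indicator (strip \<Omega> \<epsilon> \<inter> V) x \<partial>lborel) \<le> ennreal (c p) * ?B \<phi>"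
            by simp
          have "(\<integral>\<^sup>+x. ennreal ((norm (frechet_derivative \<phi> (at x) e))\<^sup>2) * indicator (strip \<Omega> (K * \<epsilon>)) x \<partial>lborel)
            \<le> (\<integral>\<^sup>+x. (\<Sum>j\<in>UNIV. ennreal ((norm (frechet_derivative \<phi> (at x) (axis j 1)))\<^sup>2) * indicator (strip \<Omega> (K * \<epsilon>)) x) \<partial>lborel)"
          proof (rule nn_integral_mono)
            fix x
            have "ennreal ((norm (frechet_derivative \<phi> (at x) e))\<^sup>2) \<le> ennreal (\<Sum>j\<in>UNIV. (norm (frechet_derivative \<phi> (at x) (axis j 1)))\<^sup>2)"
              by (intro ennreal_leI directional_derivative_squared_le[OF sm e])
            also have "\<dots> = (\<Sum>j\<in>UNIV. ennreal ((norm (frechet_derivative \<phi> (at x) (axis j 1)))\<^sup>2))"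
              by (rule sum_ennreal[symmetric]) simp
            finally show "ennreal ((norm (frechet_derivative \<phi> (at x) e))\<^sup>2) * indicator (strip \<Omega> (K * \<epsilon>)) x
                \<le> (\<Sum>j\<in>UNIV. ennreal ((norm (frechet_derivative \<phi> (at x) (axis j 1)))\<^sup>2) * indicator (strip \<Omega> (K * \<epsilon>)) x)"
              unfolding sum_distrib_right[symmetric] by (rule mult_right_mono) simp
          qed
          also have "\<dots> = ?G \<phi> \<epsilon>" by (rule nn_integral_sum) measurable
          finally show "(\<integral>\<^sup>+x. ennreal ((norm (frechet_derivative \<phi> (at x) e))\<^sup>2) * indicator (strip \<Omega> (K * \<epsilon>)) x \<partial>lborel) \<le> ?G \<phi> \<epsilon>" .
        qed auto
        finally show ?thesis by (simp add: p power_mult_distrib ennreal_mult' mult.assoc)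
      qed
      have "(\<integral>\<^sup>+x. ennreal ((norm (\<phi> x))\<^sup>2) * indicator (strip \<Omega> \<epsilon>) x \<partial>lborel)
        \<le> (\<integral>\<^sup>+x. (\<Sum>p\<in>E. ennreal ((norm (\<phi> x))\<^sup>2) * indicator (strip \<Omega> \<epsilon> \<inter> fst p) x) \<partial>lborel)"
      proof (rule nn_integral_mono)
        fix x
        show "ennreal ((norm (\<phi> x))\<^sup>2) * indicator (strip \<Omega> \<epsilon>) x \<le> (\<Sum>p\<in>E. ennreal ((norm (\<phi> x))\<^sup>2) * indicator (strip \<Omega> \<epsilon> \<inter> fst p) x)"
        proof (cases "x \<in> strip \<Omega> \<epsilon>")
          case True
          then obtain V e t where p: "(V, e, t) \<in> E" "x \<in> V" using cov[OF \<epsilon>(2)] by blast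
          then have "ennreal ((norm (\<phi> x))\<^sup>2) * indicator (strip \<Omega> \<epsilon>) x = ennreal ((norm (\<phi> x))\<^sup>2) * indicator (strip \<Omega> \<epsilon> \<inter> fst (V, e, t)) x"
            using True by simp
          also have "\<dots> \<le> (\<Sum>p\<in>E. ennreal ((norm (\<phi> x))\<^sup>2) * indicator (strip \<Omega> \<epsilon> \<inter> fst p) x)"
            by (rule member_le_sum[OF p(1) _ fin]) simp
          finally show ?thesis .
        qed simp
      qed
      also have "\<dots> = (\<Sum>p\<in>E. \<integral>\<^sup>+x. ennreal ((norm (\<phi> x))\<^sup>2) * indicator (strip \<Omega> \<epsilon> \<inter> fst p) x \<partial>lborel)"
        using Vm by (intro nn_integral_sum) auto
      also have "\<dots> \<le> (\<Sum>p\<in>E. ennreal (2 * c p) * ?B \<phi> + ennreal (2 * K\<^sup>2 * \<epsilon>\<^sup>2) * ?G \<phi> \<epsilon>)"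
        by (intro sum_mono one)
      also have "\<dots> = (\<Sum>p\<in>E. ennreal (2 * c p)) * ?B \<phi> + of_nat (card E) * (ennreal (2 * K\<^sup>2 * \<epsilon>\<^sup>2) * ?G \<phi> \<epsilon>)"
        by (simp add: sum.distrib sum_distrib_right)
      also have "(\<Sum>p\<in>E. ennreal (2 * c p)) = ennreal (\<Sum>p\<in>E. 2 * c p)"
        by (rule sum_ennreal) (use c in \<open>auto intro: less_imp_le\<close>)
      also have "of_nat (card E) * (ennreal (2 * K\<^sup>2 * \<epsilon>\<^sup>2) * ?G \<phi> \<epsilon>) = ennreal (C * \<epsilon>\<^sup>2) * ?G \<phi> \<epsilon>"
        by (simp add: C_def ennreal_of_nat_eq_real_of_nat ennreal_mult' mult.assoc)
      finally show ?thesis .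
    qed
    moreover have "0 \<le> (\<Sum>p\<in>E. 2 * c p)" using bspec[OF c, THEN conjunct1] by (intro sum_nonneg) (simp add: less_imp_le)
    ultimately show ?thesis by blast
  qed
  moreover have "0 \<le> C" by (simp add: C_def)
  ultimately show thesis using that K \<epsilon>0 by blast
qed

section \<open>Functions with zero trace are limits of test fields\<close>

lemma borel_measurable_lebesgue_on:
  "f \<in> borel_measurable borel \<Longrightarrow> f \<in> borel_measurable (lebesgue_on \<Omega>)"
  by (intro measurable_restrict_space1 measurable_completion) simp

text \<open>Translation between the nonnegative integrals of the strip estimate and the norms that the theorem
  is about.\<close>

lemma nn_integral_lborel_indicator_eq_l2_norm:
  fixes f :: "'a::euclidean_space \<Rightarrow> 'b::euclidean_space"
  assumes f: "L2 (lebesgue_on \<Omega>) f" and A: "A \<in> sets borel" "A \<subseteq> \<Omega>" and \<Omega>: "\<Omega> \<in> sets lebesgue"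
  shows "(\<integral>\<^sup>+x. ennreal ((norm (f x))\<^sup>2) * indicator A x \<partial>lborel)
    = ennreal ((l2_norm (lebesgue_on \<Omega>) (\<lambda>x. indicator A x *\<^sub>R f x))\<^sup>2)"
proof -
  have L: "L2 (lebesgue_on \<Omega>) (\<lambda>x. indicator A x *\<^sub>R f x)"
    using A by (intro L2_mult_bounded[OF f, where B=1] borel_measurable_lebesgue_on borel_measurable_indicator) (auto simp: indicator_def)
  have "ennreal ((l2_norm (lebesgue_on \<Omega>) (\<lambda>x. indicator A x *\<^sub>R f x))\<^sup>2)
    = (\<integral>\<^sup>+x. ennreal ((norm (indicator A x *\<^sub>R f x))\<^sup>2) \<partial>lebesgue_on \<Omega>)"
    by (rule nn_integral_eq_l2_norm_squared[OF L, symmetric])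
  also have "\<dots> = (\<integral>\<^sup>+x. ennreal ((norm (indicator A x *\<^sub>R f x))\<^sup>2) * indicator \<Omega> x \<partial>lebesgue)"
    using \<Omega> by (intro nn_integral_restrict_space) simp
  also have "\<dots> = (\<integral>\<^sup>+x. ennreal ((norm (f x))\<^sup>2) * indicator A x \<partial>lebesgue)"
    using A(2) by (intro nn_integral_cong) (auto simp: indicator_def)
  also have "\<dots> = (\<integral>\<^sup>+x. ennreal ((norm (f x))\<^sup>2) * indicator A x \<partial>lborel)" by (rule nn_integral_completion)
  finally show ?thesis by simp
qed

text \<open>Every point of the open set \<open>\<Omega>\<close> leaves the strips eventually; dominated convergence.\<close>

lemma l2_norm_strip_tendsto_0:
  fixes f :: "'a::euclidean_space \<Rightarrow> 'b::euclidean_space"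
  assumes \<Omega>: "open \<Omega>" "frontier \<Omega> \<noteq> {}" and f: "L2 (lebesgue_on \<Omega>) f" and s: "s \<longlonglongrightarrow> 0"
  shows "(\<lambda>m. l2_norm (lebesgue_on \<Omega>) (\<lambda>x. indicator (strip \<Omega> (s m)) x *\<^sub>R f x)) \<longlonglongrightarrow> 0"
proof -
  have Lm: "(\<lambda>x. indicator (strip \<Omega> \<epsilon>) x *\<^sub>R f x) \<in> borel_measurable (lebesgue_on \<Omega>)" for \<epsilon>
    by (intro borel_measurable_scaleR L2_measurable f borel_measurable_lebesgue_on borel_measurable_indicator strip_borel \<Omega>)
  have "(\<lambda>m. \<integral>x. (norm (indicator (strip \<Omega> (s m)) x *\<^sub>R f x))\<^sup>2 \<partial>lebesgue_on \<Omega>) \<longlonglongrightarrow> (\<integral>x. 0 \<partial>lebesgue_on \<Omega>)"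
  proof (rule integral_dominated_convergence)
    show "integrable (lebesgue_on \<Omega>) (\<lambda>x. (norm (f x))\<^sup>2)" by (rule L2_integrable[OF f])
    show "(\<lambda>x. (norm (indicator (strip \<Omega> (s m)) x *\<^sub>R f x))\<^sup>2) \<in> borel_measurable (lebesgue_on \<Omega>)" for m
      by (intro borel_measurable_power measurable_compose[OF Lm]) simp
    show "AE x in lebesgue_on \<Omega>. norm ((norm (indicator (strip \<Omega> (s m)) x *\<^sub>R f x))\<^sup>2) \<le> (norm (f x))\<^sup>2" for m
      by (intro AE_I2) (auto simp: indicator_def)
    show "AE x in lebesgue_on \<Omega>. (\<lambda>m. (norm (indicator (strip \<Omega> (s m)) x *\<^sub>R f x))\<^sup>2) \<longlonglongrightarrow> 0"
    proof (rule AE_I2, rule tendsto_eventually)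
      fix x assume "x \<in> space (lebesgue_on \<Omega>)"
      then have "x \<in> \<Omega>" by simp
      then have "x \<notin> frontier \<Omega>" using \<Omega>(1) by (simp add: frontier_def interior_open)
      then have "0 < infdist x (frontier \<Omega>)" by (rule infdist_pos_not_in_closed[OF frontier_closed \<Omega>(2)])
      then have "\<forall>\<^sub>F m in sequentially. s m < infdist x (frontier \<Omega>)" using s by (rule order_tendstoD(2)[rotated])
      then show "\<forall>\<^sub>F m in sequentially. (norm (indicator (strip \<Omega> (s m)) x *\<^sub>R f x))\<^sup>2 = 0"
        by eventually_elim (simp add: strip_def)
    qed
  qed simp
  from tendsto_real_sqrt[OF this] show ?thesis by (simp add: l2_norm_def)
qed

lemma boundary_measure_smooth_L2:
  fixes \<phi> :: "real^'n \<Rightarrow> 'b::euclidean_space"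
  assumes \<Omega>: "bounded \<Omega>" "polyhedral_boundary \<Omega>" and n: "CARD('n) \<ge> 2" and \<phi>: "continuous_on UNIV \<phi>"
  shows "L2 (boundary_measure \<Omega>) \<phi>"
proof -
  let ?H = "hausdorff_measure (CARD('n) - 1) :: (real^'n) measure"
  have fr: "frontier \<Omega> \<in> sets ?H" by (simp add: sets_hausdorff_measure frontier_closed)
  have spb: "space (boundary_measure \<Omega>) = frontier \<Omega>" by (simp add: boundary_measure_def space_restrict_space space_hausdorff_measure)
  have "emeasure (boundary_measure \<Omega>) (frontier \<Omega>) = emeasure ?H (frontier \<Omega>)"
    unfolding boundary_measure_def using fr by (intro emeasure_restrict_space) (auto simp: space_hausdorff_measure)
  also have "\<dots> = hausdorff_outer (CARD('n) - 1) (frontier \<Omega>)"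
    using n by (intro emeasure_hausdorff_measure) (auto simp: frontier_closed)
  also have "\<dots> < top" by (rule hausdorff_outer_polyhedral_boundary_finite[OF \<Omega>(2) n])
  finally have fin: "finite_measure (boundary_measure \<Omega>)" by (intro finite_measureI) (simp add: spb less_top)
  have "\<phi> \<in> borel_measurable ?H" 
    using borel_measurable_continuous_onI[OF \<phi>] by (simp only: measurable_cong_sets[OF sets_hausdorff_measure refl])
  then have \<phi>m: "\<phi> \<in> borel_measurable (boundary_measure \<Omega>)"
    unfolding boundary_measure_def by (rule measurable_restrict_space1)
  have "compact (\<phi> ` frontier \<Omega>)"
    using \<Omega>(1) \<phi> by (meson compact_continuous_image compact_frontier_bounded continuous_on_subset subset_UNIV)
  then have "bounded (\<phi> ` frontier \<Omega>)" by (rule compact_imp_bounded)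
  then obtain B where B: "\<And>x. x \<in> frontier \<Omega> \<Longrightarrow> norm (\<phi> x) \<le> B"
    unfolding bounded_iff by auto
  have "integrable (boundary_measure \<Omega>) (\<lambda>x. (norm (\<phi> x))\<^sup>2)"
  proof (rule finite_measure.integrable_const_bound[OF fin])
    show "AE x in boundary_measure \<Omega>. norm ((norm (\<phi> x))\<^sup>2) \<le> B\<^sup>2"
      using B by (intro AE_I2) (auto simp: spb intro!: power_mono)
  qed (use \<phi>m in simp)
  then show ?thesis using \<phi>m by (simp add: L2_def)
qed

text \<open>The mesh \<open>\<epsilon> / (4 * CARD('n))\<close> keeps the support within \<open>\<epsilon> / 2\<close> of the points with distance
  more than \<open>\<epsilon>\<close> from the boundary, and a ball that avoids the boundary does not leave \<open>\<Omega>\<close>.\<close>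

lemma ex_strip_cutoff:
  fixes \<Omega> :: "(real^'n) set"
  assumes \<Omega>: "open \<Omega>" "bounded \<Omega>" "frontier \<Omega> \<noteq> {}"
  obtains M where "0 \<le> M" and "\<And>\<epsilon>. 0 < \<epsilon> \<Longrightarrow> \<exists>\<zeta>. test_function \<Omega> \<zeta> \<and> (\<forall>x. 0 \<le> \<zeta> x \<and> \<zeta> x \<le> 1) \<and>
     (\<forall>x\<in>\<Omega> - strip \<Omega> \<epsilon>. \<zeta> x = 1 \<and> (\<forall>v. frechet_derivative \<zeta> (at x) v = 0)) \<and>
     (\<forall>x v. \<bar>frechet_derivative \<zeta> (at x) v\<bar> \<le> M / \<epsilon> * norm v)"
proof -
  obtain M where M: "0 \<le> M" and cut: "\<And>\<epsilon>. \<And>K::(real^'n) set. 0 < \<epsilon> \<Longrightarrow> bounded K \<Longrightarrow>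
      \<exists>\<zeta>. smooth \<zeta> \<and> (\<forall>x. 0 \<le> \<zeta> x \<and> \<zeta> x \<le> 1) \<and> (\<forall>x\<in>K. \<zeta> x = 1) \<and>
        (\<forall>x. \<zeta> x \<noteq> 0 \<longrightarrow> (\<exists>y\<in>K. dist x y \<le> 2 * real CARD('n) * \<epsilon>)) \<and>
        (\<forall>x v. \<bar>frechet_derivative \<zeta> (at x) v\<bar> \<le> M / \<epsilon> * norm v)"
    by (rule ex_smooth_cutoff, rule that)
  have "\<exists>\<zeta>. test_function \<Omega> \<zeta> \<and> (\<forall>x. 0 \<le> \<zeta> x \<and> \<zeta> x \<le> 1) \<and>
     (\<forall>x\<in>\<Omega> - strip \<Omega> \<epsilon>. \<zeta> x = 1 \<and> (\<forall>v. frechet_derivative \<zeta> (at x) v = 0)) \<and>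
     (\<forall>x v. \<bar>frechet_derivative \<zeta> (at x) v\<bar> \<le> (4 * real CARD('n) * M) / \<epsilon> * norm v)" if \<epsilon>: "0 < \<epsilon>" for \<epsilon>
  proof -
    define \<mu> where "\<mu> = \<epsilon> / (4 * real CARD('n))"
    have \<mu>: "0 < \<mu>" "2 * real CARD('n) * \<mu> = \<epsilon> / 2" using \<epsilon> by (auto simp: \<mu>_def)
    have bK: "bounded (\<Omega> - strip \<Omega> \<epsilon>)" using \<Omega>(2) by (rule bounded_subset) blast
    obtain \<zeta> where \<zeta>: "smooth \<zeta>" "\<And>x. 0 \<le> \<zeta> x \<and> \<zeta> x \<le> 1" "\<And>x. x \<in> \<Omega> - strip \<Omega> \<epsilon> \<Longrightarrow> \<zeta> x = 1"
      "\<And>x. \<zeta> x \<noteq> 0 \<Longrightarrow> \<exists>y\<in>\<Omega> - strip \<Omega> \<epsilon>. dist x y \<le> \<epsilon> / 2"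
      "\<And>x v. \<bar>frechet_derivative \<zeta> (at x) v\<bar> \<le> M / \<mu> * norm v"
      using cut[OF \<mu>(1) bK] unfolding \<mu>(2) by auto
    have sub: "closure {x. \<zeta> x \<noteq> 0} \<subseteq> \<Omega>"
    proof
      fix x assume "x \<in> closure {x. \<zeta> x \<noteq> 0}"
      then obtain z where z: "\<zeta> z \<noteq> 0" "dist z x < \<epsilon> / 2"
        using \<epsilon> closure_approachable[of x "{x. \<zeta> x \<noteq> 0}"] by (metis half_gt_zero mem_Collect_eq)
      obtain y where y: "y \<in> \<Omega>" "y \<notin> strip \<Omega> \<epsilon>" "dist z y \<le> \<epsilon> / 2" using \<zeta>(4)[OF z(1)] by auto
      have yx: "dist y x < \<epsilon>" using dist_triangle[of y x z] z(2) y(3) by (simp add: dist_commute)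
      have far: "\<epsilon> < infdist y (frontier \<Omega>)" using y by (auto simp: strip_def)
      have "ball y \<epsilon> \<inter> frontier \<Omega> = {}"
        using far infdist_le[of _ "frontier \<Omega>" y] by fastforce
      moreover have "connected (ball y \<epsilon>)" by (simp add: convex_connected)
      moreover have "ball y \<epsilon> \<inter> \<Omega> \<noteq> {}" using y(1) \<epsilon> by (metis IntI centre_in_ball empty_iff)
      ultimately have "ball y \<epsilon> - \<Omega> = {}" using connected_Int_frontier by metis
      then show "x \<in> \<Omega>" using yx by auto
    qed
    have cpt: "compact (closure {x. \<zeta> x \<noteq> 0})"
      using bounded_subset[OF \<Omega>(2) sub] by (simp add: compact_eq_bounded_closed)
    have D0: "frechet_derivative \<zeta> (at x) v = 0" if "x \<in> \<Omega> - strip \<Omega> \<epsilon>" for x v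
      using differential_zero_at_max[OF \<zeta>(1), of x] \<zeta>(2) \<zeta>(3)[OF that] by simp
    have "M / \<mu> = (4 * real CARD('n) * M) / \<epsilon>" by (simp add: \<mu>_def)
    then show ?thesis using \<zeta> sub cpt D0 by (intro exI[of _ \<zeta>]) (auto simp: test_function_def)
  qed
  then show thesis using that[of "4 * real CARD('n) * M"] M by simp
qed

lemma sum_squares_le_square_sum:
  fixes a :: "'i \<Rightarrow> real"
  assumes "finite I" "\<And>i. i \<in> I \<Longrightarrow> 0 \<le> a i" shows "(\<Sum>i\<in>I. (a i)\<^sup>2) \<le> (\<Sum>i\<in>I. a i)\<^sup>2"
proof -
  have "sqrt (\<Sum>i\<in>I. (a i)\<^sup>2) \<le> (\<Sum>i\<in>I. a i)"
    using L2_set_le_sum[of I a] assms by (simp add: L2_set_def)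
  then have "(sqrt (\<Sum>i\<in>I. (a i)\<^sup>2))\<^sup>2 \<le> (\<Sum>i\<in>I. a i)\<^sup>2" by (intro power_mono) (auto intro: sum_nonneg)
  then show ?thesis by (simp add: sum_nonneg)
qed

text \<open>The analogue of \<open>test_function\<close> for vector values.\<close>

definition test_field :: "'a::euclidean_space set \<Rightarrow> ('a \<Rightarrow> 'b::euclidean_space) \<Rightarrow> bool" where
  "test_field \<Omega> \<psi> \<longleftrightarrow> smooth \<psi> \<and> compact (closure {x. \<psi> x \<noteq> 0}) \<and> closure {x. \<psi> x \<noteq> 0} \<subseteq> \<Omega>"

text \<open>The closure of the test fields in \<open>H\<^sup>1\<close>.\<close>

definition test_approximable :: "(real^'n) set \<Rightarrow> (real^'n \<Rightarrow> 'b::euclidean_space) \<Rightarrow> bool" where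
  "test_approximable \<Omega> u \<longleftrightarrow> H1 \<Omega> u \<and> (\<forall>\<eta>>0. \<exists>\<psi>. test_field \<Omega> \<psi> \<and>
     l2_norm (lebesgue_on \<Omega>) (\<lambda>x. \<psi> x - u x) < \<eta> \<and>
     (\<forall>j. l2_norm (lebesgue_on \<Omega>) (\<lambda>x. frechet_derivative \<psi> (at x) (axis j 1) - wderiv \<Omega> j u x) < \<eta>))"

text \<open>Multiply the smooth functions that approximate \<open>u\<close> by cutoffs. The gradient of the cutoff is of
  order \<open>1 / \<epsilon>\<close>, but lives on the strip of width \<open>\<epsilon>\<close>, where by \<open>strip_estimate\<close> the \<open>L\<^sup>2\<close> norm of an
  approximating function is, up to its boundary values, of order \<open>\<epsilon>\<close> times the norm of its gradient in
  a strip that is wider by a fixed factor.\<close>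

lemma H10_test_approximable:
  fixes \<Omega> :: "(real^'n) set" and u :: "real^'n \<Rightarrow> 'b::euclidean_space"
  assumes dom: "polyhedral_lipschitz_domain \<Omega>" and n: "CARD('n) \<ge> 2" and u: "H10 \<Omega> u"
  shows "test_approximable \<Omega> u"
  unfolding test_approximable_def
proof (intro conjI allI impI)
  show H1u: "H1 \<Omega> u" using u by (simp add: H10_def)
  fix \<eta> :: real assume \<eta>: "0 < \<eta>"
  have \<Omega>: "open \<Omega>" "bounded \<Omega>" "\<Omega> \<noteq> {}" and poly: "polyhedral_boundary \<Omega>" and lip: "lipschitz_boundary \<Omega>"
    using dom by (auto simp: polyhedral_lipschitz_domain_def)
  have "\<Omega> \<noteq> UNIV" using \<Omega>(2) not_bounded_UNIV by metis
  then have ne: "frontier \<Omega> \<noteq> {}" using \<Omega>(3) frontier_not_empty by blast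
  have \<Omega>s: "\<Omega> \<in> sets lebesgue" using \<Omega>(1) by (simp add: sets_completionI_sets)
  let ?M = "lebesgue_on \<Omega>"
  let ?N = "l2_norm ?M"
  define g where "g j = wderiv \<Omega> j u" for j
  have uL: "L2 ?M u" using H1u by (simp add: H1_def)
  have gL: "L2 ?M (g j)" for j unfolding g_def by (rule H1_wderiv_L2[OF \<Omega>(1) H1u])
  obtain \<phi> :: "nat \<Rightarrow> real^'n \<Rightarrow> 'b" where sm: "\<And>n. smooth (\<phi> n)"
    and lim1: "(\<lambda>n. h1_norm \<Omega> (\<lambda>x. \<phi> n x - u x)) \<longlonglongrightarrow> 0"
    and lim2: "(\<lambda>n. l2_norm (boundary_measure \<Omega>) (\<lambda>x. \<phi> n x - 0)) \<longlonglongrightarrow> 0"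
    using u unfolding H10_def has_trace_def by blast
  define D where "D n j x = frechet_derivative (\<phi> n) (at x) (axis j 1)" for n j x
  have \<phi>L: "L2 ?M (\<phi> n)" for n by (rule continuous_L2_bounded[OF smooth_continuous_on[OF sm] \<Omega>(2) \<Omega>s])
  have DL: "L2 ?M (D n j)" for n j
    unfolding D_def by (rule continuous_L2_bounded[OF smooth_continuous_on[OF smooth_frechet_derivative[OF sm]] \<Omega>(2) \<Omega>s])
  define \<alpha>0 where "\<alpha>0 n = ?N (\<lambda>x. \<phi> n x - u x)" for n
  define \<alpha> where "\<alpha> n j = ?N (\<lambda>x. D n j x - g j x)" for n j
  define \<beta> where "\<beta> n = l2_norm (boundary_measure \<Omega>) (\<phi> n)" for n
  have \<beta>lim: "\<beta> \<longlonglongrightarrow> 0" using lim2 by (simp add: \<beta>_def[abs_def])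
  have h1: "h1_norm \<Omega> (\<lambda>x. \<phi> n x - u x) = sqrt ((\<alpha>0 n)\<^sup>2 + (\<Sum>j\<in>UNIV. (\<alpha> n j)\<^sup>2))" for n
    unfolding h1_norm_def \<alpha>0_def \<alpha>_def D_def g_def l2_norm_wderiv_smooth_diff[OF \<Omega>(1,2) sm H1u] ..
  have \<alpha>0le: "\<alpha>0 n \<le> h1_norm \<Omega> (\<lambda>x. \<phi> n x - u x)" for n
    unfolding h1 by (rule real_le_rsqrt) (simp add: sum_nonneg)
  have \<alpha>le: "\<alpha> n j \<le> h1_norm \<Omega> (\<lambda>x. \<phi> n x - u x)" for n j
  proof -
    have "(\<alpha> n j)\<^sup>2 \<le> (\<Sum>j\<in>UNIV. (\<alpha> n j)\<^sup>2)" by (rule member_le_sum) auto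
    then have "(\<alpha> n j)\<^sup>2 \<le> (\<alpha>0 n)\<^sup>2 + (\<Sum>j\<in>UNIV. (\<alpha> n j)\<^sup>2)" using zero_le_power2[of "\<alpha>0 n"] by linarith
    then show ?thesis unfolding h1 by (rule real_le_rsqrt)
  qed
  have \<alpha>0lim: "\<alpha>0 \<longlonglongrightarrow> 0"
    by (rule tendsto_sandwich[OF _ _ tendsto_const lim1]) (use \<alpha>0le in \<open>auto simp: \<alpha>0_def l2_norm_nonneg\<close>)
  have \<alpha>lim: "(\<lambda>n. \<alpha> n j) \<longlonglongrightarrow> 0" for j
    by (rule tendsto_sandwich[OF _ _ tendsto_const lim1]) (use \<alpha>le in \<open>auto simp: \<alpha>_def l2_norm_nonneg\<close>)
  obtain C K \<epsilon>0 :: real where C: "0 \<le> C" and K: "1 \<le> K" and \<epsilon>0: "0 < \<epsilon>0"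
    and strip: "\<And>\<epsilon>. 0 < \<epsilon> \<Longrightarrow> \<epsilon> \<le> \<epsilon>0 \<Longrightarrow> \<exists>c\<ge>0. \<forall>\<phi>::real^'n \<Rightarrow> 'b. smooth \<phi> \<longrightarrow>
      (\<integral>\<^sup>+x. ennreal ((norm (\<phi> x))\<^sup>2) * indicator (strip \<Omega> \<epsilon>) x \<partial>lborel)
      \<le> ennreal c * (\<integral>\<^sup>+x. ennreal ((norm (\<phi> x))\<^sup>2) \<partial>boundary_measure \<Omega>)
        + ennreal (C * \<epsilon>\<^sup>2) * (\<Sum>j\<in>UNIV. \<integral>\<^sup>+x. ennreal ((norm (frechet_derivative \<phi> (at x) (axis j 1)))\<^sup>2) * indicator (strip \<Omega> (K * \<epsilon>)) x \<partial>lborel)"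
    by (rule strip_estimate[OF \<Omega> lip n], rule that)
  obtain M where M: "0 \<le> M" and cutoff: "\<And>\<epsilon>. 0 < \<epsilon> \<Longrightarrow> \<exists>\<zeta>. test_function \<Omega> \<zeta> \<and> (\<forall>x. 0 \<le> \<zeta> x \<and> \<zeta> x \<le> 1) \<and>
     (\<forall>x\<in>\<Omega> - strip \<Omega> \<epsilon>. \<zeta> x = 1 \<and> (\<forall>v. frechet_derivative \<zeta> (at x) v = 0)) \<and>
     (\<forall>x v. \<bar>frechet_derivative \<zeta> (at x) v\<bar> \<le> M / \<epsilon> * norm v)"
    by (rule ex_strip_cutoff[OF \<Omega>(1,2) ne], rule that)
  let ?I = "\<lambda>\<epsilon> f x. indicator (strip \<Omega> \<epsilon>) x *\<^sub>R f x"
  have Im: "(\<lambda>x. indicator (strip \<Omega> \<epsilon>) x :: real) \<in> borel_measurable ?M" for \<epsilon>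
    by (intro borel_measurable_lebesgue_on borel_measurable_indicator strip_borel \<Omega>)
  have IL: "L2 ?M (?I \<epsilon> f)" if "L2 ?M f" for \<epsilon> and f :: "real^'n \<Rightarrow> 'b"
    by (rule L2_mult_bounded[OF that Im, where B=1]) (auto simp: indicator_def)
  have strip\<Omega>: "strip \<Omega> \<epsilon> \<subseteq> \<Omega>" for \<epsilon> by (auto simp: strip_def)
  note convert = nn_integral_lborel_indicator_eq_l2_norm[OF _ strip_borel[OF \<Omega>(1)] strip\<Omega> \<Omega>s]
  have stripN: "\<exists>c\<ge>0. \<forall>n. ?N (?I \<epsilon> (\<phi> n)) \<le> c * \<beta> n + sqrt C * \<epsilon> * (\<Sum>i\<in>UNIV. \<alpha> n i + ?N (?I (K * \<epsilon>) (g i)))"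
    if \<epsilon>: "0 < \<epsilon>" "\<epsilon> \<le> \<epsilon>0" for \<epsilon>
  proof -
    obtain c where c: "0 \<le> c" and le: "\<And>\<phi>::real^'n \<Rightarrow> 'b. smooth \<phi> \<Longrightarrow>
      (\<integral>\<^sup>+x. ennreal ((norm (\<phi> x))\<^sup>2) * indicator (strip \<Omega> \<epsilon>) x \<partial>lborel)
      \<le> ennreal c * (\<integral>\<^sup>+x. ennreal ((norm (\<phi> x))\<^sup>2) \<partial>boundary_measure \<Omega>)
        + ennreal (C * \<epsilon>\<^sup>2) * (\<Sum>j\<in>UNIV. \<integral>\<^sup>+x. ennreal ((norm (frechet_derivative \<phi> (at x) (axis j 1)))\<^sup>2) * indicator (strip \<Omega> (K * \<epsilon>)) x \<partial>lborel)"
      using strip[OF \<epsilon>] by blast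
    have "?N (?I \<epsilon> (\<phi> n)) \<le> sqrt c * \<beta> n + sqrt C * \<epsilon> * (\<Sum>i\<in>UNIV. \<alpha> n i + ?N (?I (K * \<epsilon>) (g i)))" for n
    proof -
      define a where "a i = ?N (?I (K * \<epsilon>) (D n i))" for i
      have a0: "0 \<le> a i" for i by (simp add: a_def l2_norm_nonneg)
      have \<beta>0: "0 \<le> \<beta> n" by (simp add: \<beta>_def l2_norm_nonneg)
      have bd: "(\<integral>\<^sup>+x. ennreal ((norm (\<phi> n x))\<^sup>2) \<partial>boundary_measure \<Omega>) = ennreal ((\<beta> n)\<^sup>2)"
        unfolding \<beta>_def by (rule nn_integral_eq_l2_norm_squared[OF boundary_measure_smooth_L2[OF \<Omega>(2) poly n smooth_continuous_on[OF sm]]])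
      have "ennreal ((?N (?I \<epsilon> (\<phi> n)))\<^sup>2) \<le> ennreal c * ennreal ((\<beta> n)\<^sup>2) + ennreal (C * \<epsilon>\<^sup>2) * (\<Sum>j\<in>UNIV. ennreal ((a j)\<^sup>2))"
        using le[OF sm[of n]] unfolding D_def[symmetric] convert[OF \<phi>L] convert[OF DL] bd a_def .
      also have "\<dots> = ennreal (c * (\<beta> n)\<^sup>2 + C * \<epsilon>\<^sup>2 * (\<Sum>j\<in>UNIV. (a j)\<^sup>2))"
        using c C by (simp add: ennreal_mult' ennreal_plus sum_nonneg sum_ennreal)
      finally have "(?N (?I \<epsilon> (\<phi> n)))\<^sup>2 \<le> c * (\<beta> n)\<^sup>2 + C * \<epsilon>\<^sup>2 * (\<Sum>j\<in>UNIV. (a j)\<^sup>2)"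
        using c C by (subst (asm) ennreal_le_iff) (auto intro!: add_nonneg_nonneg mult_nonneg_nonneg sum_nonneg)
      also have "\<dots> \<le> (sqrt c * \<beta> n)\<^sup>2 + (sqrt C * \<epsilon> * (\<Sum>j\<in>UNIV. a j))\<^sup>2"
      proof -
        have "(\<Sum>j\<in>UNIV. (a j)\<^sup>2) \<le> (\<Sum>j\<in>UNIV. a j)\<^sup>2" using a0 by (intro sum_squares_le_square_sum) auto
        then have "C * \<epsilon>\<^sup>2 * (\<Sum>j\<in>UNIV. (a j)\<^sup>2) \<le> C * \<epsilon>\<^sup>2 * (\<Sum>j\<in>UNIV. a j)\<^sup>2" using C by (intro mult_left_mono) auto
        then show ?thesis using c C by (simp add: power_mult_distrib)
      qed
      also have "\<dots> \<le> (sqrt c * \<beta> n + sqrt C * \<epsilon> * (\<Sum>j\<in>UNIV. a j))\<^sup>2"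
      proof -
        have "0 \<le> 2 * (sqrt c * \<beta> n) * (sqrt C * \<epsilon> * (\<Sum>j\<in>UNIV. a j))"
          using c C \<beta>0 \<epsilon> a0 by (intro mult_nonneg_nonneg sum_nonneg) auto
        then show ?thesis unfolding power2_sum by linarith
      qed
      finally have "?N (?I \<epsilon> (\<phi> n)) \<le> sqrt c * \<beta> n + sqrt C * \<epsilon> * (\<Sum>j\<in>UNIV. a j)"
        by (rule power2_le_imp_le) (use c C \<beta>0 \<epsilon> a0 in \<open>auto intro!: add_nonneg_nonneg mult_nonneg_nonneg sum_nonneg\<close>)
      also have "\<dots> \<le> sqrt c * \<beta> n + sqrt C * \<epsilon> * (\<Sum>i\<in>UNIV. \<alpha> n i + ?N (?I (K * \<epsilon>) (g i)))"
      proof (intro add_left_mono mult_left_mono sum_mono)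
        fix i :: 'n
        have "a i \<le> ?N (?I (K * \<epsilon>) (g i)) + ?N (\<lambda>x. ?I (K * \<epsilon>) (D n i) x - ?I (K * \<epsilon>) (g i) x)"
          unfolding a_def by (rule l2_norm_le_add_diff[OF IL[OF DL] IL[OF gL]])
        also have "?N (\<lambda>x. ?I (K * \<epsilon>) (D n i) x - ?I (K * \<epsilon>) (g i) x) \<le> 1 * \<alpha> n i"
          unfolding \<alpha>_def
          by (rule l2_norm_bound[OF L2_diff[OF DL gL] L2_measurable[OF L2_diff[OF IL[OF DL] IL[OF gL]]]])
             (auto simp: indicator_def)
        finally show "a i \<le> \<alpha> n i + ?N (?I (K * \<epsilon>) (g i))" by simp
      qed (use C \<epsilon> in auto)
      finally show ?thesis .
    qed
    then show ?thesis using c by (intro exI[of _ "sqrt c"]) auto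
  qed
  \<comment> \<open>The part of the error that does not depend on the approximating function is small for thin strips.\<close>
  define s where "s m = \<epsilon>0 / real (Suc m)" for m
  have s: "0 < s m" "s m \<le> \<epsilon>0" for m using \<epsilon>0 by (auto simp: s_def field_simps)
  have s0: "s \<longlonglongrightarrow> 0"
    using tendsto_mult_left[OF LIMSEQ_Suc[OF lim_1_over_n[where 'a=real]], of \<epsilon>0] by (simp add: s_def[abs_def])
  have Ks0: "(\<lambda>m. K * s m) \<longlonglongrightarrow> 0" using tendsto_mult_left[OF s0, of K] by simp
  have tail0: "(\<lambda>m. ?N (?I (s m) u)) \<longlonglongrightarrow> 0" by (rule l2_norm_strip_tendsto_0[OF \<Omega>(1) ne uL s0])
  have tail: "(\<lambda>m. ?N (?I (s m) (g j)) + M * sqrt C * (\<Sum>i\<in>UNIV. ?N (?I (K * s m) (g i)))) \<longlonglongrightarrow> 0" for j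
  proof -
    have "(\<lambda>m. ?N (?I (s m) (g j)) + M * sqrt C * (\<Sum>i\<in>UNIV. ?N (?I (K * s m) (g i)))) \<longlonglongrightarrow> 0 + M * sqrt C * (\<Sum>i\<in>(UNIV::'n set). 0)"
      by (intro tendsto_add tendsto_mult_left tendsto_sum l2_norm_strip_tendsto_0[OF \<Omega>(1) ne gL] s0 Ks0)
    then show ?thesis by simp
  qed
  have "\<forall>\<^sub>F m in sequentially. ?N (?I (s m) u) < \<eta> / 2 \<and>
      (\<forall>j. ?N (?I (s m) (g j)) + M * sqrt C * (\<Sum>i\<in>UNIV. ?N (?I (K * s m) (g i))) < \<eta> / 2)"
    using \<eta> by (intro eventually_conj eventually_all_finite order_tendstoD(2)[OF tail0] order_tendstoD(2)[OF tail]) auto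
  then obtain m where m: "?N (?I (s m) u) < \<eta> / 2"
      "\<And>j. ?N (?I (s m) (g j)) + M * sqrt C * (\<Sum>i\<in>UNIV. ?N (?I (K * s m) (g i))) < \<eta> / 2"
    by (auto simp: eventually_sequentially)
  define \<epsilon> where "\<epsilon> = s m"
  have \<epsilon>: "0 < \<epsilon>" "\<epsilon> \<le> \<epsilon>0" using s by (auto simp: \<epsilon>_def)
  obtain c where c: "0 \<le> c" and cle: "\<And>n. ?N (?I \<epsilon> (\<phi> n)) \<le> c * \<beta> n + sqrt C * \<epsilon> * (\<Sum>i\<in>UNIV. \<alpha> n i + ?N (?I (K * \<epsilon>) (g i)))"
    using stripN[OF \<epsilon>] by blast
  have head: "(\<lambda>n. \<alpha> n j + M / \<epsilon> * (c * \<beta> n) + M * sqrt C * (\<Sum>i\<in>UNIV. \<alpha> n i)) \<longlonglongrightarrow> 0" for j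
  proof -
    have "(\<lambda>n. \<alpha> n j + M / \<epsilon> * (c * \<beta> n) + M * sqrt C * (\<Sum>i\<in>UNIV. \<alpha> n i)) \<longlonglongrightarrow> 0 + M / \<epsilon> * (c * 0) + M * sqrt C * (\<Sum>i\<in>(UNIV::'n set). 0)"
      by (intro tendsto_add tendsto_mult_left tendsto_sum \<alpha>lim \<beta>lim)
    then show ?thesis by simp
  qed
  have "\<forall>\<^sub>F n in sequentially. \<alpha>0 n < \<eta> / 2 \<and>
      (\<forall>j. \<alpha> n j + M / \<epsilon> * (c * \<beta> n) + M * sqrt C * (\<Sum>i\<in>UNIV. \<alpha> n i) < \<eta> / 2)"
    using \<eta> by (intro eventually_conj eventually_all_finite order_tendstoD(2)[OF \<alpha>0lim] order_tendstoD(2)[OF head]) auto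
  then obtain n where n': "\<alpha>0 n < \<eta> / 2"
      "\<And>j. \<alpha> n j + M / \<epsilon> * (c * \<beta> n) + M * sqrt C * (\<Sum>i\<in>UNIV. \<alpha> n i) < \<eta> / 2"
    by (auto simp: eventually_sequentially)
  obtain \<zeta> where \<zeta>: "smooth \<zeta>" "\<And>x. 0 \<le> \<zeta> x \<and> \<zeta> x \<le> 1" "compact (closure {x. \<zeta> x \<noteq> 0})" "closure {x. \<zeta> x \<noteq> 0} \<subseteq> \<Omega>"
     "\<And>x. x \<in> \<Omega> - strip \<Omega> \<epsilon> \<Longrightarrow> \<zeta> x = 1 \<and> (\<forall>v. frechet_derivative \<zeta> (at x) v = 0)"
     "\<And>x v. \<bar>frechet_derivative \<zeta> (at x) v\<bar> \<le> M / \<epsilon> * norm v"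
    using cutoff[OF \<epsilon>(1)] unfolding test_function_def by blast
  have \<zeta>m: "\<zeta> \<in> borel_measurable ?M" and D\<zeta>m: "(\<lambda>x. frechet_derivative \<zeta> (at x) v) \<in> borel_measurable ?M" for v
    by (intro borel_measurable_lebesgue_on borel_measurable_continuous_onI smooth_continuous_on smooth_frechet_derivative \<zeta>(1))+
  define \<psi> where "\<psi> x = \<zeta> x *\<^sub>R \<phi> n x" for x
  have sm\<psi>: "smooth \<psi>" unfolding \<psi>_def[abs_def] by (rule smooth_scaleR[OF \<zeta>(1) sm])
  have sub: "closure {x. \<psi> x \<noteq> 0} \<subseteq> closure {x. \<zeta> x \<noteq> 0}" by (rule closure_mono) (auto simp: \<psi>_def)
  have cpt: "compact (closure {x. \<psi> x \<noteq> 0})"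
    using \<zeta>(3) sub by (meson bounded_subset closed_closure compact_eq_bounded_closed)
  have D\<psi>: "frechet_derivative \<psi> (at x) (axis j 1) = \<zeta> x *\<^sub>R D n j x + frechet_derivative \<zeta> (at x) (axis j 1) *\<^sub>R \<phi> n x" for x j
    using frechet_derivative_at[OF has_derivative_scaleR[OF smooth_has_derivative[OF \<zeta>(1), of x] smooth_has_derivative[OF sm[of n], of x]]]
    unfolding D_def \<psi>_def[abs_def] by metis
  have cutL: "L2 ?M (\<lambda>x. (1 - \<zeta> x) *\<^sub>R f x)" and cutN: "?N (\<lambda>x. (1 - \<zeta> x) *\<^sub>R f x) \<le> ?N (?I \<epsilon> f)" if f: "L2 ?M f" for f :: "real^'n \<Rightarrow> 'b"
  proof -
    show L: "L2 ?M (\<lambda>x. (1 - \<zeta> x) *\<^sub>R f x)"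
    proof (rule L2_mult_bounded[OF f, where B=1])
      show "\<bar>1 - \<zeta> x\<bar> \<le> 1" for x using \<zeta>(2)[of x] by linarith
    qed (use \<zeta>m in simp)
    have "?N (\<lambda>x. (1 - \<zeta> x) *\<^sub>R f x) \<le> 1 * ?N (?I \<epsilon> f)"
    proof (rule l2_norm_bound[OF IL[OF f] L2_measurable[OF L]], rule AE_I2)
      fix x assume "x \<in> space ?M"
      then show "norm ((1 - \<zeta> x) *\<^sub>R f x) \<le> 1 * norm (?I \<epsilon> f x)"
        using \<zeta>(2)[of x] \<zeta>(5)[of x] by (cases "x \<in> strip \<Omega> \<epsilon>") (auto intro!: mult_left_le_one_le)
    qed simp
    then show "?N (\<lambda>x. (1 - \<zeta> x) *\<^sub>R f x) \<le> ?N (?I \<epsilon> f)" by simp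
  qed
  have mulL: "L2 ?M (\<lambda>x. \<zeta> x *\<^sub>R f x)" and mulN: "?N (\<lambda>x. \<zeta> x *\<^sub>R f x) \<le> ?N f" if f: "L2 ?M f" for f :: "real^'n \<Rightarrow> 'b"
  proof -
    show L: "L2 ?M (\<lambda>x. \<zeta> x *\<^sub>R f x)"
      by (rule L2_mult_bounded[OF f \<zeta>m, where B=1]) (use \<zeta>(2) in auto)
    have "?N (\<lambda>x. \<zeta> x *\<^sub>R f x) \<le> 1 * ?N f"
      by (rule l2_norm_bound[OF f L2_measurable[OF L]]) (use \<zeta>(2) in \<open>auto intro!: mult_left_le_one_le\<close>)
    then show "?N (\<lambda>x. \<zeta> x *\<^sub>R f x) \<le> ?N f" by simp
  qed
  have "test_field \<Omega> \<psi>"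
    using sm\<psi> cpt order_trans[OF sub \<zeta>(4)] by (simp add: test_field_def)
  moreover have "?N (\<lambda>x. \<psi> x - u x) < \<eta>"
  proof -
    have "(\<lambda>x. \<psi> x - u x) = (\<lambda>x. \<zeta> x *\<^sub>R (\<phi> n x - u x) - (1 - \<zeta> x) *\<^sub>R u x)"
      by (auto simp: \<psi>_def algebra_simps)
    then have "?N (\<lambda>x. \<psi> x - u x) \<le> ?N (\<lambda>x. \<zeta> x *\<^sub>R (\<phi> n x - u x)) + ?N (\<lambda>x. (1 - \<zeta> x) *\<^sub>R u x)"
      using l2_norm_diff_triangle[OF mulL[OF L2_diff[OF \<phi>L uL]] cutL[OF uL]] by simp
    also have "\<dots> \<le> \<alpha>0 n + ?N (?I \<epsilon> u)"
      unfolding \<alpha>0_def by (intro add_mono mulN cutN L2_diff \<phi>L uL)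
    also have "\<dots> < \<eta>" using n'(1) m(1) by (simp add: \<epsilon>_def)
    finally show ?thesis .
  qed
  moreover have "?N (\<lambda>x. frechet_derivative \<psi> (at x) (axis j 1) - wderiv \<Omega> j u x) < \<eta>" for j
  proof -
    have L3: "L2 ?M (\<lambda>x. frechet_derivative \<zeta> (at x) (axis j 1) *\<^sub>R \<phi> n x)"
      by (rule L2_mult_bounded[OF \<phi>L D\<zeta>m, where B="M / \<epsilon>"]) (use \<zeta>(6)[of _ "axis j 1"] in simp)
    have "?N (\<lambda>x. frechet_derivative \<zeta> (at x) (axis j 1) *\<^sub>R \<phi> n x) \<le> M / \<epsilon> * ?N (?I \<epsilon> (\<phi> n))"
    proof (rule l2_norm_bound[OF IL[OF \<phi>L] L2_measurable[OF L3]], rule AE_I2)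
      fix x assume "x \<in> space ?M"
      then show "norm (frechet_derivative \<zeta> (at x) (axis j 1) *\<^sub>R \<phi> n x) \<le> M / \<epsilon> * norm (?I \<epsilon> (\<phi> n) x)"
        using \<zeta>(5)[of x] mult_right_mono[OF \<zeta>(6)[of x "axis j 1"], of "norm (\<phi> n x)"]
        by (cases "x \<in> strip \<Omega> \<epsilon>") auto
    qed (use M \<epsilon> in simp)
    also have "\<dots> \<le> M / \<epsilon> * (c * \<beta> n + sqrt C * \<epsilon> * (\<Sum>i\<in>UNIV. \<alpha> n i + ?N (?I (K * \<epsilon>) (g i))))"
      using M \<epsilon> by (intro mult_left_mono cle) auto
    also have "\<dots> = M / \<epsilon> * (c * \<beta> n) + M * sqrt C * (\<Sum>i\<in>UNIV. \<alpha> n i) + M * sqrt C * (\<Sum>i\<in>UNIV. ?N (?I (K * \<epsilon>) (g i)))"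
      using \<epsilon> by (simp add: sum.distrib distrib_left)
    finally have t3: "?N (\<lambda>x. frechet_derivative \<zeta> (at x) (axis j 1) *\<^sub>R \<phi> n x)
        \<le> M / \<epsilon> * (c * \<beta> n) + M * sqrt C * (\<Sum>i\<in>UNIV. \<alpha> n i) + M * sqrt C * (\<Sum>i\<in>UNIV. ?N (?I (K * \<epsilon>) (g i)))" .
    have "(\<lambda>x. frechet_derivative \<psi> (at x) (axis j 1) - g j x)
        = (\<lambda>x. (\<zeta> x *\<^sub>R (D n j x - g j x) - (1 - \<zeta> x) *\<^sub>R g j x) + frechet_derivative \<zeta> (at x) (axis j 1) *\<^sub>R \<phi> n x)"
      by (auto simp: D\<psi> algebra_simps)
    then have "?N (\<lambda>x. frechet_derivative \<psi> (at x) (axis j 1) - g j x)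
        \<le> ?N (\<lambda>x. \<zeta> x *\<^sub>R (D n j x - g j x) - (1 - \<zeta> x) *\<^sub>R g j x) + ?N (\<lambda>x. frechet_derivative \<zeta> (at x) (axis j 1) *\<^sub>R \<phi> n x)"
      using l2_norm_triangle[OF L2_diff[OF mulL[OF L2_diff[OF DL gL]] cutL[OF gL]] L3] by simp
    also have "?N (\<lambda>x. \<zeta> x *\<^sub>R (D n j x - g j x) - (1 - \<zeta> x) *\<^sub>R g j x)
        \<le> ?N (\<lambda>x. \<zeta> x *\<^sub>R (D n j x - g j x)) + ?N (\<lambda>x. (1 - \<zeta> x) *\<^sub>R g j x)"
      by (rule l2_norm_diff_triangle[OF mulL[OF L2_diff[OF DL gL]] cutL[OF gL]])
    also have "\<dots> \<le> \<alpha> n j + ?N (?I \<epsilon> (g j))"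
      unfolding \<alpha>_def by (intro add_mono mulN cutN L2_diff DL gL)
    finally have "?N (\<lambda>x. frechet_derivative \<psi> (at x) (axis j 1) - g j x)
        \<le> \<alpha> n j + ?N (?I \<epsilon> (g j)) + ?N (\<lambda>x. frechet_derivative \<zeta> (at x) (axis j 1) *\<^sub>R \<phi> n x)" by simp
    also have "\<dots> < \<eta>" using t3 n'(2)[of j] m(2)[of j] unfolding \<epsilon>_def by linarith
    finally show ?thesis unfolding g_def .
  qed
  ultimately show "\<exists>\<psi>. test_field \<Omega> \<psi> \<and> ?N (\<lambda>x. \<psi> x - u x) < \<eta> \<and>
     (\<forall>j. ?N (\<lambda>x. frechet_derivative \<psi> (at x) (axis j 1) - wderiv \<Omega> j u x) < \<eta>)" by blast
qed

section \<open>Poincare inequality and skew-symmetry of convection\<close>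

lemma test_approximable_diff:
  fixes \<Omega> :: "(real^'n) set" and u v :: "real^'n \<Rightarrow> 'b::euclidean_space"
  assumes \<Omega>: "open \<Omega>" "bounded \<Omega>" and u: "test_approximable \<Omega> u" and v: "test_approximable \<Omega> v"
  shows "test_approximable \<Omega> (\<lambda>x. u x - v x)"
  unfolding test_approximable_def
proof (intro conjI allI impI)
  let ?M = "lebesgue_on \<Omega>"
  have \<Omega>s: "\<Omega> \<in> sets lebesgue" using \<Omega>(1) by (simp add: sets_completionI_sets)
  have H: "H1 \<Omega> u" "H1 \<Omega> v" using u v by (auto simp: test_approximable_def)
  show Hd: "H1 \<Omega> (\<lambda>x. u x - v x)" by (rule H1_diff[OF \<Omega>(1) H])
  have uL: "L2 ?M u" "L2 ?M v" using H by (auto simp: H1_def)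
  fix \<eta> :: real assume "0 < \<eta>"
  then have \<eta>: "0 < \<eta> / 2" by simp
  obtain \<psi> where \<psi>: "smooth \<psi>" "compact (closure {x. \<psi> x \<noteq> 0})" "closure {x. \<psi> x \<noteq> 0} \<subseteq> \<Omega>"
     "l2_norm ?M (\<lambda>x. \<psi> x - u x) < \<eta> / 2"
     "\<And>j. l2_norm ?M (\<lambda>x. frechet_derivative \<psi> (at x) (axis j 1) - wderiv \<Omega> j u x) < \<eta> / 2"
    using u \<eta> unfolding test_approximable_def test_field_def by blast
  obtain \<theta> where \<theta>: "smooth \<theta>" "compact (closure {x. \<theta> x \<noteq> 0})" "closure {x. \<theta> x \<noteq> 0} \<subseteq> \<Omega>"
     "l2_norm ?M (\<lambda>x. \<theta> x - v x) < \<eta> / 2"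
     "\<And>j. l2_norm ?M (\<lambda>x. frechet_derivative \<theta> (at x) (axis j 1) - wderiv \<Omega> j v x) < \<eta> / 2"
    using v \<eta> unfolding test_approximable_def test_field_def by blast
  have sub: "closure {x. \<psi> x - \<theta> x \<noteq> 0} \<subseteq> closure {x. \<psi> x \<noteq> 0} \<union> closure {x. \<theta> x \<noteq> 0}"
    unfolding closure_Un[symmetric] by (rule closure_mono) auto
  have cpt: "compact (closure {x. \<psi> x - \<theta> x \<noteq> 0})"
    using compact_Un[OF \<psi>(2) \<theta>(2)] sub by (meson bounded_subset closed_closure compact_eq_bounded_closed)
  have L: "L2 ?M f" if "smooth f" for f :: "real^'n \<Rightarrow> 'b"
    by (rule continuous_L2_bounded[OF smooth_continuous_on[OF that] \<Omega>(2) \<Omega>s])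
  have "l2_norm ?M (\<lambda>x. (\<psi> x - \<theta> x) - (u x - v x)) = l2_norm ?M (\<lambda>x. (\<psi> x - u x) - (\<theta> x - v x))"
    by (simp add: algebra_simps)
  also have "\<dots> < \<eta>"
    using l2_norm_diff_triangle[OF L2_diff[OF L[OF \<psi>(1)] uL(1)] L2_diff[OF L[OF \<theta>(1)] uL(2)]] \<psi>(4) \<theta>(4) by linarith
  finally have n0: "l2_norm ?M (\<lambda>x. (\<psi> x - \<theta> x) - (u x - v x)) < \<eta>" .
  have D: "frechet_derivative (\<lambda>x. \<psi> x - \<theta> x) (at x) w = frechet_derivative \<psi> (at x) w - frechet_derivative \<theta> (at x) w" for x w
    using frechet_derivative_at[OF has_derivative_diff[OF smooth_has_derivative[OF \<psi>(1)] smooth_has_derivative[OF \<theta>(1)]]] by metis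
  have n1: "l2_norm ?M (\<lambda>x. frechet_derivative (\<lambda>x. \<psi> x - \<theta> x) (at x) (axis j 1) - wderiv \<Omega> j (\<lambda>x. u x - v x) x) < \<eta>" for j
  proof -
    let ?D = "\<lambda>f x. frechet_derivative f (at x) (axis j 1)"
    have DL: "L2 ?M (?D \<psi>)" "L2 ?M (?D \<theta>)" by (rule L[OF smooth_frechet_derivative[OF \<psi>(1)]], rule L[OF smooth_frechet_derivative[OF \<theta>(1)]])
    have wL: "L2 ?M (wderiv \<Omega> j u)" "L2 ?M (wderiv \<Omega> j v)" "L2 ?M (wderiv \<Omega> j (\<lambda>x. u x - v x))"
      by (rule H1_wderiv_L2[OF \<Omega>(1) H(1)], rule H1_wderiv_L2[OF \<Omega>(1) H(2)], rule H1_wderiv_L2[OF \<Omega>(1) Hd])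
    have "l2_norm ?M (\<lambda>x. ?D (\<lambda>x. \<psi> x - \<theta> x) x - wderiv \<Omega> j (\<lambda>x. u x - v x) x)
        = l2_norm ?M (\<lambda>x. (?D \<psi> x - wderiv \<Omega> j u x) - (?D \<theta> x - wderiv \<Omega> j v x))"
      unfolding D
    proof (rule l2_norm_cong_AE)
      show "AE x in ?M. norm (?D \<psi> x - ?D \<theta> x - wderiv \<Omega> j (\<lambda>x. u x - v x) x) = norm ((?D \<psi> x - wderiv \<Omega> j u x) - (?D \<theta> x - wderiv \<Omega> j v x))"
        using wderiv_AE_eq[OF \<Omega>(1) has_weak_deriv_diff[where j=j, OF \<Omega>(1) H1_has_weak_deriv[OF H(1)] H1_has_weak_deriv[OF H(2)]]]
      proof eventually_elim
        case (elim x)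
        show ?case unfolding elim by (simp add: algebra_simps)
      qed
    qed (intro L2_measurable L2_diff DL wL)+
    also have "\<dots> < \<eta>"
      using l2_norm_diff_triangle[OF L2_diff[OF DL(1) wL(1)] L2_diff[OF DL(2) wL(2)]] \<psi>(5)[of j] \<theta>(5)[of j] by linarith
    finally show ?thesis .
  qed
  have "test_field \<Omega> (\<lambda>x. \<psi> x - \<theta> x)"
    using smooth_diff[OF \<psi>(1) \<theta>(1)] cpt sub \<psi>(3) \<theta>(3) unfolding test_field_def by blast
  then show "\<exists>\<psi>. test_field \<Omega> \<psi> \<and> l2_norm ?M (\<lambda>x. \<psi> x - (u x - v x)) < \<eta> \<and>
     (\<forall>j. l2_norm ?M (\<lambda>x. frechet_derivative \<psi> (at x) (axis j 1) - wderiv \<Omega> j (\<lambda>x. u x - v x) x) < \<eta>)"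
    using n0 n1 by blast
qed

text \<open>\<open>segment_estimate\<close> with segments of a fixed length \<open>h\<close> that exceeds the diameter of \<open>\<Omega>\<close>: they end
  outside \<open>\<Omega>\<close>, where \<open>\<psi>\<close> vanishes.\<close>

lemma poincare_test:
  fixes \<Omega> :: "(real^'n) set"
  assumes \<Omega>: "open \<Omega>" "bounded \<Omega>"
  obtains c where "0 < c" and "\<And>\<psi>::real^'n \<Rightarrow> 'b::euclidean_space. test_field \<Omega> \<psi> \<Longrightarrow>
     l2_norm (lebesgue_on \<Omega>) \<psi> \<le> c * l2_norm (lebesgue_on \<Omega>) (\<lambda>x. frechet_derivative \<psi> (at x) (axis j 1))"
proof -
  have \<Omega>s: "\<Omega> \<in> sets lebesgue" using \<Omega>(1) by (simp add: sets_completionI_sets)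
  obtain R where R: "0 < R" "\<And>x. x \<in> \<Omega> \<Longrightarrow> norm x \<le> R" using \<Omega>(2) by (auto simp: bounded_pos)
  define h where "h = 3 * R"
  have h: "0 < h" using R by (simp add: h_def)
  let ?M = "lebesgue_on \<Omega>" and ?e = "axis j 1 :: real^'n"
  have e: "norm ?e = 1" by simp
  have "l2_norm ?M \<psi> \<le> sqrt 2 * h * l2_norm ?M (\<lambda>x. frechet_derivative \<psi> (at x) ?e)"
    if \<psi>: "test_field \<Omega> \<psi>" for \<psi> :: "real^'n \<Rightarrow> 'b"
  proof -
    have sm: "smooth \<psi>" and supp: "closure {x. \<psi> x \<noteq> 0} \<subseteq> \<Omega>" using \<psi> by (auto simp: test_field_def)
    let ?D = "\<lambda>x. frechet_derivative \<psi> (at x) ?e"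
    have z: "\<psi> x = 0" if "x \<notin> \<Omega>" for x using that supp closure_subset[of "{x. \<psi> x \<noteq> 0}"] by blast
    have Dz: "?D x = 0" if "x \<notin> \<Omega>" for x
    proof -
      have "x \<notin> closure {x. \<psi> x \<noteq> 0}" using that supp by blast
      from frechet_derivative_zero_outside_support[OF this] show ?thesis by (rule fun_cong)
    qed
    have conv: "(\<integral>\<^sup>+x. ennreal ((norm (f x))\<^sup>2) * indicator \<Omega> x \<partial>lborel) = ennreal ((l2_norm ?M f)\<^sup>2)" if "smooth f" for f :: "real^'n \<Rightarrow> 'b"
    proof -
      have L: "L2 ?M f" by (rule continuous_L2_bounded[OF smooth_continuous_on[OF that] \<Omega>(2) \<Omega>s])
      have "l2_norm ?M (\<lambda>x. indicator \<Omega> x *\<^sub>R f x) = l2_norm ?M f"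
        unfolding l2_norm_def by (intro arg_cong[where f=sqrt] Bochner_Integration.integral_cong) auto
      with nn_integral_lborel_indicator_eq_l2_norm[OF L _ order_refl \<Omega>s] \<Omega>(1) show ?thesis by simp
    qed
    have "ennreal ((l2_norm ?M \<psi>)\<^sup>2) = (\<integral>\<^sup>+x. ennreal ((norm (\<psi> x))\<^sup>2) * indicator \<Omega> x \<partial>lborel)" by (rule conv[OF sm, symmetric])
    also have "\<dots> \<le> 2 * (\<integral>\<^sup>+x. ennreal ((norm (\<psi> (x - h *\<^sub>R ?e)))\<^sup>2) * indicator \<Omega> x \<partial>lborel)
        + ennreal (2 * h\<^sup>2) * (\<integral>\<^sup>+x. ennreal ((norm (?D x))\<^sup>2) * indicator UNIV x \<partial>lborel)"
      using \<Omega>(1) h by (intro segment_estimate[OF sm]) auto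
    also have "(\<integral>\<^sup>+x. ennreal ((norm (\<psi> (x - h *\<^sub>R ?e)))\<^sup>2) * indicator \<Omega> x \<partial>lborel) = nn_integral lborel (\<lambda>x::real^'n. 0)"
    proof (intro nn_integral_cong)
      fix x :: "real^'n"
      have "x - h *\<^sub>R ?e \<notin> \<Omega>" if "x \<in> \<Omega>"
      proof
        assume "x - h *\<^sub>R ?e \<in> \<Omega>"
        then have "norm (x - h *\<^sub>R ?e) \<le> R" by (rule R(2))
        moreover have "norm (h *\<^sub>R ?e) \<le> norm x + norm (x - h *\<^sub>R ?e)"
          using norm_triangle_ineq4[of x "x - h *\<^sub>R ?e"] by simp
        ultimately show False using R(1) R(2)[OF that] h by (simp add: h_def)
      qed
      then show "ennreal ((norm (\<psi> (x - h *\<^sub>R ?e)))\<^sup>2) * indicator \<Omega> x = 0" by (auto simp: indicator_def z)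
    qed
    also have "(\<integral>\<^sup>+x. ennreal ((norm (?D x))\<^sup>2) * indicator UNIV x \<partial>lborel) = (\<integral>\<^sup>+x. ennreal ((norm (?D x))\<^sup>2) * indicator \<Omega> x \<partial>lborel)"
      by (intro nn_integral_cong) (auto simp: indicator_def Dz)
    also have "\<dots> = ennreal ((l2_norm ?M ?D)\<^sup>2)" by (rule conv[OF smooth_frechet_derivative[OF sm]])
    finally have "ennreal ((l2_norm ?M \<psi>)\<^sup>2) \<le> ennreal (2 * h\<^sup>2 * (l2_norm ?M ?D)\<^sup>2)" by (simp add: ennreal_mult')
    then have "(l2_norm ?M \<psi>)\<^sup>2 \<le> 2 * h\<^sup>2 * (l2_norm ?M ?D)\<^sup>2" by (subst (asm) ennreal_le_iff) auto
    also have "\<dots> = (sqrt 2 * h * l2_norm ?M ?D)\<^sup>2" by (simp add: power_mult_distrib)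
    finally show ?thesis by (rule power2_le_imp_le) (use h in \<open>auto intro!: mult_nonneg_nonneg simp: l2_norm_nonneg\<close>)
  qed
  then show thesis using that[of "sqrt 2 * h"] h by simp
qed

lemma poincare:
  fixes \<Omega> :: "(real^'n) set"
  assumes \<Omega>: "open \<Omega>" "bounded \<Omega>"
  obtains c where "0 < c" and "\<And>u::real^'n \<Rightarrow> 'b::euclidean_space. test_approximable \<Omega> u \<Longrightarrow>
     l2_norm (lebesgue_on \<Omega>) u \<le> c * l2_norm (lebesgue_on \<Omega>) (wderiv \<Omega> j u)"
proof -
  have \<Omega>s: "\<Omega> \<in> sets lebesgue" using \<Omega>(1) by (simp add: sets_completionI_sets)
  let ?M = "lebesgue_on \<Omega>"
  obtain c where c: "0 < c" and le: "\<And>\<psi>::real^'n \<Rightarrow> 'b. test_field \<Omega> \<psi> \<Longrightarrow>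
     l2_norm ?M \<psi> \<le> c * l2_norm ?M (\<lambda>x. frechet_derivative \<psi> (at x) (axis j 1))"
    by (rule poincare_test[OF \<Omega>, where j=j], rule that)
  have "l2_norm ?M u \<le> c * l2_norm ?M (wderiv \<Omega> j u)" if u: "test_approximable \<Omega> u" for u :: "real^'n \<Rightarrow> 'b"
  proof (rule field_le_epsilon)
    fix e :: real assume e: "0 < e"
    define \<eta> where "\<eta> = e / (1 + c)"
    have "(1 + c) * \<eta> = e" using c by (simp add: \<eta>_def)
    then have \<eta>: "0 < \<eta>" "\<eta> + c * \<eta> = e"
      using e c by (simp add: \<eta>_def, simp only: distrib_right mult_1_left)
    obtain \<psi> where t\<psi>: "test_field \<Omega> \<psi>" and \<psi>: "smooth \<psi>"
      "l2_norm ?M (\<lambda>x. \<psi> x - u x) < \<eta>" "\<And>j. l2_norm ?M (\<lambda>x. frechet_derivative \<psi> (at x) (axis j 1) - wderiv \<Omega> j u x) < \<eta>"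
      using u \<eta>(1) unfolding test_approximable_def test_field_def by blast
    have H: "H1 \<Omega> u" using u by (simp add: test_approximable_def)
    have L: "L2 ?M f" if "smooth f" for f :: "real^'n \<Rightarrow> 'b"
      by (rule continuous_L2_bounded[OF smooth_continuous_on[OF that] \<Omega>(2) \<Omega>s])
    have uL: "L2 ?M u" using H by (simp add: H1_def)
    let ?D = "\<lambda>x. frechet_derivative \<psi> (at x) (axis j 1)"
    have DL: "L2 ?M ?D" by (rule L[OF smooth_frechet_derivative[OF \<psi>(1)]])
    have "l2_norm ?M u \<le> l2_norm ?M \<psi> + l2_norm ?M (\<lambda>x. \<psi> x - u x)"
      using l2_norm_diff_triangle[OF L[OF \<psi>(1)] L2_diff[OF L[OF \<psi>(1)] uL]] by simp
    also have "l2_norm ?M \<psi> \<le> c * l2_norm ?M ?D" by (rule le[OF t\<psi>])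
    also have "\<dots> \<le> c * (l2_norm ?M (wderiv \<Omega> j u) + \<eta>)"
      using l2_norm_le_add_diff[OF DL H1_wderiv_L2[OF \<Omega>(1) H, of j]] \<psi>(3)[of j] c by (intro mult_left_mono) auto
    finally show "l2_norm ?M u \<le> c * l2_norm ?M (wderiv \<Omega> j u) + e"
      using \<psi>(2) \<eta>(2) by (simp add: distrib_left)
  qed
  then show thesis using that c by blast
qed

lemma Linf_AE_bound:
  assumes "Linf M f" shows "AE x in M. norm (f x) \<le> linf_norm M f"
proof -
  let ?e = "esssup M (\<lambda>x. ereal (norm (f x)))"
  have lt: "?e < \<infinity>" using assms by (simp add: Linf_def)
  have "AE x in M. ereal (norm (f x)) \<le> ?e" by (rule esssup_AE)
  then show ?thesis
  proof eventually_elim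
    case (elim x)
    with lt show ?case by (cases ?e) (auto simp: linf_norm_def)
  qed
qed

text \<open>The essential supremum of a norm could only be negative on a null set, and nonempty open sets are
  not null.\<close>

lemma Linf_norm_nonneg:
  assumes "open \<Omega>" "\<Omega> \<noteq> {}" "Linf (lebesgue_on \<Omega>) f" shows "0 \<le> linf_norm (lebesgue_on \<Omega>) f"
proof (rule ccontr)
  assume neg: "\<not> 0 \<le> linf_norm (lebesgue_on \<Omega>) f"
  have "AE x in lebesgue_on \<Omega>. False"
    using Linf_AE_bound[OF assms(3)]
  proof eventually_elim
    case (elim x)
    with neg norm_ge_zero[of "f x"] show ?case by linarith
  qed
  then have "AE x in lebesgue. x \<notin> \<Omega>"
    using assms(1) by (simp add: AE_restrict_space_iff sets_completionI_sets)
  then have "negligible \<Omega>"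
    using assms(1) by (simp add: negligible_iff_null_sets completion.null_sets_iff_AE)
  then show False using open_not_negligible[OF assms(1,2)] by simp
qed

lemma W1inf_bounds:
  assumes \<Omega>: "open \<Omega>" "\<Omega> \<noteq> {}" and \<beta>: "W1inf \<Omega> \<beta>"
  shows "(\<lambda>x. \<beta> x $ j) \<in> borel_measurable (lebesgue_on \<Omega>)"
    and "AE x in lebesgue_on \<Omega>. \<bar>\<beta> x $ j\<bar> \<le> w1inf_norm \<Omega> \<beta>"
    and "0 \<le> w1inf_norm \<Omega> \<beta>"
proof -
  have L: "Linf (lebesgue_on \<Omega>) \<beta>" using \<beta> by (simp add: W1inf_def)
  have le: "linf_norm (lebesgue_on \<Omega>) \<beta> \<le> w1inf_norm \<Omega> \<beta>" by (simp add: w1inf_norm_def)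
  show "(\<lambda>x. \<beta> x $ j) \<in> borel_measurable (lebesgue_on \<Omega>)"
    using L by (intro measurable_compose[OF _ borel_measurable_continuous_onI[of "\<lambda>v. v $ j"]])
      (auto simp: Linf_def intro: continuous_intros)
  show "AE x in lebesgue_on \<Omega>. \<bar>\<beta> x $ j\<bar> \<le> w1inf_norm \<Omega> \<beta>"
    using Linf_AE_bound[OF L]
    by eventually_elim (rule order_trans[OF component_le_norm_cart order_trans[OF _ le]])
  show "0 \<le> w1inf_norm \<Omega> \<beta>" by (rule order_trans[OF Linf_norm_nonneg[OF \<Omega> L] le])
qed

text \<open>The divergence is defined through weak derivatives, which is the stated identity summed over the
  coordinates.\<close>

lemma divergence_free_test:
  fixes \<Omega> :: "(real^'n) set"
  assumes \<Omega>: "open \<Omega>" and \<beta>: "W1inf \<Omega> \<beta>" "divergence_free \<Omega> \<beta>" and q: "test_function \<Omega> q"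
  shows "(\<integral>x. (\<Sum>i\<in>UNIV. \<beta> x $ i * frechet_derivative q (at x) (axis i 1)) \<partial>lebesgue_on \<Omega>) = 0"
proof -
  let ?M = "lebesgue_on \<Omega>"
  have \<Omega>s: "\<Omega> \<in> sets lebesgue" using \<Omega> by (simp add: sets_completionI_sets)
  have w: "has_weak_deriv \<Omega> i \<beta> (wderiv \<Omega> i \<beta>)" for i
    using \<beta>(1) has_weak_deriv_wderiv unfolding W1inf_def by blast
  have li: "locally_integrable \<Omega> \<beta>" "locally_integrable \<Omega> (wderiv \<Omega> i \<beta>)" for i
    using w[of i] by (auto simp: has_weak_deriv_def)
  have I1: "integrable ?M (\<lambda>x. frechet_derivative q (at x) (axis i 1) *\<^sub>R \<beta> x)" for i
    by (rule test_function_mult_integrable2(2)[OF q li(1) \<Omega>s])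
  have I2: "integrable ?M (\<lambda>x. q x *\<^sub>R wderiv \<Omega> i \<beta> x)" for i
    by (rule test_function_mult_integrable2(1)[OF q li(2) \<Omega>s])
  have J1: "integrable ?M (\<lambda>x. \<beta> x $ i * frechet_derivative q (at x) (axis i 1))" for i
    using integrable_bounded_linear[OF bounded_linear_vec_nth[of i] I1[of i]] by (simp add: mult.commute)
  have J2: "integrable ?M (\<lambda>x. q x * wderiv \<Omega> i \<beta> x $ i)" for i
    using integrable_bounded_linear[OF bounded_linear_vec_nth[of i] I2[of i]] by simp
  have eq: "(\<integral>x. \<beta> x $ i * frechet_derivative q (at x) (axis i 1) \<partial>?M) = - (\<integral>x. q x * wderiv \<Omega> i \<beta> x $ i \<partial>?M)" for i
  proof -
    have "(\<integral>x. frechet_derivative q (at x) (axis i 1) *\<^sub>R \<beta> x \<partial>?M) = - (\<integral>x. q x *\<^sub>R wderiv \<Omega> i \<beta> x \<partial>?M)"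
      using w[of i] q unfolding has_weak_deriv_def by blast
    then have "(\<integral>x. frechet_derivative q (at x) (axis i 1) *\<^sub>R \<beta> x \<partial>?M) $ i = - ((\<integral>x. q x *\<^sub>R wderiv \<Omega> i \<beta> x \<partial>?M) $ i)" by simp
    then show ?thesis
      using integral_bounded_linear[OF bounded_linear_vec_nth[of i] I1[of i]]
        integral_bounded_linear[OF bounded_linear_vec_nth[of i] I2[of i]] by (simp add: mult.commute)
  qed
  have "(\<integral>x. (\<Sum>i\<in>UNIV. \<beta> x $ i * frechet_derivative q (at x) (axis i 1)) \<partial>?M)
      = (\<Sum>i\<in>UNIV. \<integral>x. \<beta> x $ i * frechet_derivative q (at x) (axis i 1) \<partial>?M)"
    by (rule Bochner_Integration.integral_sum[OF J1])
  also have "\<dots> = - (\<Sum>i\<in>UNIV. \<integral>x. q x * wderiv \<Omega> i \<beta> x $ i \<partial>?M)" by (simp add: eq sum_negf)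
  also have "(\<Sum>i\<in>UNIV. \<integral>x. q x * wderiv \<Omega> i \<beta> x $ i \<partial>?M) = (\<integral>x. (\<Sum>i\<in>UNIV. q x * wderiv \<Omega> i \<beta> x $ i) \<partial>?M)"
    by (rule Bochner_Integration.integral_sum[OF J2, symmetric])
  also have "\<dots> = 0"
  proof (rule integral_eq_zero_AE)
    show "AE x in ?M. (\<Sum>i\<in>UNIV. q x * wderiv \<Omega> i \<beta> x $ i) = 0"
      using \<beta>(2) unfolding divergence_free_def wdiv_def
      by eventually_elim (simp add: sum_distrib_left[symmetric])
  qed
  finally show ?thesis by simp
qed

text \<open>For a test field \<open>\<psi>\<close> the integrand is half the derivative of \<open>\<psi> x \<bullet> \<psi> x\<close> along \<open>\<beta>\<close>, so
  \<open>divergence_free_test\<close> applies. Both factors converge in \<open>L\<^sup>2\<close> because \<open>\<beta>\<close> is bounded.\<close>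

lemma convection_skew:
  fixes \<Omega> :: "(real^'n) set" and u :: "real^'n \<Rightarrow> 'b::euclidean_space"
  assumes \<Omega>: "open \<Omega>" "bounded \<Omega>" "\<Omega> \<noteq> {}" and \<beta>: "W1inf \<Omega> \<beta>" "divergence_free \<Omega> \<beta>"
    and u: "test_approximable \<Omega> u"
  shows "(\<integral>x. (\<Sum>j\<in>UNIV. (\<beta> x $ j) *\<^sub>R wderiv \<Omega> j u x) \<bullet> u x \<partial>lebesgue_on \<Omega>) = 0"
proof -
  let ?M = "lebesgue_on \<Omega>"
  have \<Omega>s: "\<Omega> \<in> sets lebesgue" using \<Omega> by (simp add: sets_completionI_sets)
  define B where "B = w1inf_norm \<Omega> \<beta>"
  note bds = W1inf_bounds[OF \<Omega>(1,3) \<beta>(1), folded B_def]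
  note \<beta>m = bds(1) and \<beta>B = bds(2) and B0 = bds(3)
  have H: "H1 \<Omega> u" using u by (simp add: test_approximable_def)
  have uL: "L2 ?M u" using H by (simp add: H1_def)
  have gL: "L2 ?M (wderiv \<Omega> j u)" for j by (rule H1_wderiv_L2[OF \<Omega>(1) H])
  have "\<exists>\<psi>. test_field \<Omega> \<psi> \<and> l2_norm ?M (\<lambda>x. \<psi> x - u x) < 1 / real (Suc k) \<and>
     (\<forall>j. l2_norm ?M (\<lambda>x. frechet_derivative \<psi> (at x) (axis j 1) - wderiv \<Omega> j u x) < 1 / real (Suc k))" for k
    using u unfolding test_approximable_def by simp
  from choice[OF allI[OF this]] obtain \<psi> where \<psi>: "\<forall>k. test_field \<Omega> (\<psi> k) \<and> l2_norm ?M (\<lambda>x. \<psi> k x - u x) < 1 / real (Suc k) \<and>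
     (\<forall>j. l2_norm ?M (\<lambda>x. frechet_derivative (\<psi> k) (at x) (axis j 1) - wderiv \<Omega> j u x) < 1 / real (Suc k))" ..
  have sm: "smooth (\<psi> k)" for k using \<psi> unfolding test_field_def by blast
  define D where "D k j x = frechet_derivative (\<psi> k) (at x) (axis j 1)" for k j x
  define F where "F k x = (\<Sum>j\<in>UNIV. (\<beta> x $ j) *\<^sub>R D k j x)" for k x
  define G where "G x = (\<Sum>j\<in>UNIV. (\<beta> x $ j) *\<^sub>R wderiv \<Omega> j u x)" for x
  have \<psi>L: "L2 ?M (\<psi> k)" for k by (rule continuous_L2_bounded[OF smooth_continuous_on[OF sm] \<Omega>(2) \<Omega>s])
  have DL: "L2 ?M (D k j)" for k j
    unfolding D_def by (rule continuous_L2_bounded[OF smooth_continuous_on[OF smooth_frechet_derivative[OF sm]] \<Omega>(2) \<Omega>s])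
  note mL = L2_mult_AE_bounded(1)[OF _ \<beta>m \<beta>B B0]
  have FL: "L2 ?M (F k)" for k unfolding F_def by (intro L2_sum mL DL)
  have GL: "L2 ?M G" unfolding G_def by (intro L2_sum mL gL)
  have zero: "(\<integral>x. F k x \<bullet> \<psi> k x \<partial>?M) = 0" for k
  proof -
    let ?q = "\<lambda>x. \<psi> k x \<bullet> \<psi> k x"
    have sub: "closure {x. ?q x \<noteq> 0} \<subseteq> closure {x. \<psi> k x \<noteq> 0}" by (rule closure_mono) auto
    have K: "compact (closure {x. \<psi> k x \<noteq> 0})" "closure {x. \<psi> k x \<noteq> 0} \<subseteq> \<Omega>"
      using \<psi> unfolding test_field_def by blast+
    have "test_function \<Omega> ?q"
      unfolding test_function_def
    proof (intro conjI smooth_inner sm)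
      show "compact (closure {x. ?q x \<noteq> 0})"
        using K(1) sub by (meson bounded_subset closed_closure compact_eq_bounded_closed)
      show "closure {x. ?q x \<noteq> 0} \<subseteq> \<Omega>" by (rule order_trans[OF sub K(2)])
    qed
    note 0 = divergence_free_test[OF \<Omega>(1) \<beta> this]
    have Dq: "frechet_derivative ?q (at x) v = 2 * (frechet_derivative (\<psi> k) (at x) v \<bullet> \<psi> k x)" for x v
    proof -
      have "frechet_derivative ?q (at x) = (\<lambda>v. \<psi> k x \<bullet> frechet_derivative (\<psi> k) (at x) v + frechet_derivative (\<psi> k) (at x) v \<bullet> \<psi> k x)"
        by (rule frechet_derivative_at[symmetric], rule has_derivative_inner[OF smooth_has_derivative[OF sm] smooth_has_derivative[OF sm]])
      then show ?thesis by (simp add: inner_commute)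
    qed
    have "(\<Sum>i\<in>UNIV. \<beta> x $ i * frechet_derivative ?q (at x) (axis i 1)) = 2 * (F k x \<bullet> \<psi> k x)" for x
      unfolding Dq F_def D_def by (simp add: inner_sum_left sum_distrib_left mult.left_commute)
    with 0 have "(\<integral>x. 2 * (F k x \<bullet> \<psi> k x) \<partial>?M) = 0" by simp
    then show ?thesis by simp
  qed
  have lim1: "(\<lambda>k. 1 / real (Suc k)) \<longlonglongrightarrow> 0" using LIMSEQ_Suc[OF lim_1_over_n[where 'a=real]] by simp
  have l\<psi>: "(\<lambda>k. l2_norm ?M (\<lambda>x. \<psi> k x - u x)) \<longlonglongrightarrow> 0"
    by (rule tendsto_sandwich[OF _ _ tendsto_const lim1]) (use \<psi> in \<open>auto simp: l2_norm_nonneg intro!: always_eventually less_imp_le\<close>)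
  have lF: "(\<lambda>k. l2_norm ?M (\<lambda>x. F k x - G x)) \<longlonglongrightarrow> 0"
  proof (rule tendsto_sandwich[OF _ _ tendsto_const])
    have "l2_norm ?M (\<lambda>x. F k x - G x) \<le> real CARD('n) * B * (1 / real (Suc k))" for k
    proof -
      have "l2_norm ?M (\<lambda>x. F k x - G x) = l2_norm ?M (\<lambda>x. \<Sum>j\<in>UNIV. (\<beta> x $ j) *\<^sub>R (D k j x - wderiv \<Omega> j u x))"
        by (simp add: F_def G_def scaleR_diff_right sum_subtractf)
      also have "\<dots> \<le> (\<Sum>j\<in>UNIV. l2_norm ?M (\<lambda>x. (\<beta> x $ j) *\<^sub>R (D k j x - wderiv \<Omega> j u x)))"
        by (intro l2_norm_sum_le mL L2_diff DL gL) simp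
      also have "\<dots> \<le> (\<Sum>j\<in>(UNIV::'n set). B * (1 / real (Suc k)))"
      proof (rule sum_mono)
        fix j :: 'n
        have "l2_norm ?M (\<lambda>x. (\<beta> x $ j) *\<^sub>R (D k j x - wderiv \<Omega> j u x)) \<le> B * l2_norm ?M (\<lambda>x. D k j x - wderiv \<Omega> j u x)"
          by (rule L2_mult_AE_bounded(2)[OF L2_diff[OF DL gL] \<beta>m \<beta>B B0])
        also have "\<dots> \<le> B * (1 / real (Suc k))"
        proof (rule mult_left_mono[OF less_imp_le B0])
          show "l2_norm ?M (\<lambda>x. D k j x - wderiv \<Omega> j u x) < 1 / real (Suc k)"
            using \<psi> unfolding D_def by blast
        qed
        finally show "l2_norm ?M (\<lambda>x. (\<beta> x $ j) *\<^sub>R (D k j x - wderiv \<Omega> j u x)) \<le> B * (1 / real (Suc k))" .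
      qed
      finally show ?thesis by (simp add: mult.assoc)
    qed
    then show "\<forall>\<^sub>F k in sequentially. l2_norm ?M (\<lambda>x. F k x - G x) \<le> real CARD('n) * B * (1 / real (Suc k))"
      by (rule always_eventually[OF allI])
    show "(\<lambda>k. real CARD('n) * B * (1 / real (Suc k))) \<longlonglongrightarrow> 0"
      using tendsto_mult_left[OF lim1, of "real CARD('n) * B"] by simp
  qed (simp add: l2_norm_nonneg)
  have "(\<lambda>k. \<integral>x. F k x \<bullet> \<psi> k x \<partial>?M) \<longlonglongrightarrow> (\<integral>x. G x \<bullet> u x \<partial>?M)"
    by (rule L2_tendsto_integral_inner[OF FL \<psi>L GL uL lF l\<psi>])
  then have "(\<integral>x. G x \<bullet> u x \<partial>?M) = 0" unfolding zero LIMSEQ_const_iff by (rule sym)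
  then show ?thesis by (simp add: G_def)
qed

section \<open>Energy estimates\<close>

lemma Re_cdot: "Re (cdot a b) = a \<bullet> b"
  by (simp add: cdot_def inner_vec_def inner_complex_def)

lemma norm_cdot_le: "norm (cdot a b) \<le> norm a * norm b"
proof -
  have "norm (cdot a b) \<le> (\<Sum>i\<in>UNIV. \<bar>norm (a $ i)\<bar> * \<bar>norm (b $ i)\<bar>)"
    unfolding cdot_def by (rule order_trans[OF norm_sum]) (simp add: norm_mult)
  also have "\<dots> \<le> norm a * norm b" unfolding norm_vec_def by (rule L2_set_mult_ineq)
  finally show ?thesis .
qed

lemma integrable_cdot:
  fixes f g :: "'a \<Rightarrow> complex^'n"
  assumes "L2 M f" "L2 M g" shows "integrable M (\<lambda>x. cdot (f x) (g x))"
proof (rule Bochner_Integration.integrable_bound[OF L2_integrable_norm_mult[OF assms]])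
  have nth: "(\<lambda>x. h x $ i) \<in> borel_measurable M" if "L2 M h" for h :: "'a \<Rightarrow> complex^'n" and i
    by (rule measurable_compose[OF L2_measurable[OF that] borel_measurable_continuous_onI]) (intro continuous_intros)
  have cn: "(\<lambda>x. cnj (g x $ i)) \<in> borel_measurable M" for i
    by (rule measurable_compose[OF nth[OF assms(2)] borel_measurable_continuous_onI]) (intro continuous_intros)
  show "(\<lambda>x. cdot (f x) (g x)) \<in> borel_measurable M"
    unfolding cdot_def by (intro borel_measurable_sum borel_measurable_times nth[OF assms(1)] cn)
  show "AE x in M. norm (cdot (f x) (g x)) \<le> norm (norm (f x) * norm (g x))"
    using norm_cdot_le by (intro AE_I2) simp
qed

lemma Re_integral_cdot:
  assumes "L2 M f" "L2 M g" shows "Re (\<integral>x. cdot (f x) (g x) \<partial>M) = (\<integral>x. f x \<bullet> g x \<partial>M)"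
  using integral_Re[OF integrable_cdot[OF assms]] by (simp add: Re_cdot)

lemma cddot_wgrad:
  "cddot (wgrad \<Omega> u x) (wgrad \<Omega> v x) = (\<Sum>j\<in>UNIV. cdot (wderiv \<Omega> j u x) (wderiv \<Omega> j v x))"
  unfolding cddot_def cdot_def wgrad_def by (simp, rule sum.swap)

text \<open>The real part of the sesquilinear problem involves only real inner products. The pressure term is
  the conjugate of the divergence constraint with the pressure itself as test function.\<close>

lemma real_weak_form:
  fixes u v F f :: "real^'n \<Rightarrow> complex^'n"
  assumes \<Omega>: "open \<Omega>" and u: "H1 \<Omega> u" and v: "H1 \<Omega> v" and F: "L2 (lebesgue_on \<Omega>) F" and f: "L2 (lebesgue_on \<Omega>) f"
    and eq: "(\<integral>x. of_real \<nu> * cddot (wgrad \<Omega> u x) (wgrad \<Omega> v x) \<partial>(lebesgue_on \<Omega>))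
        + (\<integral>x. cdot (F x) (v x) \<partial>(lebesgue_on \<Omega>))
        - (\<integral>x. p x * cnj (wdiv \<Omega> v x) \<partial>(lebesgue_on \<Omega>))
        = (\<integral>x. cdot (f x) (v x) \<partial>(lebesgue_on \<Omega>))"
    and div: "(\<integral>x. cnj (p x) * wdiv \<Omega> v x \<partial>(lebesgue_on \<Omega>)) = 0"
  shows "\<nu> * (\<Sum>j\<in>UNIV. \<integral>x. wderiv \<Omega> j u x \<bullet> wderiv \<Omega> j v x \<partial>lebesgue_on \<Omega>)
      + (\<integral>x. F x \<bullet> v x \<partial>lebesgue_on \<Omega>) = (\<integral>x. f x \<bullet> v x \<partial>lebesgue_on \<Omega>)"
proof -
  let ?M = "lebesgue_on \<Omega>"
  have vL: "L2 ?M v" using v by (simp add: H1_def)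
  note I = integrable_cdot[OF H1_wderiv_L2[OF \<Omega> u] H1_wderiv_L2[OF \<Omega> v]]
  note R = Re_integral_cdot[OF H1_wderiv_L2[OF \<Omega> u] H1_wderiv_L2[OF \<Omega> v]]
  have A: "(\<integral>x. of_real \<nu> * cddot (wgrad \<Omega> u x) (wgrad \<Omega> v x) \<partial>?M)
      = of_real \<nu> * (\<Sum>j\<in>UNIV. \<integral>x. cdot (wderiv \<Omega> j u x) (wderiv \<Omega> j v x) \<partial>?M)"
    unfolding cddot_wgrad using I by simp
  have 1: "Re (\<integral>x. of_real \<nu> * cddot (wgrad \<Omega> u x) (wgrad \<Omega> v x) \<partial>?M)
      = \<nu> * (\<Sum>j\<in>UNIV. \<integral>x. wderiv \<Omega> j u x \<bullet> wderiv \<Omega> j v x \<partial>?M)"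
    unfolding A by (simp add: R)
  have "(\<integral>x. p x * cnj (wdiv \<Omega> v x) \<partial>?M) = cnj (\<integral>x. cnj (p x) * wdiv \<Omega> v x \<partial>?M)"
    using Bochner_Integration.integral_cnj[of ?M "\<lambda>x. cnj (p x) * wdiv \<Omega> v x"] by simp
  then have 2: "(\<integral>x. p x * cnj (wdiv \<Omega> v x) \<partial>?M) = 0" by (simp add: div)
  from arg_cong[OF eq, of Re] show ?thesis
    by (simp only: plus_complex.simps minus_complex.simps 1 2 Re_integral_cdot[OF F vL] Re_integral_cdot[OF f vL]) simp
qed

definition grad_norm :: "(real^'n) set \<Rightarrow> (real^'n \<Rightarrow> 'b::euclidean_space) \<Rightarrow> real" where
  "grad_norm \<Omega> u = sqrt (\<Sum>j\<in>UNIV. (l2_norm (lebesgue_on \<Omega>) (wderiv \<Omega> j u))\<^sup>2)"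

lemma grad_norm_nonneg: "0 \<le> grad_norm \<Omega> u"
  by (simp add: grad_norm_def sum_nonneg)

lemma grad_norm_squared: "(grad_norm \<Omega> u)\<^sup>2 = (\<Sum>j\<in>UNIV. (l2_norm (lebesgue_on \<Omega>) (wderiv \<Omega> j u))\<^sup>2)"
  by (simp add: grad_norm_def sum_nonneg)

lemma wderiv_le_grad_norm: "l2_norm (lebesgue_on \<Omega>) (wderiv \<Omega> j u) \<le> grad_norm \<Omega> u"
  unfolding grad_norm_def by (rule real_le_rsqrt) (rule member_le_sum, auto)

lemma h1_norm_grad_norm: "h1_norm \<Omega> u = sqrt ((l2_norm (lebesgue_on \<Omega>) u)\<^sup>2 + (grad_norm \<Omega> u)\<^sup>2)"
  by (simp add: h1_norm_def grad_norm_squared)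

text \<open>The form in which energy identities are used: cancel one power of the norm.\<close>

lemma le_of_weighted_square_le:
  assumes "0 \<le> (x::real)" "0 < \<nu>" "0 \<le> b" "\<nu> * x\<^sup>2 \<le> b * x"
  shows "x \<le> b / \<nu>"
proof (cases "x = 0")
  case False
  then have "\<nu> * x \<le> b"
    using assms(1,4) mult_right_le_imp_le[of "\<nu> * x" x b] by (simp add: power2_eq_square mult.assoc)
  then show ?thesis using assms(2) by (simp add: pos_le_divide_eq mult.commute)
qed (use assms in simp)

lemma convection_L2:
  fixes \<Omega> :: "(real^'n) set"
  assumes \<Omega>: "open \<Omega>" "\<Omega> \<noteq> {}" and \<beta>: "W1inf \<Omega> \<beta>" and u: "H1 \<Omega> u"
  shows "L2 (lebesgue_on \<Omega>) (convection \<Omega> \<beta> u)"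
    and "l2_norm (lebesgue_on \<Omega>) (convection \<Omega> \<beta> u) \<le> real CARD('n) * w1inf_norm \<Omega> \<beta> * grad_norm \<Omega> u"
proof -
  let ?M = "lebesgue_on \<Omega>"
  define B where "B = w1inf_norm \<Omega> \<beta>"
  note bds = W1inf_bounds[OF \<Omega> \<beta>, folded B_def]
  note \<beta>m = bds(1) and \<beta>B = bds(2) and B0 = bds(3)
  have gL: "L2 ?M (wderiv \<Omega> j u)" for j by (rule H1_wderiv_L2[OF \<Omega>(1) u])
  note mL = L2_mult_AE_bounded(1)[OF gL \<beta>m \<beta>B B0]
  have conv: "convection \<Omega> \<beta> u = (\<lambda>x. \<Sum>j\<in>UNIV. (\<beta> x $ j) *\<^sub>R wderiv \<Omega> j u x)" by (simp add: convection_def[abs_def])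
  show "L2 ?M (convection \<Omega> \<beta> u)" unfolding conv by (intro L2_sum mL)
  have "l2_norm ?M (convection \<Omega> \<beta> u) \<le> (\<Sum>j\<in>UNIV. l2_norm ?M (\<lambda>x. (\<beta> x $ j) *\<^sub>R wderiv \<Omega> j u x))"
    unfolding conv by (intro l2_norm_sum_le mL) simp
  also have "\<dots> \<le> (\<Sum>j\<in>(UNIV::'n set). w1inf_norm \<Omega> \<beta> * grad_norm \<Omega> u)"
  proof (rule sum_mono)
    fix j :: 'n
    have "l2_norm ?M (\<lambda>x. (\<beta> x $ j) *\<^sub>R wderiv \<Omega> j u x) \<le> B * l2_norm ?M (wderiv \<Omega> j u)"
      by (rule L2_mult_AE_bounded(2)[OF gL \<beta>m \<beta>B B0])
    also have "\<dots> \<le> w1inf_norm \<Omega> \<beta> * grad_norm \<Omega> u"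
      unfolding B_def by (rule mult_left_mono[OF wderiv_le_grad_norm bds(3)[unfolded B_def]])
    finally show "l2_norm ?M (\<lambda>x. (\<beta> x $ j) *\<^sub>R wderiv \<Omega> j u x) \<le> w1inf_norm \<Omega> \<beta> * grad_norm \<Omega> u" .
  qed
  finally show "l2_norm ?M (convection \<Omega> \<beta> u) \<le> real CARD('n) * w1inf_norm \<Omega> \<beta> * grad_norm \<Omega> u" by (simp add: mult.assoc)
qed

theorem lemma2p3:
  fixes \<Omega> :: "(real^'n) set" and \<nu> \<nu>min \<nu>max :: real
  assumes "CARD('n) \<in> {2, 3}"
    and "polyhedral_lipschitz_domain \<Omega>"
    and "0 < \<nu>min" and "\<nu>min < \<nu>" and "\<nu> < \<nu>max"
  shows "\<exists>C\<nu>>0. \<forall>\<beta> T TS.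
           W1inf \<Omega> \<beta> \<longrightarrow> divergence_free \<Omega> \<beta> \<longrightarrow>
           oseen_operator \<Omega> \<nu> \<beta> T \<longrightarrow> stokes_operator \<Omega> \<nu> TS \<longrightarrow>
           (\<forall>f. L2 (lebesgue_on \<Omega>) f \<longrightarrow>
              h1_norm \<Omega> (\<lambda>x. T f x - TS f x)
                \<le> C\<nu> * w1inf_norm \<Omega> \<beta> * l2_norm (lebesgue_on \<Omega>) f)"
proof -
  let ?M = "lebesgue_on \<Omega>"
  have \<nu>: "0 < \<nu>" using assms(3,4) by linarith
  have n: "CARD('n) \<ge> 2" using assms(1) by auto
  have \<Omega>: "open \<Omega>" "bounded \<Omega>" "\<Omega> \<noteq> {}" using assms(2) by (auto simp: polyhedral_lipschitz_domain_def)
  note appr = H10_test_approximable[OF assms(2) n]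
  \<comment> \<open>Any coordinate direction serves for the Poincare inequality.\<close>
  obtain c where c: "0 < c" and poinc: "\<And>u::real^'n \<Rightarrow> complex^'n. test_approximable \<Omega> u \<Longrightarrow>
     l2_norm ?M u \<le> c * l2_norm ?M (wderiv \<Omega> undefined u)"
    by (rule poincare[OF \<Omega>(1,2), where j=undefined], rule that)
  have poincare_grad: "l2_norm ?M u \<le> c * grad_norm \<Omega> u" if "test_approximable \<Omega> u" for u :: "real^'n \<Rightarrow> complex^'n"
    by (rule order_trans[OF poinc[OF that] mult_left_mono[OF wderiv_le_grad_norm]]) (use c in simp)
  define k where "k = real CARD('n)"
  have k: "0 < k" by (simp add: k_def)
  define C where "C = sqrt (c\<^sup>2 + 1) * (k * c / \<nu> * (c / \<nu>))"
  have C: "0 < C" unfolding C_def using c k \<nu> by (intro mult_pos_pos) (auto simp: add_pos_nonneg intro: real_sqrt_gt_zero add_nonneg_pos)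
  have "h1_norm \<Omega> (\<lambda>x. T f x - TS f x) \<le> C * w1inf_norm \<Omega> \<beta> * l2_norm ?M f"
    if \<beta>: "W1inf \<Omega> \<beta>" "divergence_free \<Omega> \<beta>" and T: "oseen_operator \<Omega> \<nu> \<beta> T" and TS: "stokes_operator \<Omega> \<nu> TS"
      and f: "L2 ?M f" for \<beta> T TS f
  proof -
    define u where "u = T f"
    define v where "v = TS f"
    define w where "w x = u x - v x" for x
    define B where "B = w1inf_norm \<Omega> \<beta>"
    define a where "a y z = (\<Sum>j\<in>UNIV. \<integral>x. wderiv \<Omega> j y x \<bullet> wderiv \<Omega> j z x \<partial>?M)" for y z :: "real^'n \<Rightarrow> complex^'n"
    define F where "F = convection \<Omega> \<beta> u"
    obtain p where p: "oseen_solution \<Omega> \<nu> \<beta> f u p" using T f unfolding oseen_operator_def u_def by blast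
    obtain r where r: "stokes_solution \<Omega> \<nu> f v r" using TS f unfolding stokes_operator_def v_def by blast
    have Hu: "H10 \<Omega> u" and Hv: "H10 \<Omega> v" using p r by (auto simp: oseen_solution_def stokes_solution_def)
    have H: "H1 \<Omega> u" "H1 \<Omega> v" using Hu Hv by (auto simp: H10_def)
    have uv: "L2 ?M u" "L2 ?M v" using H by (auto simp: H1_def)
    have tw: "test_approximable \<Omega> w"
      unfolding w_def by (rule test_approximable_diff[OF \<Omega>(1,2) appr[OF Hu] appr[OF Hv]])
    have Hw: "H1 \<Omega> w" using tw by (simp add: test_approximable_def)
    have wL: "L2 ?M w" using Hw by (simp add: H1_def)
    have FL: "L2 ?M F" unfolding F_def by (rule convection_L2(1)[OF \<Omega>(1,3) \<beta>(1) H(1)])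
    have B0: "0 \<le> B" unfolding B_def by (rule W1inf_bounds(3)[OF \<Omega>(1,3) \<beta>(1)])
    have divs: "(\<integral>x. cnj (q x) * wdiv \<Omega> u x \<partial>?M) = 0" "(\<integral>x. cnj (q x) * wdiv \<Omega> v x \<partial>?M) = 0"
      if "L2_zero_mean \<Omega> q" for q
      using p r that by (auto simp: oseen_solution_def stokes_solution_def)
    have zm: "L2_zero_mean \<Omega> p" "L2_zero_mean \<Omega> r" using p r by (auto simp: oseen_solution_def stokes_solution_def)
    have oseen: "\<nu> * a u z + (\<integral>x. F x \<bullet> z x \<partial>?M) = (\<integral>x. f x \<bullet> z x \<partial>?M)"
      if z: "H10 \<Omega> z" "(\<integral>x. cnj (p x) * wdiv \<Omega> z x \<partial>?M) = 0" for z
      unfolding a_def F_def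
    proof (rule real_weak_form[OF \<Omega>(1) H(1) _ FL[unfolded F_def] f _ z(2)])
      show "H1 \<Omega> z" using z by (simp add: H10_def)
    qed (use p z in \<open>auto simp: oseen_solution_def\<close>)
    have stokes: "\<nu> * a v z = (\<integral>x. f x \<bullet> z x \<partial>?M)"
      if z: "H10 \<Omega> z" "(\<integral>x. cnj (r x) * wdiv \<Omega> z x \<partial>?M) = 0" for z
    proof -
      have "\<nu> * a v z + (\<integral>x. 0 \<bullet> z x \<partial>?M) = (\<integral>x. f x \<bullet> z x \<partial>?M)"
        unfolding a_def
      proof (rule real_weak_form[OF \<Omega>(1) H(2) _ L2_zero f _ z(2)])
        show "H1 \<Omega> z" using z by (simp add: H10_def)
      qed (use r z in \<open>auto simp: stokes_solution_def cdot_def\<close>)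
      then show ?thesis by simp
    qed
    have aself: "a y y = (grad_norm \<Omega> y)\<^sup>2" for y
      unfolding a_def grad_norm_squared l2_norm_squared by (simp add: power2_norm_eq_inner)
    have skew: "(\<integral>x. F x \<bullet> u x \<partial>?M) = 0"
      using convection_skew[OF \<Omega> \<beta> appr[OF Hu]] by (simp add: F_def convection_def)
    \<comment> \<open>The Oseen problem tested with its own velocity.\<close>
    have energy: "grad_norm \<Omega> u \<le> c / \<nu> * l2_norm ?M f"
    proof -
      have "\<nu> * (grad_norm \<Omega> u)\<^sup>2 = (\<integral>x. f x \<bullet> u x \<partial>?M)"
        using oseen[OF Hu divs(1)[OF zm(1)]] skew by (simp add: aself)
      also have "\<dots> \<le> l2_norm ?M f * l2_norm ?M u" using abs_integral_inner_le[OF f uv(1)] by linarith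
      also have "\<dots> \<le> l2_norm ?M f * (c * grad_norm \<Omega> u)"
        by (rule mult_left_mono[OF poincare_grad[OF appr[OF Hu]] l2_norm_nonneg])
      also have "\<dots> = (c * l2_norm ?M f) * grad_norm \<Omega> u" by (simp add: mult_ac)
      finally have "grad_norm \<Omega> u \<le> (c * l2_norm ?M f) / \<nu>"
        by (rule le_of_weighted_square_le[OF grad_norm_nonneg \<nu>, rotated]) (use c in \<open>simp add: l2_norm_nonneg\<close>)
      then show ?thesis by simp
    qed
    \<comment> \<open>The difference of the two problems, tested with both velocities.\<close>
    have diff: "grad_norm \<Omega> w \<le> k * c / \<nu> * B * grad_norm \<Omega> u"
    proof -
      have gL: "L2 ?M (wderiv \<Omega> j u)" "L2 ?M (wderiv \<Omega> j v)" for j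
        by (rule H1_wderiv_L2[OF \<Omega>(1) H(1)], rule H1_wderiv_L2[OF \<Omega>(1) H(2)])
      have "(l2_norm ?M (wderiv \<Omega> j w))\<^sup>2 = (\<integral>x. wderiv \<Omega> j u x \<bullet> wderiv \<Omega> j u x \<partial>?M) - (\<integral>x. wderiv \<Omega> j u x \<bullet> wderiv \<Omega> j v x \<partial>?M)
          - (\<integral>x. wderiv \<Omega> j v x \<bullet> wderiv \<Omega> j u x \<partial>?M) + (\<integral>x. wderiv \<Omega> j v x \<bullet> wderiv \<Omega> j v x \<partial>?M)" for j
      proof -
        have "(l2_norm ?M (wderiv \<Omega> j w))\<^sup>2 = (\<integral>x. (norm (wderiv \<Omega> j u x - wderiv \<Omega> j v x))\<^sup>2 \<partial>?M)"
          unfolding w_def[abs_def] l2_norm_wderiv_diff[OF \<Omega>(1) H] by (rule l2_norm_squared)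
        also have "\<dots> = (\<integral>x. wderiv \<Omega> j u x \<bullet> wderiv \<Omega> j u x - wderiv \<Omega> j u x \<bullet> wderiv \<Omega> j v x
            - wderiv \<Omega> j v x \<bullet> wderiv \<Omega> j u x + wderiv \<Omega> j v x \<bullet> wderiv \<Omega> j v x \<partial>?M)"
        proof (intro Bochner_Integration.integral_cong refl)
          have "(norm (y - z))\<^sup>2 = y \<bullet> y - y \<bullet> z - z \<bullet> y + z \<bullet> z" for y z :: "complex^'n"
            unfolding power2_norm_eq_inner inner_diff_left inner_diff_right by linarith
          then show "(norm (wderiv \<Omega> j u x - wderiv \<Omega> j v x))\<^sup>2 = wderiv \<Omega> j u x \<bullet> wderiv \<Omega> j u x - wderiv \<Omega> j u x \<bullet> wderiv \<Omega> j v x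
            - wderiv \<Omega> j v x \<bullet> wderiv \<Omega> j u x + wderiv \<Omega> j v x \<bullet> wderiv \<Omega> j v x" for x .
        qed
        finally show ?thesis
          using L2_integrable_inner[OF gL(1) gL(1)] L2_integrable_inner[OF gL(1) gL(2)]
            L2_integrable_inner[OF gL(2) gL(1)] L2_integrable_inner[OF gL(2) gL(2)] by simp
      qed
      then have "(grad_norm \<Omega> w)\<^sup>2 = a u u - a u v - a v u + a v v"
        unfolding grad_norm_squared a_def by (simp add: sum.distrib sum_subtractf)
      then have "\<nu> * (grad_norm \<Omega> w)\<^sup>2 = \<nu> * (a u u - a u v - a v u + a v v)" by simp
      also have "\<dots> = (\<nu> * a u u - \<nu> * a v u) - (\<nu> * a u v - \<nu> * a v v)"
        by (simp add: algebra_simps)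
      also have "\<nu> * a u u - \<nu> * a v u = - (\<integral>x. F x \<bullet> u x \<partial>?M)"
        using oseen[OF Hu divs(1)[OF zm(1)]] stokes[OF Hu divs(1)[OF zm(2)]] by linarith
      also have "\<nu> * a u v - \<nu> * a v v = - (\<integral>x. F x \<bullet> v x \<partial>?M)"
        using oseen[OF Hv divs(2)[OF zm(1)]] stokes[OF Hv divs(2)[OF zm(2)]] by linarith
      also have "- (\<integral>x. F x \<bullet> u x \<partial>?M) - - (\<integral>x. F x \<bullet> v x \<partial>?M) = - (\<integral>x. F x \<bullet> w x \<partial>?M)"
        using L2_integrable_inner[OF FL uv(1)] L2_integrable_inner[OF FL uv(2)] by (simp add: w_def inner_diff_right)
      also have "\<dots> \<le> l2_norm ?M F * l2_norm ?M w" using abs_integral_inner_le[OF FL wL] by linarith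
      also have "\<dots> \<le> (k * B * grad_norm \<Omega> u) * (c * grad_norm \<Omega> w)"
        using convection_L2(2)[OF \<Omega>(1,3) \<beta>(1) H(1)] poincare_grad[OF tw] k B0
        by (intro mult_mono) (auto simp: F_def k_def B_def l2_norm_nonneg grad_norm_nonneg)
      also have "\<dots> = (k * c * B * grad_norm \<Omega> u) * grad_norm \<Omega> w" by (simp add: mult_ac)
      finally have "grad_norm \<Omega> w \<le> (k * c * B * grad_norm \<Omega> u) / \<nu>"
        by (rule le_of_weighted_square_le[OF grad_norm_nonneg \<nu>, rotated]) (use c k B0 in \<open>simp add: grad_norm_nonneg\<close>)
      then show ?thesis by simp
    qed
    have "h1_norm \<Omega> w \<le> sqrt ((c * grad_norm \<Omega> w)\<^sup>2 + (grad_norm \<Omega> w)\<^sup>2)"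
      unfolding h1_norm_grad_norm
      by (intro real_sqrt_le_mono add_right_mono power_mono poincare_grad[OF tw] l2_norm_nonneg)
    also have "\<dots> = sqrt ((c\<^sup>2 + 1) * (grad_norm \<Omega> w)\<^sup>2)" by (simp add: power_mult_distrib distrib_right)
    also have "\<dots> = sqrt (c\<^sup>2 + 1) * grad_norm \<Omega> w" by (simp add: real_sqrt_mult grad_norm_nonneg)
    also have "\<dots> \<le> sqrt (c\<^sup>2 + 1) * (k * c / \<nu> * B * (c / \<nu> * l2_norm ?M f))"
    proof (rule mult_left_mono)
      have "k * c / \<nu> * B * grad_norm \<Omega> u \<le> k * c / \<nu> * B * (c / \<nu> * l2_norm ?M f)"
        using c \<nu> k B0 by (intro mult_left_mono energy) auto
      with diff show "grad_norm \<Omega> w \<le> k * c / \<nu> * B * (c / \<nu> * l2_norm ?M f)" by linarith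
    qed simp
    also have "\<dots> = C * B * l2_norm ?M f" by (simp add: C_def)
    finally show ?thesis unfolding w_def[abs_def] u_def v_def B_def .
  qed
  with C show ?thesis by blast
qed

end
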